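(* Let $\lambda>1$, $\mu>1$, $\Delta_1=[-\mu,-1]$, $\Delta_2=[1,\lambda]$, and let $\mathcal R$, $\pi$, $\psi^{(1)}$, $\psi^{(2)}$ be as in the context. Then the algebraic system $$ \begin{cases} 2\,(a+\alpha)(3-a\alpha-a-\alpha)(3-a\alpha+a+\alpha)+(\lambda-\mu)(a-\alpha)^3=0,\\ (\lambda+\mu)^2(a-\alpha)^6=4\,(3+a\alpha)^3(1-a\alpha)(2+a+\alpha)(2-a-\alpha) \end{cases} $$ has a unique solution $(\alpha,a)$ with $-1<\alpha<a<1$. For this solution, the equation $$x^2+(a+\alpha)x+\frac{(a-\alpha)^2}{1-a\alpha}-3=0$$ has two real solutions $\beta<-1$ and $b>1$. Put $$h=\frac14(a+\alpha)\Big(2a\alpha-\frac{(a-\alpha)^2}{1-a\alpha}\Big),\quad A=\frac14(1-\beta)(1-\alpha)(1-a)(1-b),\quad B=\frac14(1+\beta)(1+\alpha)(1+a)(1+b),$$ $$H(z)=h+z+\frac{Az}{1-z}+\frac{Bz}{1+z},\qquad G(z)=\frac{H(z)}{H(a)}.$$ Then $G$ is a rational function of degree $3$ which lifts to a conformal homeomorphism $g:\overline{\mathbb C}\to\mathcal R$ with $\pi\circ g=G$, and, writing $G^{-1}:=g^{-1}:\mathcal R\to\overline{\mathbb C}$, $$\psi^{(1)}=\frac{1}{H(a)}\,(1+G^{-1}),\qquad \psi^{(2)}=\frac{A}{2H(a)}\,\frac{1+G^{-1}}{1-G^{-1}}.$$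
   Context: $\overline{\mathbb C}$ is the extended complex plane. Given $\Delta_1=[-\mu,-1]$ and $\Delta_2=[1,\lambda]$, $\mathcal R$ is the compact three-sheeted Riemann surface formed by the sheets $\mathcal R_0=\overline{\mathbb C}\setminus\Delta_1$, $\mathcal R_1=\overline{\mathbb C}\setminus(\Delta_1\cup\Delta_2)$, $\mathcal R_2=\overline{\mathbb C}\setminus\Delta_2$, where $\mathcal R_0$ and $\mathcal R_1$ are glued crosswise along $\Delta_1$ (upper bank of one identified with lower bank of the other) and $\mathcal R_1$ and $\mathcal R_2$ are glued crosswise along $\Delta_2$. It is a branched cover of $\overline{\mathbb C}$ with projection $\pi$, and has genus $0$. For $w\in\overline{\mathbb C}$, $w^{(k)}$ denotes the point of sheet $\mathcal R_k$ projecting to $w$. For $l\in\{1,2\}$, $\psi^{(l)}$ denotes the conformal map of $\mathcal R$ onto $\overline{\mathbb C}$ such that $\psi^{(l)}(w)=w+O(1)$ as $w\to\infty^{(l)}$ and $\psi^{(l)}(w)=C_1/w+O(1/w^2)$ as $w\to\infty^{(0)}$ for some constant $C_1$. *)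

theory Defs
  imports "HOL-Analysis.Analysis" "HOL-Computational_Algebra.Polynomial"
begin

text \<open>Points of the extended complex plane: None is the point at infinity,
  Some z is the finite point z.\<close>
type_synonym ecomplex = "complex option"

definition ext_top :: "ecomplex topology" where
  "ext_top = topology (\<lambda>U. open {z. Some z \<in> U} \<and>
      (None \<in> U \<longrightarrow> (\<exists>r. \<forall>z. r < cmod z \<longrightarrow> Some z \<in> U)))"

definition UH :: "ecomplex set" where "UH = insert None (Some ` {z. Im z \<ge> 0})"
definition LH :: "ecomplex set" where "LH = insert None (Some ` {z. Im z \<le> 0})"

definition emob :: "complex \<Rightarrow> complex \<Rightarrow> complex \<Rightarrow> complex \<Rightarrow> ecomplex \<Rightarrow> ecomplex" where
  "emob a b c d w = (case w of
      None \<Rightarrow> (if c = 0 then None else Some (a / c))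
    | Some z \<Rightarrow> (if c * z + d = 0 then None else Some ((a * z + b) / (c * z + d))))"

text \<open>A point of R is written (k, w): k \<in> {0,1,2} is the sheet, w the projection.
  Points of sheet k lying over the interior of a cut of sheet k represent the
  point reached from the UPPER bank of that cut on sheet k.  The four branch
  points over -mu, -1 (joining sheets 0,1) and over 1, lam (joining sheets 1,2)
  are represented canonically by (0,-mu), (0,-1), (1,1), (1,lam).\<close>
type_synonym rpt = "nat \<times> ecomplex"

definition canon :: "real \<Rightarrow> real \<Rightarrow> rpt \<Rightarrow> rpt" where
  "canon lam mu p = (case p of (k, w) \<Rightarrow>
     if k = 1 \<and> (w = Some (complex_of_real (-mu)) \<or> w = Some (-1)) then (0, w)
     else if k = 2 \<and> (w = Some 1 \<or> w = Some (complex_of_real lam)) then (1, w)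
     else (k, w))"

definition R_pts :: "real \<Rightarrow> real \<Rightarrow> rpt set" where
  "R_pts lam mu = {canon lam mu (k, w) | k w. k < 3}"

definition proj :: "rpt \<Rightarrow> ecomplex" where "proj p = snd p"

text \<open>Point of R reached from the LOWER bank of sheet k over the real point x
  (crosswise gluing: lower bank of sheet 0 = upper bank of sheet 1 over Delta_1,
  etc.).\<close>
definition lowerpt :: "real \<Rightarrow> real \<Rightarrow> nat \<Rightarrow> real \<Rightarrow> rpt" where
  "lowerpt lam mu k x =
     (if (k = 0 \<or> k = 1) \<and> -mu < x \<and> x < -1 then (1 - k, Some (complex_of_real x))
      else if (k = 1 \<or> k = 2) \<and> 1 < x \<and> x < lam then (3 - k, Some (complex_of_real x))
      else canon lam mu (k, Some (complex_of_real x)))"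

definition chart_up :: "real \<Rightarrow> real \<Rightarrow> nat \<Rightarrow> ecomplex \<Rightarrow> rpt" where
  "chart_up lam mu k w = canon lam mu (k, w)"

definition chart_low :: "real \<Rightarrow> real \<Rightarrow> nat \<Rightarrow> ecomplex \<Rightarrow> rpt" where
  "chart_low lam mu k w = (case w of
      Some z \<Rightarrow> (if Im z = 0 then lowerpt lam mu k (Re z) else canon lam mu (k, w))
    | None \<Rightarrow> canon lam mu (k, None))"

text \<open>The topology of R: the quotient (final) topology of the six closed
  half-sheets glued as described.\<close>
definition R_top :: "real \<Rightarrow> real \<Rightarrow> rpt topology" where
  "R_top lam mu = topology (\<lambda>U. U \<subseteq> R_pts lam mu \<and>
      (\<forall>k<3. openin (subtopology ext_top UH) {w \<in> UH. chart_up lam mu k w \<in> U} \<and>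
             openin (subtopology ext_top LH) {w \<in> LH. chart_low lam mu k w \<in> U}))"

definition sheet_open :: "real \<Rightarrow> real \<Rightarrow> nat \<Rightarrow> complex set" where
  "sheet_open lam mu k = {z. \<not> (Im z = 0 \<and>
      (((k = 0 \<or> k = 1) \<and> -mu \<le> Re z \<and> Re z \<le> -1) \<or>
       ((k = 1 \<or> k = 2) \<and> 1 \<le> Re z \<and> Re z \<le> lam)))}"

definition mero_at :: "(complex \<Rightarrow> ecomplex) \<Rightarrow> complex \<Rightarrow> bool" where
  "mero_at F w \<longleftrightarrow>
     (\<exists>r>0. (\<forall>z\<in>ball w r. F z \<noteq> None) \<and> (\<lambda>z. the (F z)) holomorphic_on ball w r) \<or>
     (\<exists>r>0. (\<forall>z\<in>ball w r. F z \<noteq> Some 0) \<and>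
        (\<lambda>z. case F z of None \<Rightarrow> 0 | Some c \<Rightarrow> inverse c) holomorphic_on ball w r)"

text \<open>Conformal map of R onto the extended plane: a homeomorphism which is
  holomorphic in the local coordinate on the open parts of the sheets (by the
  removable singularity theorem this is equivalent to holomorphy in all local
  coordinates of R).\<close>
definition conformal_R :: "real \<Rightarrow> real \<Rightarrow> (rpt \<Rightarrow> ecomplex) \<Rightarrow> bool" where
  "conformal_R lam mu f \<longleftrightarrow> homeomorphic_map (R_top lam mu) ext_top f \<and>
     (\<forall>k<3. \<forall>w\<in>sheet_open lam mu k. mero_at (\<lambda>z. f (k, Some z)) w)"

definition is_psi :: "real \<Rightarrow> real \<Rightarrow> nat \<Rightarrow> (rpt \<Rightarrow> ecomplex) \<Rightarrow> bool" where
  "is_psi lam mu l f \<longleftrightarrow> conformal_R lam mu f \<and>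
     (\<exists>M. \<forall>\<^sub>F w in at_infinity. \<exists>c. f (l, Some w) = Some c \<and> cmod (c - w) \<le> M) \<and>
     (\<exists>C1 M. \<forall>\<^sub>F w in at_infinity. \<exists>c. f (0, Some w) = Some c \<and>
         cmod (c - C1 / w) \<le> M / (cmod w)\<^sup>2)"

definition rational_of_degree :: "nat \<Rightarrow> (complex \<Rightarrow> complex) \<Rightarrow> bool" where
  "rational_of_degree n G \<longleftrightarrow> (\<exists>p q :: complex poly. q \<noteq> 0 \<and> coprime p q \<and>
      max (degree p) (degree q) = n \<and> (\<forall>z. poly q z \<noteq> 0 \<longrightarrow> G z = poly p z / poly q z))"

end

theory Submission
  imports Defs "HOL-Complex_Analysis.Complex_Analysis"
    "HOL-Computational_Algebra.Fundamental_Theorem_Algebra"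
begin

text \<open>
  The coefficients are chosen so that H has the critical points beta, alpha, a, b, and the two
  equations of the system say that their G-values are -mu, -1, 1, lambda. As A and B are negative,
  the imaginary part of G(z) is Im z times a function W that is positive outside two ovals around
  the poles -1 and 1 and negative inside them. The three regions cut out by the ovals are the three
  sheets: a connectedness argument shows that each half of a region is mapped onto a closed half
  plane, and since G(z) = w is a cubic equation in z and the half-regions belonging to the same
  half plane meet only in critical points, which are double roots, these maps are injective.
  The inverse branches glue to a continuous bijection from the compact surface onto the sphere.

  For uniqueness of psi, compose with G: the composition is continuous and, by the
  pasting theorem across a line in the local coordinate G, holomorphic off finitely many points, so
  Liouville's theorem identifies it. Uniqueness of psi in turn gives uniqueness of (alpha, a): from
  psi^(1) one recovers H(a) and the preimages of the branch points. Existence of (alpha, a)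
  follows from the intermediate value theorem along the curve defined by the first equation.
\<close>

text \<open>Origin of the data: up to a factor and an affine change of variable, a map of degree 3
  with simple poles at infinity, 1 and -1 has the form of H. Comparing (1 - z^2)^2 H'(z) with the
  product over \<beta>, \<alpha>, a, b shows that the critical points have sum 0 and that their
  elementary symmetric functions satisfy e4 - e2 = 3. Given \<alpha> and a, these two conditions
  amount to the quadratic equation for \<beta> and b; evaluation at 1 and -1 gives 4A and 4B, and h
  is fixed by H(\<alpha>) = -H(a). Surjectivity onto each half plane comes before injectivity: once
  each of the three half-regions over a half plane is known to hold a root of the cubic, a second
  root in one of them is one too many, unless roots coincide on an oval. The surface is glued from
  closed half planes, so the branches of the inverse live on closed half planes as well. They remain
  to be compared along the real axis: off the cuts the two branches of a sheet agree, on a cut those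
  of the two glued sheets cross over.\<close>

section \<open>The topology of the extended plane\<close>

text \<open>The definition states the topology by hand. Recognizing it as the one-point
  compactification yields compactness and the Hausdorff property, on which the homeomorphism proofs
  below rest.\<close>

lemma ext_top_eq: "ext_top = Alexandroff_compactification euclidean"
proof -
  have "openin (Alexandroff_compactification euclidean) U \<longleftrightarrow>
      open {z. Some z \<in> U} \<and> (None \<in> U \<longrightarrow> (\<exists>r. \<forall>z. r < cmod z \<longrightarrow> Some z \<in> U))" for U :: "ecomplex set"
  proof (cases "None \<in> U")
    case True
    have U: "U = insert None (Some ` (UNIV - {z. Some z \<notin> U}))"
    proof (rule set_eqI)
      fix x show "x \<in> U \<longleftrightarrow> x \<in> insert None (Some ` (UNIV - {z. Some z \<notin> U}))"
        using True by (cases x) auto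
    qed
    have "openin (Alexandroff_compactification euclidean) U \<longleftrightarrow> compact {z. Some z \<notin> U}"
    proof
      assume "openin (Alexandroff_compactification euclidean) U"
      then obtain C where "compact C" "U = insert None (Some ` (UNIV - C))"
        using True by (auto simp: openin_Alexandroff_compactification)
      then have "{z. Some z \<notin> U} = C" by auto
      then show "compact {z. Some z \<notin> U}" using \<open>compact C\<close> by simp
    next
      assume "compact {z. Some z \<notin> U}"
      then show "openin (Alexandroff_compactification euclidean) U"
        unfolding openin_Alexandroff_compactification
        by (intro disjI2 exI[of _ "{z. Some z \<notin> U}"]) (use U compact_imp_closed in simp)
    qed
    also have "\<dots> \<longleftrightarrow> open {z. Some z \<in> U} \<and> (\<exists>r. \<forall>z. r < cmod z \<longrightarrow> Some z \<in> U)"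
    proof -
      have "closed {z. Some z \<notin> U} \<longleftrightarrow> open {z. Some z \<in> U}"
        by (simp add: closed_def Compl_eq)
      moreover have "bounded {z. Some z \<notin> U} \<longleftrightarrow> (\<exists>r. \<forall>z. r < cmod z \<longrightarrow> Some z \<in> U)"
        by (simp add: bounded_iff linorder_not_le[symmetric]) metis
      ultimately show ?thesis by (simp add: compact_eq_bounded_closed conj_commute)
    qed
    finally show ?thesis using True by simp
  next
    case False
    have U: "U = Some ` {z. Some z \<in> U}"
    proof (rule set_eqI)
      fix x show "x \<in> U \<longleftrightarrow> x \<in> Some ` {z. Some z \<in> U}"
        using False by (cases x) auto
    qed
    have "openin (Alexandroff_compactification euclidean) U \<longleftrightarrow> open {z. Some z \<in> U}"
      by (subst U) (simp only: openin_Alexandroff_compactification_image_Some open_openin)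
    then show ?thesis using False by simp
  qed
  then have "ext_top = topology (openin (Alexandroff_compactification euclidean))"
    unfolding ext_top_def by (intro arg_cong[where f = topology]) (auto simp: fun_eq_iff)
  then show ?thesis by (simp add: openin_inverse)
qed

lemma openin_ext_top:
  "openin ext_top U \<longleftrightarrow>
     open {z. Some z \<in> U} \<and> (None \<in> U \<longrightarrow> (\<exists>r. \<forall>z. r < cmod z \<longrightarrow> Some z \<in> U))"
proof -
  have "istopology (\<lambda>U. open {z. Some z \<in> U} \<and>
      (None \<in> U \<longrightarrow> (\<exists>r. \<forall>z::complex. r < cmod z \<longrightarrow> Some z \<in> U)))" (is "istopology ?P")
    unfolding istopology_def
  proof (intro conjI allI impI)
    fix S T :: "ecomplex set" assume "?P S" "?P T"
    then show "open {z. Some z \<in> S \<inter> T}" by (simp add: open_Collect_conj)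
  next
    fix S T :: "ecomplex set" assume S: "?P S" and T: "?P T" and "None \<in> S \<inter> T"
    then obtain r s where "\<forall>z. r < cmod z \<longrightarrow> Some z \<in> S" "\<forall>z. s < cmod z \<longrightarrow> Some z \<in> T" by auto
    then have "\<forall>z. max r s < cmod z \<longrightarrow> Some z \<in> S \<inter> T" by auto
    then show "\<exists>r. \<forall>z. r < cmod z \<longrightarrow> Some z \<in> S \<inter> T" by blast
  next
    fix \<K> :: "ecomplex set set" assume K: "\<forall>K\<in>\<K>. ?P K"
    have "{z. Some z \<in> \<Union>\<K>} = (\<Union>K\<in>\<K>. {z. Some z \<in> K})" by auto
    then show "open {z. Some z \<in> \<Union>\<K>}" using K by auto
  next
    fix \<K> :: "ecomplex set set" assume "\<forall>K\<in>\<K>. ?P K" "None \<in> \<Union>\<K>"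
    then show "\<exists>r. \<forall>z. r < cmod z \<longrightarrow> Some z \<in> \<Union>\<K>" by blast
  qed
  then show ?thesis by (simp add: ext_top_def topology_inverse')
qed

lemma topspace_ext_top [simp]: "topspace ext_top = UNIV"
  by (simp add: ext_top_eq UNIV_option_conv)

lemma compact_space_ext_top: "compact_space ext_top"
  by (simp add: ext_top_eq)

lemma Hausdorff_space_ext_top: "Hausdorff_space ext_top"
  by (simp add: ext_top_eq Hausdorff_space_Alexandroff_compactification locally_compact_space_euclidean)

lemma openin_ext_Some: "open V \<Longrightarrow> openin ext_top (Some ` V)"
  by (simp add: ext_top_eq)

section \<open>Limits and continuity on the sphere\<close>

lemma limitin_ext_top:
  "limitin ext_top F l X \<longleftrightarrow> (\<forall>U. openin ext_top U \<longrightarrow> l \<in> U \<longrightarrow> (\<forall>\<^sub>F x in X. F x \<in> U))"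
  by (auto simp: limitin_def)

lemma continuous_map_extI:
  assumes fin: "\<And>z. limitin ext_top (\<lambda>u. F (Some u)) (F (Some z)) (nhds z)"
    and inf: "limitin ext_top (\<lambda>u. F (Some u)) (F None) at_infinity"
  shows "continuous_map ext_top ext_top F"
proof -
  have "openin ext_top {x. F x \<in> U}" if U: "openin ext_top U" for U
    unfolding openin_ext_top
  proof (intro conjI impI)
    have "\<exists>T. open T \<and> z \<in> T \<and> T \<subseteq> {z. Some z \<in> {x. F x \<in> U}}" if "F (Some z) \<in> U" for z
      using fin[of z] U that unfolding limitin_ext_top eventually_nhds
      by (simp add: subset_iff) metis
    then show "open {z. Some z \<in> {x. F x \<in> U}}"
      by (subst open_subopen) auto
  next
    assume "None \<in> {x. F x \<in> U}"
    then have "\<forall>\<^sub>F u in at_infinity. F (Some u) \<in> U"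
      using inf U unfolding limitin_ext_top by auto
    then obtain b where "\<And>z. b \<le> cmod z \<Longrightarrow> F (Some z) \<in> U" unfolding eventually_at_infinity by blast
    then show "\<exists>r. \<forall>z. r < cmod z \<longrightarrow> Some z \<in> {x. F x \<in> U}"
      by (intro exI[of _ b]) auto
  qed
  then show ?thesis by (simp add: continuous_map_def)
qed

lemma limitin_ext_SomeI:
  assumes "(f \<longlongrightarrow> c) X" "\<forall>\<^sub>F x in X. F x = Some (f x)"
  shows "limitin ext_top F (Some c) X"
  unfolding limitin_ext_top
proof (intro allI impI)
  fix U assume "openin ext_top U" "Some c \<in> U"
  then have "open {z. Some z \<in> U}" "c \<in> {z. Some z \<in> U}" by (auto simp: openin_ext_top)
  then have "\<forall>\<^sub>F x in X. f x \<in> {z. Some z \<in> U}" using assms(1) topological_tendstoD by blast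
  then show "\<forall>\<^sub>F x in X. F x \<in> U" using assms(2) by eventually_elim auto
qed

lemma limitin_ext_NoneI:
  assumes "filterlim f at_infinity X" "\<forall>\<^sub>F x in X. F x = None \<or> F x = Some (f x)"
  shows "limitin ext_top F None X"
  unfolding limitin_ext_top
proof (intro allI impI)
  fix U assume U: "openin ext_top U" "None \<in> U"
  then obtain r where "\<forall>z. r < cmod z \<longrightarrow> Some z \<in> U" by (auto simp: openin_ext_top)
  moreover have "\<forall>\<^sub>F x in X. r + 1 \<le> cmod (f x)"
    using assms(1) unfolding filterlim_at_infinity_conv_norm_at_top filterlim_at_top by blast
  then have "\<forall>\<^sub>F x in X. r < cmod (f x)" by eventually_elim simp
  ultimately show "\<forall>\<^sub>F x in X. F x \<in> U" using assms(2) U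
    by (smt (verit, best) eventually_elim2)
qed

lemma limitin_ext_None_nhdsI:
  assumes "filterlim f at_infinity (at z)" "\<forall>\<^sub>F x in at z. F x = Some (f x)" "F z = None"
  shows "limitin ext_top F None (nhds z)"
proof -
  have "limitin ext_top F None (at z)" using assms by (intro limitin_ext_NoneI) (auto elim: eventually_mono)
  then show ?thesis using assms(3)
    unfolding limitin_ext_top by (auto simp: eventually_nhds_conv_at)
qed

lemma continuous_map_ext_limitin:
  assumes "continuous_map (subtopology ext_top T) ext_top F" "z \<in> S" "Some ` S \<subseteq> T"
  shows "limitin ext_top (\<lambda>u. F (Some u)) (F (Some z)) (at z within S)"
  unfolding limitin_ext_top
proof (intro allI impI)
  fix U assume U: "openin ext_top U" "F (Some z) \<in> U"
  have "openin (subtopology ext_top T) {x \<in> T. F x \<in> U}"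
    using openin_continuous_map_preimage[OF assms(1) U(1)] by (simp add: topspace_subtopology)
  then obtain V where V: "openin ext_top V" "{x \<in> T. F x \<in> U} = V \<inter> T"
    unfolding openin_subtopology by auto
  then have "open {z. Some z \<in> V}" by (simp add: openin_ext_top)
  moreover have "z \<in> {z. Some z \<in> V}" using assms U V by auto
  ultimately have "\<forall>\<^sub>F u in nhds z. Some u \<in> V" using eventually_nhds by blast
  then show "\<forall>\<^sub>F u in at z within S. F (Some u) \<in> U"
    unfolding eventually_at_filter
  proof (rule eventually_mono, intro impI)
    fix u assume "Some u \<in> V" "u \<in> S"
    then have "Some u \<in> V \<inter> T" using assms(3) by auto
    then show "F (Some u) \<in> U" using V(2) by auto
  qed
qed

lemma limitin_ext_SomeD:
  assumes "limitin ext_top F (Some c) X" "\<forall>\<^sub>F x in X. F x = Some (f x)"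
  shows "(f \<longlongrightarrow> c) X"
proof (rule topological_tendstoI)
  fix S assume S: "open S" "c \<in> S"
  then have "\<forall>\<^sub>F x in X. F x \<in> Some ` S"
    using assms(1) openin_ext_Some unfolding limitin_ext_top by blast
  then show "\<forall>\<^sub>F x in X. f x \<in> S" using assms(2) by eventually_elim auto
qed

lemma continuous_on_ext_the:
  assumes "continuous_map (subtopology ext_top T) ext_top F" "Some ` S \<subseteq> T"
    and "\<And>z. z \<in> S \<Longrightarrow> F (Some z) = Some (f z)"
  shows "continuous_on S f"
  unfolding continuous_on_def
proof
  fix z assume z: "z \<in> S"
  show "(f \<longlongrightarrow> f z) (at z within S)"
    using continuous_map_ext_limitin[OF assms(1) z assms(2)] assms(3) z
    by (intro limitin_ext_SomeD[where F = "\<lambda>u. F (Some u)"]) (auto simp: eventually_at_filter)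
qed

text \<open>A continuous bijection of a compact Hausdorff space is a homeomorphism. Bijectivity
  comes from the adjugate matrix, which has the same determinant.\<close>

lemma emob_homeomorphic:
  assumes "a * d - b * c \<noteq> 0"
  shows "homeomorphic_map ext_top ext_top (emob a b c d)"
proof -
  have "continuous_map ext_top ext_top (emob a b c d)"
  proof (rule continuous_map_extI)
    fix z
    show "limitin ext_top (\<lambda>u. emob a b c d (Some u)) (emob a b c d (Some z)) (nhds z)"
    proof (cases "c * z + d = 0")
      case False
      have "\<forall>\<^sub>F u in nhds z. c * u + d \<noteq> 0"
        by (rule tendsto_imp_eventually_ne[where c = "c * z + d"])
           (use False in \<open>auto intro!: tendsto_eq_intros filterlim_ident\<close>)
      then have ev: "\<forall>\<^sub>F u in nhds z. emob a b c d (Some u) = Some ((a * u + b) / (c * u + d))"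
        by eventually_elim (simp add: emob_def)
      show ?thesis using False
        by (subst (2) emob_def) (auto intro!: limitin_ext_SomeI[OF _ ev] tendsto_eq_intros filterlim_ident)
    next
      case True
      then have c: "c \<noteq> 0" using assms by auto
      \<comment> \<open>Numerator and denominator have no common zero, since the determinant is a
        combination of the two.\<close>
      have n: "a * z + b \<noteq> 0"
      proof
        assume "a * z + b = 0"
        moreover have "a * d - b * c = a * (c * z + d) - c * (a * z + b)" by (simp add: algebra_simps)
        ultimately show False using assms True by simp
      qed
      have nz: "c * u + d \<noteq> 0" if "u \<noteq> z" for u
      proof
        assume "c * u + d = 0"
        then have "c * u = c * z" using True by (metis add_right_cancel)
        then show False using c that by simp
      qed
      have ev: "\<forall>\<^sub>F u in at z. emob a b c d (Some u) = Some ((a * u + b) / (c * u + d))"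
        by (auto simp: eventually_at_filter emob_def nz)
      have "filterlim (\<lambda>u. (a * u + b) / (c * u + d)) at_infinity (at z)"
        using True n nz
        by (intro filterlim_divide_at_infinity[where c = "a * z + b"])
           (auto intro!: tendsto_eq_intros simp: filterlim_at eventually_at_filter)
      then show ?thesis using ev True
        by (subst (2) emob_def) (auto intro!: limitin_ext_None_nhdsI simp: emob_def)
    qed
  next
    show "limitin ext_top (\<lambda>u. emob a b c d (Some u)) (emob a b c d None) at_infinity"
    proof (cases "c = 0")
      case True
      then have ad: "a \<noteq> 0" "d \<noteq> 0" using assms by auto
      have "filterlim (\<lambda>u. b / d + a / d * u) at_infinity at_infinity"
        using ad by (intro tendsto_add_filterlim_at_infinity[OF tendsto_const]
           tendsto_mult_filterlim_at_infinity[OF tendsto_const]) (auto simp: filterlim_ident)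
      then show ?thesis using True ad
        by (subst (2) emob_def) (auto intro!: limitin_ext_NoneI simp: emob_def add_divide_distrib)
    next
      case False
      have "filterlim (\<lambda>u. c * u + d) at_infinity at_infinity"
        using False by (intro tendsto_add_filterlim_at_infinity'[OF _ tendsto_const]
           tendsto_mult_filterlim_at_infinity[OF tendsto_const]) (auto simp: filterlim_ident)
      then have "((\<lambda>u. inverse (c * u + d)) \<longlongrightarrow> 0) at_infinity" and
         nz: "\<forall>\<^sub>F u in at_infinity. c * u + d \<noteq> 0"
        by (auto simp: filterlim_at_infinity_imp_eventually_ne intro: filterlim_compose[OF tendsto_inverse_0])
      then have "((\<lambda>u. a / c + (b - a * d / c) * inverse (c * u + d)) \<longlongrightarrow> a / c + (b - a * d / c) * 0) at_infinity"
        by (intro tendsto_intros)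
      moreover have "\<forall>\<^sub>F u in at_infinity. emob a b c d (Some u) = Some (a / c + (b - a * d / c) * inverse (c * u + d))"
        using nz
      proof eventually_elim
        fix u assume u: "c * u + d \<noteq> 0"
        have g: "(x * v + y) / v = x + y * inverse v" if "v \<noteq> 0" for x y v :: complex
          using that by (simp add: field_simps)
        have "a * u + b = a / c * (c * u + d) + (b - a * d / c)" using False by (simp add: distrib_left)
        then have "(a * u + b) / (c * u + d) = a / c + (b - a * d / c) * inverse (c * u + d)"
          using u g by metis
        then show "emob a b c d (Some u) = Some (a / c + (b - a * d / c) * inverse (c * u + d))"
          using u by (simp add: emob_def)
      qed
      ultimately have "limitin ext_top (\<lambda>u. emob a b c d (Some u)) (Some (a / c + (b - a * d / c) * 0)) at_infinity"
        by (rule limitin_ext_SomeI)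
      then show ?thesis using False by (subst (2) emob_def) simp
    qed
  qed
  \<comment> \<open>The coefficients are rebound, so that the same fact applied to the adjugate
    matrix gives surjectivity.\<close>
  moreover have inv: "emob d (-b) (-c) a (emob a b c d w) = w" if ne: "a * d - b * c \<noteq> 0" for a b c d w
  proof (cases w)
    case None
    then show ?thesis using ne by (auto simp: emob_def field_simps)
  next
    case (Some z)
    show ?thesis
    proof (cases "c * z + d = 0")
      case True
      have "c \<noteq> 0" using ne True by auto
      moreover from this have "z = - d / c"
        using True by (simp only: nonzero_eq_divide_eq eq_neg_iff_add_eq_0 mult.commute not_False_eq_True)
      ultimately show ?thesis using Some True by (auto simp: emob_def)
    next
      case False
      define u where "u = (a * z + b) / (c * z + d)"
      have e: "emob a b c d (Some z) = Some u" using False by (simp add: emob_def u_def)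
      have 1: "- c * u + a = (a * d - b * c) / (c * z + d)"
        using False by (simp add: u_def field_simps)
      have 2: "d * u + - b = z * (a * d - b * c) / (c * z + d)"
        using False by (simp add: u_def field_simps)
      have "- c * u + a \<noteq> 0" "(d * u + - b) / (- c * u + a) = z"
        unfolding 1 2 using False ne by simp_all
      then show ?thesis by (simp add: Some e) (simp add: emob_def)
    qed
  qed
  have "range (emob a b c d) = UNIV"
  proof -
    have "emob a b c d (emob d (-b) (-c) a w) = w" for w
      using inv[of d a "-b" "-c" w] assms by (simp add: mult.commute)
    then show ?thesis by (metis surj_def)
  qed
  moreover have "inj (emob a b c d)" using inv[OF assms] by (metis injI)
  ultimately show ?thesis
    by (intro continuous_imp_homeomorphic_map)
       (simp_all add: compact_space_ext_top Hausdorff_space_ext_top)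
qed

section \<open>The topology of the surface\<close>

lemma half_plane_iff [simp]:
  "None \<in> UH" "None \<in> LH" "Some z \<in> UH \<longleftrightarrow> 0 \<le> Im z" "Some z \<in> LH \<longleftrightarrow> Im z \<le> 0"
  by (auto simp: UH_def LH_def)

lemma chart_up_in_R_pts: "k < 3 \<Longrightarrow> chart_up lam mu k w \<in> R_pts lam mu"
  by (auto simp: chart_up_def R_pts_def)

text \<open>\<open>canon\<close> is idempotent because the branch points of the two cuts differ: a
  point moved from sheet 2 to sheet 1 is not moved on to sheet 0.\<close>

lemma R_pts_iff:
  assumes "lam > 1" "mu > 1"
  shows "(k, w) \<in> R_pts lam mu \<longleftrightarrow> k < 3 \<and>
    \<not> (k = 1 \<and> (w = Some (complex_of_real (- mu)) \<or> w = Some (- 1))) \<and>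
    \<not> (k = 2 \<and> (w = Some 1 \<or> w = Some (complex_of_real lam)))" (is "_ \<longleftrightarrow> ?Q k w")
proof
  have ne: "complex_of_real lam \<noteq> - complex_of_real mu" "complex_of_real lam \<noteq> - 1"
     "1 \<noteq> - complex_of_real mu" "(1::complex) \<noteq> - 1"
    using assms by (auto simp: complex_eq_iff)
  assume "(k, w) \<in> R_pts lam mu"
  then obtain j v where "j < 3" "(k, w) = canon lam mu (j, v)" by (auto simp: R_pts_def)
  then show "?Q k w" using ne by (auto simp: canon_def split: if_splits)
next
  assume "?Q k w"
  then have "canon lam mu (k, w) = (k, w)" by (auto simp: canon_def)
  then show "(k, w) \<in> R_pts lam mu" using \<open>?Q k w\<close> unfolding R_pts_def
    by (intro CollectI exI[of _ k] exI[of _ w]) simp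
qed

lemma chart_low_in_R_pts:
  assumes "lam > 1" "mu > 1" "k < 3"
  shows "chart_low lam mu k w \<in> R_pts lam mu"
proof -
  have c: "canon lam mu (k, v) \<in> R_pts lam mu" for v
    using assms chart_up_in_R_pts by (simp add: chart_up_def)
  have 1: "(1 - k, Some (complex_of_real x)) \<in> R_pts lam mu" if "k = 0 \<or> k = 1" "-mu < x" "x < -1" for x
    using assms that by (auto simp: R_pts_iff complex_eq_iff)
  have 2: "(3 - k, Some (complex_of_real x)) \<in> R_pts lam mu" if "k = 1 \<or> k = 2" "1 < x" "x < lam" for x
    using assms that by (auto simp: R_pts_iff complex_eq_iff)
  show ?thesis using c 1 2 by (auto simp: chart_low_def lowerpt_def split: option.split)
qed

lemma openin_R_top:
  assumes "lam > 1" "mu > 1"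
  shows "openin (R_top lam mu) U \<longleftrightarrow> U \<subseteq> R_pts lam mu \<and>
      (\<forall>k<3. openin (subtopology ext_top UH) {w \<in> UH. chart_up lam mu k w \<in> U} \<and>
             openin (subtopology ext_top LH) {w \<in> LH. chart_low lam mu k w \<in> U})"
    (is "_ \<longleftrightarrow> ?P U")
proof -
  have i: "{w \<in> A. c w \<in> S \<inter> T} = {w \<in> A. c w \<in> S} \<inter> {w \<in> A. c w \<in> T}"
    and u: "{w \<in> A. c w \<in> \<Union>\<K>} = (\<Union>K\<in>\<K>. {w \<in> A. c w \<in> K})"
    for A :: "ecomplex set" and c :: "ecomplex \<Rightarrow> rpt" and S T \<K> by auto
  have "istopology ?P"
    unfolding istopology_def
  proof (intro conjI allI impI)
    fix S T k assume "?P S" "?P T" "k < (3::nat)"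
    then show "openin (subtopology ext_top UH) {w \<in> UH. chart_up lam mu k w \<in> S \<inter> T}"
      "openin (subtopology ext_top LH) {w \<in> LH. chart_low lam mu k w \<in> S \<inter> T}"
      unfolding i by (auto intro!: openin_Int)
  next
    fix \<K> k assume "\<forall>K\<in>\<K>. ?P K" "k < (3::nat)"
    then show "openin (subtopology ext_top UH) {w \<in> UH. chart_up lam mu k w \<in> \<Union>\<K>}"
      "openin (subtopology ext_top LH) {w \<in> LH. chart_low lam mu k w \<in> \<Union>\<K>}"
      unfolding u by (auto intro!: openin_Union)
  qed auto
  then show ?thesis unfolding R_top_def by (subst topology_inverse') auto
qed

lemma topspace_R_top:
  assumes "lam > 1" "mu > 1"
  shows "topspace (R_top lam mu) = R_pts lam mu"
proof -
  have "{w \<in> A. c w \<in> R_pts lam mu} = A" if "\<And>w. c w \<in> R_pts lam mu" for A :: "ecomplex set" and c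
    using that by auto
  moreover have "openin (subtopology ext_top A) A" for A
    by (metis inf_top.left_neutral openin_topspace topspace_ext_top topspace_subtopology)
  ultimately have "openin (R_top lam mu) (R_pts lam mu)"
    using assms by (simp add: openin_R_top chart_up_in_R_pts chart_low_in_R_pts)
  moreover have "\<And>U. openin (R_top lam mu) U \<Longrightarrow> U \<subseteq> R_pts lam mu"
    using assms by (simp add: openin_R_top)
  ultimately show ?thesis by (meson openin_subset openin_topspace subset_antisym)
qed

lemma continuous_map_chart_up:
  assumes "lam > 1" "mu > 1" "k < 3"
  shows "continuous_map (subtopology ext_top UH) (R_top lam mu) (chart_up lam mu k)"
  using assms by (auto simp: continuous_map_def openin_R_top topspace_R_top chart_up_in_R_pts)

lemma continuous_map_chart_low:
  assumes "lam > 1" "mu > 1" "k < 3"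
  shows "continuous_map (subtopology ext_top LH) (R_top lam mu) (chart_low lam mu k)"
  using assms by (auto simp: continuous_map_def openin_R_top topspace_R_top chart_low_in_R_pts)

text \<open>The universal property of the final topology: maps out of the surface are checked in the
  six charts.\<close>

lemma continuous_map_R_top:
  assumes "lam > 1" "mu > 1" 
    and up: "\<And>k. k < 3 \<Longrightarrow> continuous_map (subtopology ext_top UH) Y (\<lambda>w. F (chart_up lam mu k w))"
    and low: "\<And>k. k < 3 \<Longrightarrow> continuous_map (subtopology ext_top LH) Y (\<lambda>w. F (chart_low lam mu k w))"
    and Y: "\<And>p. p \<in> R_pts lam mu \<Longrightarrow> F p \<in> topspace Y"
  shows "continuous_map (R_top lam mu) Y F"
  unfolding continuous_map_def
proof (intro conjI allI impI)
  show "F \<in> topspace (R_top lam mu) \<rightarrow> topspace Y" using Y by (auto simp: topspace_R_top assms)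
  fix U assume U: "openin Y U"
  have "{w \<in> A. c w \<in> {x \<in> R_pts lam mu. F x \<in> U}} = {w \<in> A. F (c w) \<in> U}"
    if "\<And>w. c w \<in> R_pts lam mu" for A :: "ecomplex set" and c
    using that by auto
  then show "openin (R_top lam mu) {x \<in> topspace (R_top lam mu). F x \<in> U}"
    using openin_continuous_map_preimage[OF up U] openin_continuous_map_preimage[OF low U] assms(1,2)
    by (simp add: openin_R_top topspace_R_top chart_up_in_R_pts chart_low_in_R_pts)
qed

lemma closedin_half_planes: "closedin ext_top UH" "closedin ext_top LH"
proof -
  have "UNIV - UH = Some ` {z. Im z < 0}" "UNIV - LH = Some ` {z. 0 < Im z}"
    by (auto simp: UH_def LH_def image_iff) (metis not_None_eq linorder_not_le)+
  then show "closedin ext_top UH" "closedin ext_top LH"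
    by (simp_all add: closedin_def openin_ext_Some open_halfspace_Im_lt open_halfspace_Im_gt)
qed

lemma R_pts_eq_charts:
  assumes "lam > 1" "mu > 1"
  shows "R_pts lam mu = (\<Union>k\<in>{..<3}. chart_up lam mu k ` UH \<union> chart_low lam mu k ` LH)"
proof (intro equalityI subsetI)
  fix p assume "p \<in> R_pts lam mu"
  then obtain k w where kw: "k < 3" "p = canon lam mu (k, w)" by (auto simp: R_pts_def)
  show "p \<in> (\<Union>k\<in>{..<3}. chart_up lam mu k ` UH \<union> chart_low lam mu k ` LH)"
  proof (cases "w \<in> UH")
    case True
    then show ?thesis using kw by (auto simp: chart_up_def)
  next
    case False
    then obtain z where "w = Some z" "Im z < 0" by (cases w) auto
    then have "w \<in> LH" "p = chart_low lam mu k w" using kw by (auto simp: chart_low_def)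
    then show ?thesis using kw by auto
  qed
qed (use assms chart_up_in_R_pts chart_low_in_R_pts in auto)

text \<open>The surface is a union of six continuous images of closed, hence compact, half planes of
  the sphere.\<close>

lemma compact_space_R_top:
  assumes "lam > 1" "mu > 1"
  shows "compact_space (R_top lam mu)"
proof -
  have c: "compactin (R_top lam mu) (chart ` A)"
    if "closedin ext_top A" "continuous_map (subtopology ext_top A) (R_top lam mu) chart" for A chart
  proof -
    have "compactin (subtopology ext_top A) A"
      using that(1) by (simp add: compactin_subtopology closedin_compact_space compact_space_ext_top)
    then show ?thesis using that(2) image_compactin by blast
  qed
  have "compactin (R_top lam mu) (\<Union>k\<in>{..<3}. chart_up lam mu k ` UH \<union> chart_low lam mu k ` LH)"
    using assms closedin_half_planes continuous_map_chart_up continuous_map_chart_low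
    by (intro compactin_Union) (auto intro!: compactin_Un c)
  then show ?thesis using assms by (simp add: compact_space_def topspace_R_top R_pts_eq_charts)
qed

section \<open>Solvability of the algebraic system\<close>

text \<open>An implicit function theorem by signs: \<open>G\<close> changes sign across
  \<open>D\<close>, and its sign at a fixed d persists for nearby s.\<close>

lemma continuous_on_implicit:
  fixes D :: "real \<Rightarrow> real" and G :: "real \<Rightarrow> real \<Rightarrow> real"
  assumes D: "\<And>s. s \<in> S \<Longrightarrow> l < D s \<and> D s < u"
    and pos: "\<And>s d. s \<in> S \<Longrightarrow> l < d \<Longrightarrow> d < D s \<Longrightarrow> 0 < G s d"
    and neg: "\<And>s d. s \<in> S \<Longrightarrow> D s < d \<Longrightarrow> d < u \<Longrightarrow> G s d < 0"
    and root: "\<And>s. s \<in> S \<Longrightarrow> G s (D s) = 0"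
    and cont: "\<And>d. l < d \<Longrightarrow> d < u \<Longrightarrow> continuous_on S (\<lambda>s. G s d)"
  shows "continuous_on S D"
  unfolding continuous_on_def
proof (intro ballI order_tendstoI)
  fix s0 y assume s0: "s0 \<in> S" and "y < D s0"
  \<comment> \<open>A test value strictly between l and \<open>D s0\<close>, where \<open>G\<close>
    is positive, and not below y.\<close>
  define d where "d = max y ((l + D s0) / 2)"
  have d: "l < d" "d < D s0" "d < u" "y \<le> d" using D[OF s0] \<open>y < D s0\<close> by (auto simp: d_def less_max_iff_disj)
  then have "\<forall>\<^sub>F s in at s0 within S. 0 < G s d"
    using cont[OF d(1) d(3)] pos[OF s0 d(1,2)] s0 unfolding continuous_on_def
    by (auto intro: order_tendstoD)
  moreover have "\<forall>\<^sub>F s in at s0 within S. s \<in> S" by (simp add: eventually_at_filter)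
  ultimately show "\<forall>\<^sub>F s in at s0 within S. y < D s"
  proof eventually_elim
    fix s assume "0 < G s d" "s \<in> S"
    then show "y < D s"
      using neg[of s d] root[of s] d by (cases "D s" d rule: linorder_cases) force+
  qed
next
  fix s0 y assume s0: "s0 \<in> S" and "D s0 < y"
  define d where "d = min y ((u + D s0) / 2)"
  have d: "d < u" "D s0 < d" "l < d" "d \<le> y" using D[OF s0] \<open>D s0 < y\<close> by (auto simp: d_def min_less_iff_disj)
  then have "\<forall>\<^sub>F s in at s0 within S. G s d < 0"
    using cont[OF d(3) d(1)] neg[OF s0 d(2,1)] s0 unfolding continuous_on_def
    by (auto intro: order_tendstoD)
  moreover have "\<forall>\<^sub>F s in at s0 within S. s \<in> S" by (simp add: eventually_at_filter)
  ultimately show "\<forall>\<^sub>F s in at s0 within S. D s < y"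
  proof eventually_elim
    fix s assume "G s d < 0" "s \<in> S"
    then show "D s < y"
      using pos[of s d] root[of s] d by (cases "D s" d rule: linorder_cases) force+
  qed
qed

text \<open>In terms of s = a + alpha and d = a - alpha, this says that the first term of the first
  equation, divided by d^3, decreases in d, so that the equation determines d from s.\<close>

lemma first_equation_decreasing:
  fixes s d e :: real
  assumes "0 < s" "s < 2" "0 < d" "d < e" "e \<le> 2"
  shows "((3 - (s\<^sup>2 - e\<^sup>2) / 4)\<^sup>2 - s\<^sup>2) * d ^ 3 < ((3 - (s\<^sup>2 - d\<^sup>2) / 4)\<^sup>2 - s\<^sup>2) * e ^ 3"
proof -
  define k where "k = 3 - s\<^sup>2 / 4"
  have s2: "s\<^sup>2 < 4" using power_strict_mono[of s 2 2] assms by simp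
  then have k: "2 < k" by (simp add: k_def)
  have "k\<^sup>2 - s\<^sup>2 = (2 - s) * (6 + s) / 4 * (k + s)"
    by (simp add: k_def power2_eq_square field_simps)
  also have "\<dots> > 0" using assms k by simp
  finally have ks: "0 < k\<^sup>2 - s\<^sup>2" .
  have f: "(3 - (s\<^sup>2 - x\<^sup>2) / 4)\<^sup>2 - s\<^sup>2 = (k\<^sup>2 - s\<^sup>2) + k * x\<^sup>2 / 2 + x ^ 4 / 16" for x
    by (simp add: k_def power2_eq_square power4_eq_xxxx field_simps)
  \<comment> \<open>Only the quartic term pulls the wrong way; k > 2 and d e \<le> 4 let the
    quadratic term absorb it.\<close>
  have "((3 - (s\<^sup>2 - d\<^sup>2) / 4)\<^sup>2 - s\<^sup>2) * e ^ 3 - ((3 - (s\<^sup>2 - e\<^sup>2) / 4)\<^sup>2 - s\<^sup>2) * d ^ 3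
     = (k\<^sup>2 - s\<^sup>2) * (e ^ 3 - d ^ 3) + d\<^sup>2 * e\<^sup>2 * (e - d) * (k / 2 - d * e / 16)"
    unfolding f by (simp add: power2_eq_square power3_eq_cube power4_eq_xxxx field_simps)
  moreover have "d ^ 3 < e ^ 3" using assms by (intro power_strict_mono) auto
  moreover have "d * e \<le> 2 * 2" using assms by (intro mult_mono) auto
  moreover from this have "0 \<le> d\<^sup>2 * e\<^sup>2 * (e - d) * (k / 2 - d * e / 16)"
    using k assms by (intro mult_nonneg_nonneg) auto
  moreover from \<open>d ^ 3 < e ^ 3\<close> have "0 < (k\<^sup>2 - s\<^sup>2) * (e ^ 3 - d ^ 3)"
    using ks by simp
  ultimately show ?thesis by linarith
qed

text \<open>Here m = mu - lam > 0 and L = lam + mu, so that L > m + 2 says lam > 1. For a = (s + d)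
  / 2 and \<alpha> = (s - d) / 2 the bounds on s and d give -1 < \<alpha> < a < 1.\<close>

lemma system_solvable_pos:
  fixes m L :: real
  assumes m: "m > 0" and L: "L > m + 2"
  obtains s d where "0 < s" "0 < d" "s + d < 2"
    "2 * s * ((3 - (s\<^sup>2 - d\<^sup>2) / 4)\<^sup>2 - s\<^sup>2) = m * d ^ 3"
    "4 * (3 + (s\<^sup>2 - d\<^sup>2) / 4) ^ 3 * (1 - (s\<^sup>2 - d\<^sup>2) / 4) * (4 - s\<^sup>2) = L\<^sup>2 * d ^ 6"
proof -
  define G where "G s d = 2 * s * ((3 - (s\<^sup>2 - d\<^sup>2) / 4)\<^sup>2 - s\<^sup>2) - m * d ^ 3" for s d :: real
  \<comment> \<open>On the line s + d = 2, that is a = 1, the first equation reduces to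
    \<open>E s = 0\<close> (see \<open>G_end\<close>). Its root t is where the curve of the first
    equation leaves the triangle of admissible (s, d).\<close>
  define E where "E s = 16 * s - m * (2 - s)\<^sup>2" for s :: real
  have "\<exists>t. 0 \<le> t \<and> t \<le> 2 \<and> E t = 0"
    using m by (intro IVT') (auto simp: E_def intro!: continuous_intros)
  then obtain t where t: "0 \<le> t" "t \<le> 2" "E t = 0" by auto
  then have t': "0 < t" "t < 2" using m by (auto simp: E_def less_le)
  have G_end: "G s (2 - s) = (2 - s) * E s" for s
    by (simp add: G_def E_def power2_eq_square power3_eq_cube field_simps)
  have E_neg: "E s < 0" if "s < t" for s
  proof -
    have "(2 - t)\<^sup>2 \<le> (2 - s)\<^sup>2" using that t' by (intro power_mono) auto
    then have "m * (2 - t)\<^sup>2 \<le> m * (2 - s)\<^sup>2" using m by simp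
    then show ?thesis using t(3) that by (simp add: E_def)
  qed
  have mono: "G s e * d ^ 3 < G s d * e ^ 3" if "0 < s" "s < 2" "0 < d" "d < e" "e \<le> 2" for s d e
    using mult_strict_left_mono[OF first_equation_decreasing[OF that], of "2 * s"] that(1)
    by (simp add: G_def algebra_simps)
  have "\<exists>d. 0 < d \<and> d \<le> 2 - s \<and> G s d = 0" if s: "0 < s" "s \<le> t" for s
  proof -
    have "(3 - s\<^sup>2 / 4)\<^sup>2 - s\<^sup>2 = (2 - s) * (6 + s) / 4 * (3 - s\<^sup>2 / 4 + s)"
      by (simp add: power2_eq_square field_simps)
    moreover have "s\<^sup>2 < 4" using power_strict_mono[of s 2 2] s t' by simp
    moreover from this have "0 < (2 - s) * (6 + s) / 4 * (3 - s\<^sup>2 / 4 + s)" using s t' by simp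
    ultimately have "0 < (3 - s\<^sup>2 / 4)\<^sup>2 - s\<^sup>2" by presburger
    then have "0 < G s 0" using s by (simp add: G_def)
    moreover have "G s (2 - s) \<le> 0"
      unfolding G_end using s t E_neg[of s] by (cases "s = t") (auto intro!: mult_nonneg_nonpos)
    ultimately have "\<exists>d. 0 \<le> d \<and> d \<le> 2 - s \<and> G s d = 0"
      using s t' by (intro IVT2') (auto simp: G_def intro!: continuous_intros)
    then show ?thesis using \<open>0 < G s 0\<close> by (metis less_irrefl order_le_less)
  qed
  then obtain D where D: "\<And>s. 0 < s \<Longrightarrow> s \<le> t \<Longrightarrow> 0 < D s \<and> D s \<le> 2 - s \<and> G s (D s) = 0"
    by metis
  have Gpos: "0 < G s d" if "0 < s" "s \<le> t" "0 < d" "d < D s" for s d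
    using mono[of s d "D s"] D[of s] that t' by (simp add: zero_less_mult_iff)
  have Gneg: "G s d < 0" if "0 < s" "s \<le> t" "D s < d" "d \<le> 2" for s d
    using mono[of s "D s" d] D[of s] that t' by (simp add: mult_less_0_iff)
  have contD: "continuous_on {0<..t} D"
    by (rule continuous_on_implicit[where l = 0 and u = 2 and G = G])
       (use D Gpos Gneg in \<open>force simp: G_def intro!: continuous_intros\<close>)+
  \<comment> \<open>The second equation along the curve d = \<open>D s\<close>; a sign change
    between small s and t yields the solution.\<close>
  define V where "V s = 4 * (3 + (s\<^sup>2 - (D s)\<^sup>2) / 4) ^ 3 * (1 - (s\<^sup>2 - (D s)\<^sup>2) / 4) * (4 - s\<^sup>2) - L\<^sup>2 * D s ^ 6" for s
  have Dt: "D t = 2 - t"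
  proof (rule ccontr)
    assume "D t \<noteq> 2 - t"
    then have "G t (2 - t) < 0" using D[of t] t' by (intro Gneg) auto
    then show False using G_end t by simp
  qed
  \<comment> \<open>At the end of the curve \<open>V\<close> is, up to a positive factor, a
    difference of squares, and \<open>E t = 0\<close> turns 2 (4 - d)^2 into (m + 2) d^2. The sign
    is then exactly the hypothesis L > m + 2.\<close>
  have Vt: "V t < 0"
  proof -
    define d where "d = 2 - t"
    have d: "0 < d" "d < 2" using t' by (auto simp: d_def)
    have V: "V t = d\<^sup>2 * ((2 * (4 - d)\<^sup>2)\<^sup>2 - (L * d\<^sup>2)\<^sup>2)"
      unfolding V_def Dt d_def by (simp add: power2_eq_square power3_eq_cube field_simps eval_nat_numeral)
    have "2 * (4 - d)\<^sup>2 = (m + 2) * d\<^sup>2"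
      using t(3) by (simp add: E_def d_def power2_eq_square algebra_simps)
    also have "\<dots> < L * d\<^sup>2" using L d by simp
    finally have "(2 * (4 - d)\<^sup>2)\<^sup>2 < (L * d\<^sup>2)\<^sup>2" by (intro power_strict_mono) auto
    then show ?thesis unfolding V using d by (intro mult_pos_neg) auto
  qed
  \<comment> \<open>This makes L^2 d^6 at most 1 for 0 \<le> d \<le> \<delta>. The third bound on s1
    keeps 2 s1 times a factor of at most 16 below m \<delta>^3, so that \<open>G\<close> is negative
    at \<delta> and \<open>D s1\<close> is at most \<delta>.\<close>
  define \<delta> where "\<delta> = 1 / L"
  have \<delta>: "0 < \<delta>" "\<delta> < 1" "L * \<delta> = 1" using L m by (auto simp: \<delta>_def)
  define s1 where "s1 = Min {1, t / 2, m * \<delta> ^ 3 / 64}"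
  have s1: "0 < s1" "s1 \<le> 1" "s1 \<le> t / 2" "s1 \<le> m * \<delta> ^ 3 / 64"
    using t' m \<delta> by (auto simp: s1_def)
  have Vs1: "0 < V s1"
  proof -
    have "s1\<^sup>2 \<le> 1\<^sup>2" using s1 by (intro power_mono) auto
    then have s1sq: "s1\<^sup>2 \<le> 1" by simp
    have "\<delta>\<^sup>2 \<le> 1\<^sup>2" using \<delta> by (intro power_mono) auto
    then have "0 \<le> 3 - (s1\<^sup>2 - \<delta>\<^sup>2) / 4" "3 - (s1\<^sup>2 - \<delta>\<^sup>2) / 4 \<le> 4"
      using s1sq zero_le_power2[of s1] zero_le_power2[of \<delta>] unfolding one_power2 by argo+
    then have "(3 - (s1\<^sup>2 - \<delta>\<^sup>2) / 4)\<^sup>2 \<le> 4\<^sup>2" by (intro power_mono)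
    then have "(3 - (s1\<^sup>2 - \<delta>\<^sup>2) / 4)\<^sup>2 - s1\<^sup>2 \<le> 16" by (auto intro: order_trans[OF diff_left_mono[of 0]])
    then have "s1 * ((3 - (s1\<^sup>2 - \<delta>\<^sup>2) / 4)\<^sup>2 - s1\<^sup>2) \<le> s1 * 16" using s1 by (intro mult_left_mono) auto
    then have "2 * s1 * ((3 - (s1\<^sup>2 - \<delta>\<^sup>2) / 4)\<^sup>2 - s1\<^sup>2) < m * \<delta> ^ 3"
      using s1(1,4) mult_pos_pos[OF m zero_less_power[OF \<delta>(1), of 3]] unfolding mult.assoc by linarith
    then have "G s1 \<delta> < 0" by (simp add: G_def)
    then have "D s1 \<le> \<delta>" using Gpos[of s1 \<delta>] s1 t' \<delta> by force
    then have "D s1 ^ 6 \<le> \<delta> ^ 6" using D[of s1] s1 t' by (intro power_mono) auto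
    also have "\<dots> \<le> \<delta>\<^sup>2" using \<delta> by (intro power_decreasing) auto
    finally have "L\<^sup>2 * D s1 ^ 6 \<le> L\<^sup>2 * \<delta>\<^sup>2" by (intro mult_left_mono) auto
    also have "\<dots> = 1" using \<delta> by (metis power_mult_distrib one_power2)
    finally have 1: "L\<^sup>2 * D s1 ^ 6 \<le> 1" .
    have "(D s1)\<^sup>2 \<le> 1\<^sup>2" using \<open>D s1 \<le> \<delta>\<close> \<delta> D[of s1] s1 t' by (intro power_mono) auto
    then have p: "-1 \<le> (s1\<^sup>2 - (D s1)\<^sup>2) / 4" "(s1\<^sup>2 - (D s1)\<^sup>2) / 4 \<le> 1/4"
      using s1sq zero_le_power2[of s1] zero_le_power2[of "D s1"] unfolding one_power2 by argo+
    define p where "p = (s1\<^sup>2 - (D s1)\<^sup>2) / 4"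
    have "1 ^ 3 \<le> (3 + p) ^ 3" using p unfolding p_def[symmetric] by (intro power_mono) auto
    then have "1 * (1/2) \<le> (3 + p) ^ 3 * (1 - p)" using p unfolding p_def[symmetric] by (intro mult_mono) auto
    then have "1/2 * 3 \<le> (3 + p) ^ 3 * (1 - p) * (4 - s1\<^sup>2)"
      using s1sq by (intro mult_mono[of "1/2" "(3 + p) ^ 3 * (1 - p)"]) linarith+
    then show ?thesis using 1 unfolding V_def p_def[symmetric] by simp
  qed
  have "continuous_on {s1..t} D" by (rule continuous_on_subset[OF contD]) (use s1 in auto)
  then have "continuous_on {s1..t} V" unfolding V_def by (intro continuous_intros) auto
  then have "\<exists>s. s1 \<le> s \<and> s \<le> t \<and> V s = 0"
    using Vt Vs1 s1 t' by (intro IVT2') auto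
  then obtain s where s: "s1 \<le> s" "s \<le> t" "V s = 0" by auto
  have "s \<noteq> t" using s Vt by auto
  then have st: "0 < s" "s < t" using s s1 by auto
  have "G s (2 - s) < 0" unfolding G_end using E_neg[of s] st t' by (intro mult_pos_neg) auto
  then have "D s < 2 - s" using D[of s] st by (cases "D s = 2 - s") auto
  then show ?thesis
    using that[of s "D s"] D[of s] st s(3) by (simp add: G_def V_def)
qed

text \<open>The reflection of z to -z sends (\<alpha>, a) to (-a, -\<alpha>) and exchanges lam with
  mu, which leaves the cases lam < mu and lam = mu.\<close>

lemma system_solvable:
  fixes lam mu :: real
  assumes "lam > 1" "mu > 1"
  shows "\<exists>\<alpha> a. 2 * (a + \<alpha>) * (3 - a * \<alpha> - a - \<alpha>) * (3 - a * \<alpha> + a + \<alpha>) + (lam - mu) * (a - \<alpha>) ^ 3 = 0 \<and>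
         (lam + mu)\<^sup>2 * (a - \<alpha>) ^ 6 = 4 * (3 + a * \<alpha>) ^ 3 * (1 - a * \<alpha>) * (2 + a + \<alpha>) * (2 - a - \<alpha>) \<and>
         -1 < \<alpha> \<and> \<alpha> < a \<and> a < 1"
proof -
  define sol where "sol lam mu \<alpha> a \<longleftrightarrow>
      2 * (a + \<alpha>) * (3 - a * \<alpha> - a - \<alpha>) * (3 - a * \<alpha> + a + \<alpha>) + (lam - mu) * (a - \<alpha>) ^ 3 = 0 \<and>
      (lam + mu)\<^sup>2 * (a - \<alpha>) ^ 6 = 4 * (3 + a * \<alpha>) ^ 3 * (1 - a * \<alpha>) * (2 + a + \<alpha>) * (2 - a - \<alpha>) \<and>
      -1 < \<alpha> \<and> \<alpha> < a \<and> a < 1" for lam mu \<alpha> a :: real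
  have pos: "\<exists>\<alpha> a. sol lam mu \<alpha> a" if lm: "lam > 1" "mu > lam" for lam mu :: real
  proof -
    obtain s d where sd: "0 < s" "0 < d" "s + d < 2"
      and e1: "2 * s * ((3 - (s\<^sup>2 - d\<^sup>2) / 4)\<^sup>2 - s\<^sup>2) = (mu - lam) * d ^ 3"
      and e2: "4 * (3 + (s\<^sup>2 - d\<^sup>2) / 4) ^ 3 * (1 - (s\<^sup>2 - d\<^sup>2) / 4) * (4 - s\<^sup>2) = (lam + mu)\<^sup>2 * d ^ 6"
    proof (rule system_solvable_pos)
      show "0 < mu - lam" "mu - lam + 2 < lam + mu" using lm by auto
    qed
    have p: "(s + d) / 2 * ((s - d) / 2) = (s\<^sup>2 - d\<^sup>2) / 4" "(s + d) / 2 + (s - d) / 2 = s" "(s + d) / 2 - (s - d) / 2 = d"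
      by (simp_all add: power2_eq_square field_simps)
    define q where "q = (s\<^sup>2 - d\<^sup>2) / 4"
    have "2 * s * (3 - q - s) * (3 - q + s) = 2 * s * ((3 - q)\<^sup>2 - s\<^sup>2)"
      by (simp add: power2_eq_square algebra_simps)
    then have 1: "2 * s * (3 - q - s) * (3 - q + s) + (lam - mu) * d ^ 3 = 0"
      using e1 unfolding q_def[symmetric] by (simp add: algebra_simps)
    have 2: "(lam + mu)\<^sup>2 * d ^ 6 = 4 * (3 + q) ^ 3 * (1 - q) * (2 + s) * (2 - s)"
      using e2 unfolding q_def[symmetric] by (simp add: power2_eq_square algebra_simps)
    have a: "3 - q - (s + d) / 2 - (s - d) / 2 = 3 - q - s" "3 - q + (s + d) / 2 + (s - d) / 2 = 3 - q + s"
      "2 + (s + d) / 2 + (s - d) / 2 = 2 + s" "2 - (s + d) / 2 - (s - d) / 2 = 2 - s" by (simp_all add: field_simps)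
    have "sol lam mu ((s - d) / 2) ((s + d) / 2)"
      unfolding sol_def p q_def[symmetric] a using 1 2 sd by auto
    then show ?thesis by blast
  qed
  consider "lam < mu" | "mu < lam" | "lam = mu" by linarith
  then have "\<exists>\<alpha> a. sol lam mu \<alpha> a"
  proof cases
    case 1
    then show ?thesis using pos assms by simp
  next
    case 2
    obtain \<alpha> a where "sol mu lam \<alpha> a" using pos[of mu lam] 2 assms by auto
    then have "sol lam mu (- a) (- \<alpha>)" by (simp add: sol_def algebra_simps)
    then show ?thesis by blast
  next
    case 3
    \<comment> \<open>For lam = mu a symmetric solution a = -\<alpha> = d / 2 is sought: the first
      equation then holds identically, and the zeros of \<open>V\<close> are the solutions of the
      second.\<close>
    define V where "V d = 16 * (3 - d\<^sup>2 / 4) ^ 3 * (1 + d\<^sup>2 / 4) - (lam + mu)\<^sup>2 * d ^ 6" for d :: real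
    have "2\<^sup>2 < (lam + mu)\<^sup>2" using assms by (intro power_strict_mono) auto
    then have V: "V 2 < 0" by (simp add: V_def)
    have "\<exists>d. 0 \<le> d \<and> d \<le> 2 \<and> V d = 0"
      by (rule IVT2') (use V in \<open>auto simp: V_def intro!: continuous_intros\<close>)
    then obtain d where d: "0 \<le> d" "d \<le> 2" "V d = 0" by auto
    then have d': "0 < d" "d < 2" using V by (auto simp: V_def less_le)
    show ?thesis
      by (rule exI[of _ "-d/2"], rule exI[of _ "d/2"])
         (use d d' 3 in \<open>simp add: sol_def V_def power2_eq_square\<close>)
  qed
  then show ?thesis unfolding sol_def .
qed

section \<open>The rational function\<close>

text \<open>Here kappa stands for H(a), and the coefficient equations say that
  (1 - z^2)^2 H'(z) = (z - beta)(z - alpha)(z - a)(z - b).\<close>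

locale three_sheets =
  fixes lam mu \<alpha> a \<beta> b A B h \<kappa> :: real
  assumes lam: "1 < lam" and mu: "1 < mu" and \<kappa>: "0 < \<kappa>"
    and order: "\<beta> < -1" "-1 < \<alpha>" "\<alpha> < a" "a < 1" "1 < b"
    and sum: "\<beta> + \<alpha> + a + b = 0"
    and coeff2: "A + B - 2 = \<beta> * \<alpha> + a * b + (\<beta> + \<alpha>) * (a + b)"
    and coeff1: "2 * (B - A) = \<beta> * \<alpha> * (a + b) + (\<beta> + \<alpha>) * (a * b)"
    and coeff0: "1 + A + B = \<beta> * \<alpha> * (a * b)"
    and critical_values: "h + \<beta> + A * \<beta> / (1 - \<beta>) + B * \<beta> / (1 + \<beta>) = - mu * \<kappa>"
      "h + \<alpha> + A * \<alpha> / (1 - \<alpha>) + B * \<alpha> / (1 + \<alpha>) = - \<kappa>"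
      "h + a + A * a / (1 - a) + B * a / (1 + a) = \<kappa>"
      "h + b + A * b / (1 - b) + B * b / (1 + b) = lam * \<kappa>"
begin

text \<open>Stated over a general algebra because it is used over the reals, for the signs of A, B
  and \<open>W\<close>, and over the complex numbers, for G'. At z = 1 and z = -1 it isolates A and
  B.\<close>

lemma critical_poly:
  fixes z :: "'a :: {real_algebra_1, comm_ring_1}"
  shows "(1 - z\<^sup>2)\<^sup>2 + of_real A * (1 + z)\<^sup>2 + of_real B * (1 - z)\<^sup>2
    = (z - of_real \<beta>) * (z - of_real \<alpha>) * (z - of_real a) * (z - of_real b)"
proof -
  have "(z - of_real \<beta>) * (z - of_real \<alpha>) * (z - of_real a) * (z - of_real b) =
     z ^ 4 - of_real (\<beta> + \<alpha> + a + b) * z ^ 3 + of_real (\<beta> * \<alpha> + a * b + (\<beta> + \<alpha>) * (a + b)) * z\<^sup>2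
     - of_real (\<beta> * \<alpha> * (a + b) + (\<beta> + \<alpha>) * (a * b)) * z + of_real (\<beta> * \<alpha> * (a * b))"
    by (simp add: power2_eq_square power3_eq_cube power4_eq_xxxx algebra_simps)
  also have "\<dots> = z ^ 4 + of_real (A + B - 2) * z\<^sup>2 - of_real (2 * (B - A)) * z + of_real (1 + A + B)"
    unfolding sum coeff2 coeff1 coeff0 by simp
  also have "\<dots> = (1 - z\<^sup>2)\<^sup>2 + of_real A * (1 + z)\<^sup>2 + of_real B * (1 - z)\<^sup>2"
    by (simp add: power2_eq_square power4_eq_xxxx algebra_simps)
  finally show ?thesis by simp
qed

lemma AB_neg: "A < 0" "B < 0"
proof -
  have "4 * A = (1 - \<beta>) * (1 - \<alpha>) * (1 - a) * (1 - b)" using critical_poly[of "1::real"] by simp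
  moreover have "(1 - \<beta>) * (1 - \<alpha>) * (1 - a) * (1 - b) < 0" using order by (intro mult_pos_neg) auto
  ultimately show "A < 0" by simp
  have "4 * B = (- 1 - \<beta>) * (- 1 - \<alpha>) * (- 1 - a) * (- 1 - b)" using critical_poly[of "-1::real"] by simp
  also have "\<dots> = - ((- 1 - \<beta>) * (1 + \<alpha>) * (1 + a) * (1 + b))" by (simp add: algebra_simps)
  also have "\<dots> < 0" using order by (simp add: mult_pos_pos)
  finally show "B < 0" by simp
qed

text \<open>The factor 1 + A / |1 - z|^2 + B / |1 + z|^2 of Im z in Im H(z), cleared of denominators
  and therefore continuous at the poles too.\<close>

definition W :: "complex \<Rightarrow> real" where
  "W z = (cmod (1 - z))\<^sup>2 * (cmod (1 + z))\<^sup>2 + A * (cmod (1 + z))\<^sup>2 + B * (cmod (1 - z))\<^sup>2"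

definition G :: "complex \<Rightarrow> complex" where
  "G z = (of_real h + z + of_real A * z / (1 - z) + of_real B * z / (1 + z)) / of_real \<kappa>"

text \<open>The numerator of kappa (G z - w): a cubic in z whose roots are the finite points of the
  fibre over w (\<open>N_zero_iff\<close>). Being a polynomial it can be used across the poles of
  G.\<close>

definition N :: "complex \<Rightarrow> complex \<Rightarrow> complex" where
  "N w z = (of_real h + z - of_real \<kappa> * w) * (1 - z\<^sup>2) + of_real A * z * (1 + z) + of_real B * z * (1 - z)"

lemma continuous_W: "continuous_on S W"
  unfolding W_def by (intro continuous_intros)

lemma W_expand:
  "W z = W (of_real (Re z)) + (Im z)\<^sup>2 * ((1 - Re z)\<^sup>2 + A + ((1 + Re z)\<^sup>2 + B)) + (Im z) ^ 4"
  unfolding W_def cmod_power2 by (simp add: power2_eq_square power4_eq_xxxx algebra_simps)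

lemma W_real: "W (of_real x) = (x - \<beta>) * (x - \<alpha>) * (x - a) * (x - b)"
proof -
  have "W (of_real x) = (1 - x\<^sup>2)\<^sup>2 + A * (1 + x)\<^sup>2 + B * (1 - x)\<^sup>2"
    unfolding W_def cmod_power2 by (simp add: power2_eq_square algebra_simps)
  then show ?thesis using critical_poly[of x] by simp
qed

lemma W_poles: "W 1 < 0" "W (- 1) < 0"
  using AB_neg by (simp_all add: W_def)

text \<open>As A and B are negative, a nonnegative \<open>W z\<close> needs each of |1 - z|^2 + A
  and |1 + z|^2 + B to be positive. The middle region thus keeps a fixed distance from both poles,
  which bounds the polar terms of G in \<open>is_psi_1\<close>.\<close>

lemma norm_lower_middle:
  assumes "0 \<le> W z"
  shows "- A < (cmod (1 - z))\<^sup>2" "- B < (cmod (1 + z))\<^sup>2"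
proof -
  define m n where "m = (cmod (1 - z))\<^sup>2" and "n = (cmod (1 + z))\<^sup>2"
  have "z \<noteq> 1" "z \<noteq> - 1" using assms W_poles by auto
  then have mn: "0 < m" "0 < n" by (auto simp: m_def n_def add_eq_0_iff)
  have "0 \<le> (m + A) * n + B * m" "0 \<le> (n + B) * m + A * n"
    using assms unfolding W_def m_def n_def by (simp_all add: algebra_simps)
  moreover have "B * m < 0" "A * n < 0" using mn AB_neg by (auto simp: mult_neg_pos)
  ultimately have "0 < (m + A) * n" "0 < (n + B) * m" by linarith+
  then show "- A < (cmod (1 - z))\<^sup>2" "- B < (cmod (1 + z))\<^sup>2"
    using mn by (auto simp: zero_less_mult_iff m_def n_def)
qed

text \<open>On the vertical line through a real point with \<open>W\<close> at least 0,
  \<open>W\<close> is a polynomial in (Im z)^2 with nonnegative constant term and positive further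
  coefficients. Hence {W \<le> 0} lies in the strips over [\<beta>, \<alpha>] and [a, b].\<close>

lemma W_pos_line:
  assumes "0 \<le> W (of_real (Re z))" "Im z \<noteq> 0"
  shows "0 < W z"
proof -
  have "0 < ((1 - Re z)\<^sup>2 + A) + ((1 + Re z)\<^sup>2 + B)"
    using norm_lower_middle[OF assms(1)] by (simp add: cmod_power2)
  moreover have "0 < (Im z)\<^sup>2" "0 \<le> (Im z) ^ 4" using assms(2) by auto
  ultimately have "0 < (Im z)\<^sup>2 * ((1 - Re z)\<^sup>2 + A + ((1 + Re z)\<^sup>2 + B))" by (simp only: mult_pos_pos)
  then show ?thesis unfolding W_expand[of z] using assms(1) \<open>0 \<le> (Im z) ^ 4\<close> by linarith
qed

lemma W_real_nonpos: "W (of_real x) \<le> 0 \<longleftrightarrow> (\<beta> \<le> x \<and> x \<le> \<alpha>) \<or> (a \<le> x \<and> x \<le> b)"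
  and W_real_neg: "W (of_real x) < 0 \<longleftrightarrow> (\<beta> < x \<and> x < \<alpha>) \<or> (a < x \<and> x < b)"
proof -
  have quad: "(x - u) * (x - v) < 0 \<longleftrightarrow> u < x \<and> x < v" "0 < (x - u) * (x - v) \<longleftrightarrow> x < u \<or> v < x"
    if "u < v" for u v
    using that by (auto simp: mult_less_0_iff zero_less_mult_iff)
  \<comment> \<open>Pairing the outer roots and the inner roots leaves two quadratics of known
    sign.\<close>
  have W: "W (of_real x) = ((x - \<beta>) * (x - b)) * ((x - \<alpha>) * (x - a))"
    unfolding W_real by (simp add: mult.assoc mult.left_commute)
  have "\<beta> < b" using order by simp
  note q = quad[OF this] quad[OF order(3)]
  have neg: "W (of_real x) < 0 \<longleftrightarrow> (\<beta> < x \<and> x < b \<and> (x < \<alpha> \<or> a < x)) \<or> ((x < \<beta> \<or> b < x) \<and> \<alpha> < x \<and> x < a)"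
    unfolding W mult_less_0_iff[of "(x - \<beta>) * (x - b)"] q by blast
  have pos: "0 < W (of_real x) \<longleftrightarrow> ((x < \<beta> \<or> b < x) \<and> (x < \<alpha> \<or> a < x)) \<or> (\<beta> < x \<and> x < b \<and> \<alpha> < x \<and> x < a)"
    unfolding W zero_less_mult_iff[of "(x - \<beta>) * (x - b)"] q by blast
  show "W (of_real x) \<le> 0 \<longleftrightarrow> (\<beta> \<le> x \<and> x \<le> \<alpha>) \<or> (a \<le> x \<and> x \<le> b)"
    unfolding not_less[symmetric] pos using order by linarith
  show "W (of_real x) < 0 \<longleftrightarrow> (\<beta> < x \<and> x < \<alpha>) \<or> (a < x \<and> x < b)"
    unfolding neg using order by linarith
qed

section \<open>The regions bounded by the zero set of W\<close>

definition mid :: real where "mid = (\<alpha> + a) / 2"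

text \<open>The regions are closed and share the ovals W = 0. The line Re z = \<open>mid\<close>
  runs between the strips over [\<beta>, \<alpha>] and [a, b] and so separates the two
  ovals.\<close>

definition Reg :: "nat \<Rightarrow> complex set" where
  "Reg k = (if k = 1 then {z. 0 \<le> W z} else if k = 0 then {z. W z \<le> 0 \<and> Re z \<le> mid}
     else {z. W z \<le> 0 \<and> mid \<le> Re z})"

lemma mid: "\<alpha> < mid" "mid < a"
  using order by (auto simp: mid_def)

lemma W_nonpos_Re:
  assumes "W z \<le> 0"
  shows "(\<beta> \<le> Re z \<and> Re z \<le> \<alpha>) \<or> (a \<le> Re z \<and> Re z \<le> b)"
proof -
  have "W (of_real (Re z)) \<le> 0"
  proof (cases "Im z = 0")
    case True
    then have "of_real (Re z) = z" by (simp add: complex_eq_iff)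
    then show ?thesis using assms by simp
  next
    case False
    then show ?thesis using W_pos_line[of z] assms by linarith
  qed
  then show ?thesis by (simp only: W_real_nonpos)
qed

lemma Reg_Re:
  "z \<in> Reg 0 \<Longrightarrow> \<beta> \<le> Re z \<and> Re z \<le> \<alpha>" "z \<in> Reg 2 \<Longrightarrow> a \<le> Re z \<and> Re z \<le> b"
  using W_nonpos_Re[of z] mid by (auto simp: Reg_def)

lemma closed_Reg: "closed (Reg k)"
  unfolding Reg_def
  by (auto intro!: closed_Collect_conj closed_Collect_le continuous_W continuous_intros)

lemma N_eq: "z \<noteq> 1 \<Longrightarrow> z \<noteq> - 1 \<Longrightarrow> N w z = of_real \<kappa> * (G z - w) * (1 - z\<^sup>2)"
proof -
  assume "z \<noteq> 1" "z \<noteq> - 1"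
  then have "1 - z \<noteq> 0" "1 + z \<noteq> 0" by (auto simp: add_eq_0_iff)
  have "of_real \<kappa> * (G z - w) =
     of_real h + z - of_real \<kappa> * w + of_real A * z / (1 - z) + of_real B * z / (1 + z)"
    using \<kappa> by (simp add: G_def right_diff_distrib)
  moreover have "1 - z\<^sup>2 = (1 - z) * (1 + z)" by (simp add: power2_eq_square algebra_simps)
  ultimately have "of_real \<kappa> * (G z - w) * (1 - z\<^sup>2) =
     (of_real h + z - of_real \<kappa> * w + of_real A * z / (1 - z) + of_real B * z / (1 + z)) * ((1 - z) * (1 + z))"
    by simp
  also have "\<dots> = N w z"
  proof -
    have "(x + p / u + q / v) * (u * v) = x * (u * v) + p * v + q * u"
      if "u \<noteq> 0" "v \<noteq> 0" for x p q u v :: complex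
      using that by (simp add: field_simps)
    then show ?thesis
      using \<open>1 - z \<noteq> 0\<close> \<open>1 + z \<noteq> 0\<close> \<open>1 - z\<^sup>2 = (1 - z) * (1 + z)\<close> by (simp add: N_def)
  qed
  finally show ?thesis by simp
qed

lemma N_poles: "N w 1 = 2 * of_real A" "N w (- 1) = - 2 * of_real B"
  by (simp_all add: N_def)

text \<open>At the poles \<open>N\<close> has the nonzero values 2A and -2B, so clearing
  denominators adds no roots.\<close>

lemma N_zero_iff: "N w z = 0 \<longleftrightarrow> z \<noteq> 1 \<and> z \<noteq> - 1 \<and> G z = w"
proof (cases "z = 1 \<or> z = - 1")
  case True
  then show ?thesis using AB_neg N_poles by auto
next
  case False
  then have "1 - z\<^sup>2 \<noteq> 0" by (simp add: power2_eq_1_iff)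
  then show ?thesis using False \<kappa> by (simp add: N_eq)
qed

lemma N_cnj: "N (cnj w) (cnj z) = cnj (N w z)"
  by (simp add: N_def)

lemma Im_G: "Im (G z) = Im z * W z / (\<kappa> * ((cmod (1 - z))\<^sup>2 * (cmod (1 + z))\<^sup>2))" if "z \<noteq> 1" "z \<noteq> - 1"
proof -
  define m n where "m = (cmod (1 - z))\<^sup>2" and "n = (cmod (1 + z))\<^sup>2"
  have mn: "m \<noteq> 0" "n \<noteq> 0" using that by (auto simp: m_def n_def add_eq_0_iff)
  have "Im (z / (1 - z)) = Im z / m" "Im (z / (1 + z)) = Im z / n"
    unfolding m_def n_def cmod_power2 by (simp_all add: Im_divide power2_eq_square algebra_simps)
  then have "Im (G z) = (Im z + A * (Im z / m) + B * (Im z / n)) / \<kappa>"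
    by (simp add: G_def Im_divide_of_real flip: times_divide_eq_right)
  also have "\<dots> = Im z * W z / (\<kappa> * (m * n))"
    using mn \<kappa> unfolding W_def m_def[symmetric] n_def[symmetric] by (simp add: field_simps)
  finally show ?thesis by (simp add: m_def n_def)
qed

lemma G_deriv:
  assumes "z \<noteq> 1" "z \<noteq> - 1"
  shows "(G has_field_derivative (z - of_real \<beta>) * (z - of_real \<alpha>) * (z - of_real a) * (z - of_real b)
      / (of_real \<kappa> * (1 - z\<^sup>2)\<^sup>2)) (at z)"
proof -
  have nz: "1 - z \<noteq> 0" "1 + z \<noteq> 0" using assms by (auto simp: add_eq_0_iff)
  have "(G has_field_derivative (1 + of_real A / (1 - z)\<^sup>2 + of_real B / (1 + z)\<^sup>2) / of_real \<kappa>) (at z)"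
    unfolding G_def[abs_def] using nz \<kappa>
    by (auto intro!: derivative_eq_intros simp: power2_eq_square) (simp add: field_simps)
  moreover have "1 + of_real A / (1 - z)\<^sup>2 + of_real B / (1 + z)\<^sup>2 =
     ((1 - z\<^sup>2)\<^sup>2 + of_real A * (1 + z)\<^sup>2 + of_real B * (1 - z)\<^sup>2) / (1 - z\<^sup>2)\<^sup>2"
  proof -
    have "1 - z\<^sup>2 = (1 - z) * (1 + z)" by (simp add: power2_eq_square algebra_simps)
    then show ?thesis using nz by (simp add: add_divide_distrib power_mult_distrib)
  qed
  ultimately show ?thesis unfolding critical_poly by (simp add: mult.commute)
qed


lemma G_critical_values:
  "G (of_real \<beta>) = of_real (- mu)" "G (of_real \<alpha>) = - 1" "G (of_real a) = 1" "G (of_real b) = of_real lam"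
proof -
  have *: "G (of_real x) = of_real ((h + x + A * x / (1 - x) + B * x / (1 + x)) / \<kappa>)" for x
    by (simp add: G_def)
  then show "G (of_real \<beta>) = of_real (- mu)" "G (of_real \<alpha>) = - 1" "G (of_real a) = 1" "G (of_real b) = of_real lam"
    unfolding * critical_values using \<kappa> by simp_all
qed

section \<open>Roots of the fibre cubic\<close>

definition crit :: "complex set" where "crit = of_real ` {\<beta>, \<alpha>, a, b}"

lemma N_expand: "N w z = - (z ^ 3) + (of_real (A - B - h) + of_real \<kappa> * w) * z\<^sup>2 + of_real (1 + A + B) * z
    + (of_real h - of_real \<kappa> * w)"
  by (simp add: N_def power2_eq_square power3_eq_cube algebra_simps)

text \<open>Vieta's formulas by divided differences: each pair of roots gives a relation between c1
  and c2, and the difference of two such relations isolates c2.\<close>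

lemma cubic_factor:
  fixes r1 r2 r3 :: complex
  assumes p: "\<And>z. p z = - (z ^ 3) + c2 * z\<^sup>2 + c1 * z + c0"
    and "p r1 = 0" "p r2 = 0" "p r3 = 0" "distinct [r1, r2, r3]"
  shows "c2 = r1 + r2 + r3" "c1 = - (r1 * r2 + r1 * r3 + r2 * r3)" "c0 = r1 * r2 * r3"
proof -
  have d: "- (r\<^sup>2 + r * s + s\<^sup>2) + c2 * (r + s) + c1 = 0" if "p r = 0" "p s = 0" "r \<noteq> s" for r s
  proof -
    have "(r - s) * (- (r\<^sup>2 + r * s + s\<^sup>2) + c2 * (r + s) + c1) = p r - p s"
      unfolding p by (simp add: power2_eq_square power3_eq_cube algebra_simps)
    then show ?thesis using that by simp
  qed
  have e: "- (r1\<^sup>2 + r1 * r2 + r2\<^sup>2) + c2 * (r1 + r2) + c1 = 0" "- (r1\<^sup>2 + r1 * r3 + r3\<^sup>2) + c2 * (r1 + r3) + c1 = 0"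
    using d assms(2-5) by auto
  have "(r2 - r3) * (c2 - (r1 + r2 + r3)) = (- (r1\<^sup>2 + r1 * r2 + r2\<^sup>2) + c2 * (r1 + r2) + c1)
     - (- (r1\<^sup>2 + r1 * r3 + r3\<^sup>2) + c2 * (r1 + r3) + c1)"
    by (simp add: power2_eq_square algebra_simps)
  then show c2: "c2 = r1 + r2 + r3" unfolding e using assms(5) by simp
  have "c1 = r1\<^sup>2 + r1 * r2 + r2\<^sup>2 - c2 * (r1 + r2)" using e(1) by (simp add: algebra_simps add_eq_0_iff)
  then show c1: "c1 = - (r1 * r2 + r1 * r3 + r2 * r3)" unfolding c2 by (simp add: power2_eq_square algebra_simps)
  have "c0 = p r1 - (- (r1 ^ 3) + c2 * r1\<^sup>2 + c1 * r1)" unfolding p by simp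
  then show "c0 = r1 * r2 * r3"
    using assms(2) unfolding c1 c2 by (simp add: power2_eq_square power3_eq_cube algebra_simps)
qed

lemma N_factor:
  assumes "N w r1 = 0" "N w r2 = 0" "N w r3 = 0" "distinct [r1, r2, r3]"
  shows "N w z = - ((z - r1) * (z - r2) * (z - r3))"
  unfolding N_expand cubic_factor[OF N_expand assms]
  by (simp add: power2_eq_square power3_eq_cube algebra_simps)

lemma N_roots_le_3:
  assumes "N w r1 = 0" "N w r2 = 0" "N w r3 = 0" "N w z = 0" "distinct [r1, r2, r3]"
  shows "z \<in> {r1, r2, r3}"
  using N_factor[OF assms(1-3,5), of z] assms(4) by simp

text \<open>A critical point is a double root, which leaves room for only one further root.\<close>

lemma crit_no_3_roots:
  assumes "N w r1 = 0" "N w r2 = 0" "N w r3 = 0" "distinct [r1, r2, r3]"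
  shows "r1 \<notin> crit"
proof
  assume "r1 \<in> crit"
  then have "(1 - r1\<^sup>2)\<^sup>2 + of_real A * (1 + r1)\<^sup>2 + of_real B * (1 - r1)\<^sup>2 = 0"
    unfolding critical_poly crit_def by auto
  \<comment> \<open>The second factor on the left is the derivative of \<open>N w\<close> at r1, by
    the product rule for kappa (G z - w) (1 - z^2). It vanishes at a critical root, whereas for
    three distinct roots it equals -(r1 - r2) (r1 - r3).\<close>
  moreover have "(1 - r1\<^sup>2) * (- 3 * r1\<^sup>2 + 2 * (of_real (A - B - h) + of_real \<kappa> * w) * r1 + of_real (1 + A + B))
     = ((1 - r1\<^sup>2)\<^sup>2 + of_real A * (1 + r1)\<^sup>2 + of_real B * (1 - r1)\<^sup>2) - 2 * r1 * N w r1"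
    by (simp add: N_def power2_eq_square power3_eq_cube algebra_simps)
  moreover have "1 - r1\<^sup>2 \<noteq> 0" using assms(1) by (simp add: N_zero_iff power2_eq_1_iff)
  ultimately have "- 3 * r1\<^sup>2 + 2 * (of_real (A - B - h) + of_real \<kappa> * w) * r1 + of_real (1 + A + B) = 0"
    using assms(1) by simp
  then have "(r1 - r2) * (r1 - r3) = 0"
    unfolding cubic_factor(1,2)[OF N_expand assms] by (simp add: power2_eq_square algebra_simps)
  then show False using assms(4) by simp
qed

text \<open>Since x / 0 = 0, \<open>G\<close> by itself has finite values at 1 and -1; infinity is
  put in at the poles here.\<close>

definition Gext :: "ecomplex \<Rightarrow> ecomplex" where
  "Gext w = (case w of None \<Rightarrow> None | Some z \<Rightarrow> (if z = 1 \<or> z = - 1 then None else Some (G z)))"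

text \<open>Partial fractions: the polar parts are separated from the linear part and the constant h
  - A + B. The bounds for the maps psi start from this form.\<close>

lemma G_alt: "z \<noteq> 1 \<Longrightarrow> z \<noteq> - 1 \<Longrightarrow>
   G z = (z + (of_real (h - A + B) + of_real A * inverse (1 - z) - of_real B * inverse (1 + z))) / of_real \<kappa>"
proof -
  assume "z \<noteq> 1" "z \<noteq> - 1"
  then have "1 - z \<noteq> 0" "1 + z \<noteq> 0" by (auto simp: add_eq_0_iff)
  then have "z / (1 - z) = inverse (1 - z) - 1" "z / (1 + z) = 1 - inverse (1 + z)"
    by (simp_all add: field_simps)
  then have "of_real A * z / (1 - z) = of_real A * (inverse (1 - z) - 1)"
    "of_real B * z / (1 + z) = of_real B * (1 - inverse (1 + z))"
    by (metis times_divide_eq_right)+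
  then show ?thesis unfolding G_def by (simp add: algebra_simps)
qed

lemma G_at_pole:
  assumes "p = 1 \<or> p = - 1"
  shows "filterlim G at_infinity (at p)"
proof -
  have ne: "\<forall>\<^sub>F z in at p. z \<noteq> 1 \<and> z \<noteq> - 1"
    using assms by (auto intro!: eventually_conj tendsto_imp_eventually_ne[OF tendsto_ident_at] eventually_neq_at_within)
  have "filterlim (\<lambda>z. N 0 z / (of_real \<kappa> * (1 - z\<^sup>2))) at_infinity (at p)"
  proof (rule filterlim_divide_at_infinity)
    show "(N 0 \<longlongrightarrow> N 0 p) (at p)" unfolding N_def by (intro tendsto_intros)
    have "((\<lambda>z. of_real \<kappa> * (1 - z\<^sup>2)) \<longlongrightarrow> of_real \<kappa> * (1 - p\<^sup>2)) (at p)" by (intro tendsto_intros)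
    moreover have "\<forall>\<^sub>F z in at p. of_real \<kappa> * (1 - z\<^sup>2) \<noteq> 0"
      using ne by eventually_elim (use \<kappa> in \<open>simp add: power2_eq_1_iff\<close>)
    ultimately show "filterlim (\<lambda>z. of_real \<kappa> * (1 - z\<^sup>2)) (at 0) (at p)"
      using assms by (auto simp: filterlim_at)
  qed (use assms AB_neg N_poles in auto)
  moreover have "\<forall>\<^sub>F z in at p. N 0 z / (of_real \<kappa> * (1 - z\<^sup>2)) = G z"
    using ne by eventually_elim (use \<kappa> in \<open>simp add: N_eq power2_eq_1_iff\<close>)
  ultimately show ?thesis by (simp cong: filterlim_cong)
qed

lemma eventually_not_pole: "\<forall>\<^sub>F u in at_infinity. u \<noteq> (1::complex) \<and> u \<noteq> - 1"
  by (intro eventually_conj filterlim_at_infinity_imp_eventually_ne filterlim_ident)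

lemma G_linear_at_infinity:
  "((\<lambda>u. G u - u / of_real \<kappa>) \<longlongrightarrow> of_real ((h - A + B) / \<kappa>)) at_infinity"
proof -
  have "filterlim (\<lambda>u. 1 + c * u) at_infinity (at_infinity :: complex filter)" if "c \<noteq> 0" for c
    by (intro tendsto_add_filterlim_at_infinity[OF tendsto_const]
        tendsto_mult_filterlim_at_infinity[OF tendsto_const that] filterlim_ident)
  from filterlim_compose[OF tendsto_inverse_0 this[of "- 1"]] filterlim_compose[OF tendsto_inverse_0 this[of 1]]
  have i: "((\<lambda>u. inverse (1 - u)) \<longlongrightarrow> (0::complex)) at_infinity" "((\<lambda>u. inverse (1 + u)) \<longlongrightarrow> (0::complex)) at_infinity"
    by simp_all
  have "((\<lambda>u. (of_real (h - A + B) + of_real A * inverse (1 - u) - of_real B * inverse (1 + u)) / of_real \<kappa>) \<longlongrightarrow>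
     (of_real (h - A + B) + of_real A * 0 - of_real B * (0::complex)) / of_real \<kappa>) at_infinity"
    using \<kappa> by (intro tendsto_intros i) auto
  moreover have "\<forall>\<^sub>F u in at_infinity. (of_real (h - A + B) + of_real A * inverse (1 - u) - of_real B * inverse (1 + u)) / of_real \<kappa> = G u - u / of_real \<kappa>"
    using eventually_not_pole by eventually_elim (simp add: G_alt diff_divide_distrib[symmetric])
  ultimately show ?thesis by (auto simp: tendsto_cong)
qed

lemma G_at_infinity: "filterlim G at_infinity at_infinity"
proof -
  have "filterlim (\<lambda>u. inverse (of_real \<kappa>) * u) at_infinity (at_infinity :: complex filter)"
    using \<kappa> by (intro tendsto_mult_filterlim_at_infinity[OF tendsto_const] filterlim_ident) auto
  from tendsto_add_filterlim_at_infinity[OF G_linear_at_infinity this]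
  show ?thesis by (simp add: divide_inverse mult.commute)
qed

lemma continuous_map_Gext: "continuous_map ext_top ext_top Gext"
proof (rule continuous_map_extI)
  fix z :: complex
  have pole: "limitin ext_top (\<lambda>u. Gext (Some u)) (Gext (Some z)) (nhds z)"
    if "filterlim G at_infinity (at z)" "z = 1 \<or> z = - 1"
  proof -
    have "\<forall>\<^sub>F u in at z. u \<noteq> 1 \<and> u \<noteq> - 1"
      using that(2) by (auto intro!: eventually_conj tendsto_imp_eventually_ne[OF tendsto_ident_at] eventually_neq_at_within)
    then have "\<forall>\<^sub>F u in at z. Gext (Some u) = Some (G u)" by eventually_elim (simp add: Gext_def)
    moreover have "Gext (Some z) = None" using that(2) by (auto simp: Gext_def)
    ultimately show ?thesis using that(1) limitin_ext_None_nhdsI[of G z "\<lambda>u. Gext (Some u)"] by simp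
  qed
  consider "z = 1" | "z = - 1" | "z \<noteq> 1" "z \<noteq> - 1" by blast
  then show "limitin ext_top (\<lambda>u. Gext (Some u)) (Gext (Some z)) (nhds z)"
  proof cases
    case 3
    have "isCont G z" using G_deriv[OF 3] by (rule DERIV_isCont)
    then have "(G \<longlongrightarrow> G z) (nhds z)" by (simp add: continuous_within tendsto_at_iff_tendsto_nhds)
    moreover have "\<forall>\<^sub>F u in nhds z. u \<noteq> 1 \<and> u \<noteq> - 1"
      using 3 by (intro eventually_conj t1_space_nhds)
    then have "\<forall>\<^sub>F u in nhds z. Gext (Some u) = Some (G u)"
      by eventually_elim (simp add: Gext_def)
    ultimately show ?thesis using 3 by (subst (2) Gext_def) (auto intro: limitin_ext_SomeI)
  qed (use pole G_at_pole in auto)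
next
  have "\<forall>\<^sub>F u in at_infinity. Gext (Some u) = None \<or> Gext (Some u) = Some (G u)"
    using eventually_not_pole by eventually_elim (simp add: Gext_def)
  then show "limitin ext_top (\<lambda>u. Gext (Some u)) (Gext None) at_infinity"
    using limitin_ext_NoneI[OF G_at_infinity] by (simp add: Gext_def)
qed

section \<open>The regions of the sheets\<close>

text \<open>Half-regions: the sheet-k part of the plane whose G-image lies in the closed half plane
  of sign s. On the middle sheet G preserves the sign of the imaginary part, on the outer
  sheets it reverses it.\<close>

definition sg :: "nat \<Rightarrow> real" where "sg k = (if k = 1 then 1 else - 1)"

definition Half :: "nat \<Rightarrow> real \<Rightarrow> ecomplex set" where
  "Half k s = Some ` {z \<in> Reg k. 0 \<le> s * sg k * Im z} \<union> (if k = 1 then {None} else {})"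

definition Hp :: "real \<Rightarrow> ecomplex set" where
  "Hp s = insert None (Some ` {w. 0 \<le> s * Im w})"

lemma Some_in_Half [simp]: "Some z \<in> Half k s \<longleftrightarrow> z \<in> Reg k \<and> 0 \<le> s * sg k * Im z"
  by (auto simp: Half_def)

lemma None_in_Half [simp]: "None \<in> Half k s \<longleftrightarrow> k = 1"
  by (auto simp: Half_def)

lemma in_Hp [simp]: "Some w \<in> Hp s \<longleftrightarrow> 0 \<le> s * Im w" "None \<in> Hp s"
  by (auto simp: Hp_def)

lemma Hp_eq: "Hp 1 = UH" "Hp (- 1) = LH"
  by (auto simp: Hp_def UH_def LH_def)

text \<open>Beyond this radius |1 - z|^2 and |1 + z|^2 both exceed -A - B, so that A / |1 - z|^2 + B
  / |1 + z|^2 > -1. The outer regions are therefore compact, and the middle one is a neighbourhood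
  of infinity.\<close>

lemma W_nonpos_bound:
  assumes "W z \<le> 0"
  shows "cmod z \<le> 1 + sqrt (- A - B)"
proof (rule ccontr)
  assume neg: "\<not> cmod z \<le> 1 + sqrt (- A - B)"
  define K where "K = - A - B"
  have K: "0 < K" using AB_neg by (simp add: K_def)
  have "sqrt K < cmod (1 - z)" "sqrt K < cmod (1 + z)"
    using neg norm_triangle_ineq2[of z 1] norm_triangle_ineq2[of z "- 1"]
    unfolding K_def[symmetric] by (auto simp: norm_minus_commute add.commute)
  then have mn: "K < (cmod (1 - z))\<^sup>2" "K < (cmod (1 + z))\<^sup>2"
    using K real_less_rsqrt not_less real_le_rsqrt by (metis real_sqrt_less_iff real_sqrt_abs abs_norm_cancel)+
  define m n where "m = (cmod (1 - z))\<^sup>2" and "n = (cmod (1 + z))\<^sup>2"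
  note mn' = mn[folded m_def n_def]
  have "- A * n - B * m < m * n"
  proof (cases "m \<le> n")
    case True
    then have "- B * m \<le> - B * n" using AB_neg by simp
    moreover have "K * n < m * n" using mn' K by simp
    ultimately show ?thesis by (simp add: K_def algebra_simps)
  next
    case False
    then have "- A * n \<le> - A * m" using AB_neg by simp
    moreover have "K * m < n * m" using mn' K by simp
    ultimately show ?thesis by (simp add: K_def algebra_simps)
  qed
  then show False using assms unfolding W_def m_def[symmetric] n_def[symmetric] by simp
qed

lemma sg_cases: "sg k = 1 \<or> sg k = - 1"
  by (simp add: sg_def)

lemma closedin_Half: "closedin ext_top (Half k s)"
proof -
  define K where "K = {z \<in> Reg k. 0 \<le> s * sg k * Im z}"
  have K: "closed K"
    unfolding K_def by (auto intro!: closed_Collect_conj closed_Collect_le closed_Reg continuous_intros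
        simp: Collect_conj_eq closed_Int)
  show ?thesis
  proof (cases "k = 1")
    case True
    have "UNIV - Half k s = Some ` (- K)"
    proof (rule set_eqI)
      fix x show "x \<in> UNIV - Half k s \<longleftrightarrow> x \<in> Some ` (- K)"
        using True by (cases x) (auto simp: K_def)
    qed
    then show ?thesis using K by (simp add: closedin_def openin_ext_Some open_Compl)
  next
    case False
    then have "K \<subseteq> {z. W z \<le> 0}" by (auto simp: K_def Reg_def split: if_splits)
    then have "K \<subseteq> cball 0 (1 + sqrt (- A - B))" using W_nonpos_bound by auto
    then have "compact K" using K compact_eq_bounded_closed bounded_cball bounded_subset by blast
    then show ?thesis using False K unfolding Half_def K_def[symmetric]
      by (simp add: ext_top_eq)
  qed
qed

lemma Reg_disjoint: "z \<in> Reg 0 \<Longrightarrow> z \<in> Reg 2 \<Longrightarrow> False"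
  using Reg_Re[of z] order by auto

text \<open>Closed regions of adjacent sheets meet only where \<open>W\<close> vanishes, and on the
  real axis that happens only at the four critical points.\<close>

lemma Reg_inter:
  assumes "z \<in> Reg 0 \<or> z \<in> Reg 2" "z \<in> Reg 1" "Im z = 0"
  shows "z \<in> crit" "z \<in> Reg 0 \<Longrightarrow> z \<in> of_real ` {\<beta>, \<alpha>}" "z \<in> Reg 2 \<Longrightarrow> z \<in> of_real ` {a, b}"
proof -
  obtain x where x: "z = of_real x" using assms(3) by (metis complex_is_Real_iff Reals_cases)
  have "W z = 0" using assms by (auto simp: Reg_def split: if_splits)
  then show z: "z \<in> crit" unfolding x W_real crit_def by auto
  show "z \<in> of_real ` {\<beta>, \<alpha>}" if "z \<in> Reg 0"
    using z Reg_Re(1)[OF that] order by (auto simp: crit_def)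
  show "z \<in> of_real ` {a, b}" if "z \<in> Reg 2"
    using z Reg_Re(2)[OF that] order by (auto simp: crit_def)
qed

lemma poles_in_Reg [simp]: "1 \<in> Reg k \<longleftrightarrow> k \<noteq> 1 \<and> k \<noteq> 0" "- 1 \<in> Reg k \<longleftrightarrow> k = 0"
  using W_poles mid order by (auto simp: Reg_def)

lemma Gext_None_iff: "Gext x = None \<longleftrightarrow> x = None \<or> x = Some 1 \<or> x = Some (- 1)"
  by (auto simp: Gext_def split: option.splits)

lemma Gext_Some_iff: "Gext x = Some w \<longleftrightarrow> (\<exists>z. x = Some z \<and> N w z = 0)"
  by (auto simp: Gext_def N_zero_iff split: option.splits)

lemma sgn_Im_G:
  assumes "N w z = 0" "z \<in> Reg k" "s = 1 \<or> s = - 1"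
  shows "0 \<le> s * sg k * Im z \<Longrightarrow> 0 \<le> s * Im w"
    "0 < s * Im w \<longleftrightarrow> 0 < s * sg k * Im z \<and> W z \<noteq> 0"
proof -
  have z: "z \<noteq> 1" "z \<noteq> - 1" "G z = w" using assms(1) by (auto simp: N_zero_iff)
  define P where "P = \<kappa> * ((cmod (1 - z))\<^sup>2 * (cmod (1 + z))\<^sup>2)"
  have P: "0 < P" using \<kappa> z by (auto simp: P_def add_eq_0_iff)
  \<comment> \<open>The sign of \<open>W\<close> on the region of sheet k is \<open>sg k\<close>;
    this is what makes one statement serve all sheets.\<close>
  have W: "sg k * W z = \<bar>W z\<bar>" using assms(2) by (auto simp: Reg_def sg_def split: if_splits)
  have "sg k * sg k = 1" by (simp add: sg_def)
  define V where "V = \<bar>W z\<bar>"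
  have WV: "W z = sg k * V" unfolding V_def W[symmetric] mult.assoc[symmetric] \<open>sg k * sg k = 1\<close> by simp
  define u where "u = s * sg k * Im z"
  have "s * Im w = u * V / P"
    using Im_G[OF z(1,2)] unfolding z(3) P_def[symmetric] WV by (simp add: u_def)
  moreover have "0 \<le> V" "W z \<noteq> 0 \<longleftrightarrow> 0 < V" by (auto simp: V_def)
  ultimately show "0 \<le> s * sg k * Im z \<Longrightarrow> 0 \<le> s * Im w"
    "0 < s * Im w \<longleftrightarrow> 0 < s * sg k * Im z \<and> W z \<noteq> 0"
    unfolding u_def[symmetric] using P by (auto simp: zero_less_mult_iff zero_less_divide_iff)
qed

lemma Gext_Half_subset:
  assumes "s = 1 \<or> s = - 1"
  shows "Gext ` Half k s \<subseteq> Hp s"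
proof
  fix y assume "y \<in> Gext ` Half k s"
  then obtain x where x: "x \<in> Half k s" "y = Gext x" by auto
  show "y \<in> Hp s"
  proof (cases y)
    case (Some w)
    then obtain z where "x = Some z" "N w z = 0" using x Gext_Some_iff by metis
    then have "0 \<le> s * Im w" using sgn_Im_G(1)[of w z k s] assms x(1) by simp
    then show ?thesis unfolding Some by simp
  qed simp
qed

lemma G_locally_invertible:
  assumes "z \<noteq> 1" "z \<noteq> - 1" "z \<notin> crit" "open S" "z \<in> S"
  obtains r where "0 < r" "ball z r \<subseteq> S - {1, -1}" "open (G ` ball z r)" "inj_on G (ball z r)"
    "G holomorphic_on ball z r"
proof -
  have "1 - z\<^sup>2 \<noteq> 0" using assms(1,2) by (simp add: power2_eq_1_iff)
  then have "deriv G z \<noteq> 0"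
    using DERIV_imp_deriv[OF G_deriv[OF assms(1,2)]] assms(3) \<kappa> by (auto simp: crit_def)
  moreover have hol: "G holomorphic_on (S - {1, -1})"
    unfolding holomorphic_on_def
    using G_deriv by (auto simp: field_differentiable_def intro!: has_field_derivative_at_within)
  moreover have "open (S - {1, -1})" using assms(4) by (intro open_Diff finite_imp_closed) auto
  moreover have "z \<in> S - {1, -1}" using assms by auto
  ultimately show thesis
    using has_complex_derivative_locally_invertible[of G "S - {1, -1}" z] that holomorphic_on_subset
    by metis
qed

text \<open>Strict inequalities make openness evident; \<open>Int_Reg_eq\<close> identifies the set
  with the region minus its bounding ovals.\<close>

definition Int_Reg :: "nat \<Rightarrow> complex set" where
  "Int_Reg k = (if k = 1 then {z. 0 < W z} else if k = 0 then {z. W z < 0 \<and> Re z < mid}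
     else {z. W z < 0 \<and> mid < Re z})"

lemma open_Int_Reg: "open (Int_Reg k)"
  unfolding Int_Reg_def
  by (auto intro!: open_Collect_conj open_Collect_less continuous_W continuous_intros)

lemma Int_Reg_eq: "k < 3 \<Longrightarrow> Int_Reg k = {z \<in> Reg k. W z \<noteq> 0}"
  using Reg_Re mid by (auto simp: Int_Reg_def Reg_def less_Suc_eq numeral_3_eq_3 numeral_2_eq_2) force+

text \<open>The open half plane \<open>D\<close> is connected. Its covered part is closed, because
  the half-region is compact, and open, because G has no critical point off the real axis. So all of
  \<open>D\<close> is covered, hence its closure, and infinity is attained at infinity or at a
  pole.\<close>

lemma Gext_Half:
  assumes s: "s = 1 \<or> s = - 1" and k: "k < 3"
  shows "Gext ` Half k s = Hp s"
proof
  show "Gext ` Half k s \<subseteq> Hp s" by (rule Gext_Half_subset[OF s])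
  define D where "D = {w. 0 < s * Im w}"
  define T where "T = {w. Some w \<in> Gext ` Half k s}"
  define Q where "Q = {z \<in> Int_Reg k. 0 < s * sg k * Im z}"
  have "openin ext_top (UNIV - Gext ` Half k s)"
  proof -
    have "compactin ext_top (Half k s)"
      by (simp add: closedin_Half closedin_compact_space compact_space_ext_top)
    then have "compactin ext_top (Gext ` Half k s)"
      by (rule image_compactin[OF _ continuous_map_Gext])
    then have "closedin ext_top (Gext ` Half k s)"
      by (rule compactin_imp_closedin[OF Hausdorff_space_ext_top])
    then show ?thesis by (simp add: closedin_def)
  qed
  then have "open (- T)" by (simp add: openin_ext_top T_def Collect_neg_eq)
  then have T: "closed T" by (simp add: closed_def)
  have openQ: "open Q"
    unfolding Q_def by (auto intro!: open_Int open_Int_Reg open_Collect_less continuous_intros simp: Collect_conj_eq)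
  have nocrit: "z \<notin> crit" "z \<noteq> 1" "z \<noteq> - 1" if "z \<in> Q" for z
    using that by (auto simp: Q_def crit_def)
  have TD: "T \<inter> D = G ` Q"
  proof (intro equalityI subsetI)
    fix w assume "w \<in> T \<inter> D"
    then obtain x where "x \<in> Half k s" "Gext x = Some w" "0 < s * Im w" by (auto simp: T_def D_def)
    then obtain z where z: "Some z \<in> Half k s" "N w z = 0" using Gext_Some_iff by metis
    then have "z \<in> Q" using sgn_Im_G(2)[OF z(2) _ s, of k] \<open>0 < s * Im w\<close> k by (simp add: Q_def Int_Reg_eq)
    then show "w \<in> G ` Q" using z(2) by (auto simp: N_zero_iff)
  next
    fix w assume "w \<in> G ` Q"
    then obtain z where z: "z \<in> Q" "w = G z" by auto
    then have "N w z = 0" using nocrit by (simp add: N_zero_iff)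
    moreover have "z \<in> Reg k" "W z \<noteq> 0" "0 < s * sg k * Im z" using z k by (auto simp: Q_def Int_Reg_eq)
    ultimately have "w \<in> D" "Some z \<in> Half k s" "Gext (Some z) = Some w"
      using sgn_Im_G(2)[of w z k s] s Gext_Some_iff[of "Some z" w] by (simp_all add: D_def)
    then show "w \<in> T \<inter> D" unfolding T_def by (metis Int_iff image_eqI mem_Collect_eq)
  qed
  have "open (G ` Q)"
  proof (subst open_subopen, intro ballI)
    fix w assume "w \<in> G ` Q"
    then obtain z where z: "z \<in> Q" "w = G z" by auto
    obtain r where "0 < r" "ball z r \<subseteq> Q - {1, -1}" "open (G ` ball z r)"
      using G_locally_invertible[OF nocrit(2,3,1)[OF z(1)] openQ z(1)] by blast
    then show "\<exists>T. open T \<and> w \<in> T \<and> T \<subseteq> G ` Q"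
      using z by (intro exI[of _ "G ` ball z r"]) auto
  qed
  moreover have "open D" unfolding D_def by (intro open_Collect_less continuous_intros)
  moreover have "connected D"
  proof -
    have "D = {w. Im w > 0} \<or> D = {w. Im w < 0}" using s by (auto simp: D_def)
    then have "convex D" using convex_halfspace_Im_gt convex_halfspace_Im_lt by auto
    then show ?thesis by (rule convex_connected)
  qed
  moreover have "Q \<noteq> {}"
  proof -
    \<comment> \<open>A real point of the open region, which a small vertical shift moves into
      \<open>Q\<close>: the gap point for the middle sheet, the pole for an outer one.\<close>
    define c where "c = (if k = 1 then of_real mid else if k = 0 then - 1 else 1 :: complex)"
    have *: "\<forall>\<^sub>F t in at_right 0. c + \<i> * of_real (s * sg k * t) \<in> Int_Reg k" if "c \<in> Int_Reg k"
    proof -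
      have "((\<lambda>t. c + \<i> * of_real (s * sg k * t)) \<longlongrightarrow> c + \<i> * of_real (s * sg k * 0)) (at_right 0)"
        by (intro tendsto_intros)
      then show ?thesis using that open_Int_Reg topological_tendstoD by fastforce
    qed
    have "c \<in> Int_Reg k"
      using W_poles mid order W_real_nonpos[of mid] by (auto simp: c_def Int_Reg_def)
    then have "\<forall>\<^sub>F t in at_right 0. 0 < t \<and> c + \<i> * of_real (s * sg k * t) \<in> Int_Reg k"
      using * by (auto simp: eventually_conj_iff eventually_at_filter)
    then obtain t where "0 < t" "c + \<i> * of_real (s * sg k * t) \<in> Int_Reg k"
      using eventually_happens' trivial_limit_at_right_real by blast
    moreover have "Im c = 0" by (auto simp: c_def)
    ultimately have "c + \<i> * of_real (s * sg k * t) \<in> Q" using s by (auto simp: Q_def sg_def)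
    then show ?thesis by blast
  qed
  ultimately have "T \<inter> D = D"
    using T TD connected_clopen[of D] by (metis closedin_closed_Int inf_commute image_is_empty openin_open_eq inf_le1)
  then have "D \<subseteq> T" by blast
  then have "closure D \<subseteq> T" using T by (simp add: closure_minimal)
  moreover have "{w. 0 \<le> s * Im w} \<subseteq> closure D"
  proof
    fix w assume w: "w \<in> {w. 0 \<le> s * Im w}"
    have "((\<lambda>t. w + \<i> * of_real (s * t)) \<longlongrightarrow> w + \<i> * of_real (s * 0)) (at_right 0)"
      by (intro tendsto_intros)
    moreover have "\<forall>\<^sub>F t in at_right 0. w + \<i> * of_real (s * t) \<in> closure D"
    proof -
      have "w + \<i> * of_real (s * t) \<in> D" if "0 < t" for t using that w s by (auto simp: D_def)
      then have "w + \<i> * of_real (s * t) \<in> closure D" if "0 < t" for t using that closure_subset by blast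
      then show ?thesis by (intro eventually_at_rightI[of 0 1]) auto
    qed
    ultimately have "w + \<i> * of_real (s * 0) \<in> closure D"
      by (rule Lim_in_closed_set[OF closed_closure _ trivial_limit_at_right_real, rotated])
    then show "w \<in> closure D" by simp
  qed
  moreover have "None \<in> Gext ` Half k s"
  proof -
    have "(if k = 1 then None else if k = 0 then Some (- 1) else Some 1) \<in> Half k s" by simp
    then show ?thesis by (rule rev_image_eqI) (simp add: Gext_def)
  qed
  ultimately show "Hp s \<subseteq> Gext ` Half k s" by (auto simp: Hp_def T_def)
qed

section \<open>Branches of the inverse\<close>

lemma Gext_crit_values:
  "Gext (Some (of_real \<beta>)) = Some (of_real (- mu))" "Gext (Some (of_real \<alpha>)) = Some (- 1)"
  "Gext (Some (of_real a)) = Some 1" "Gext (Some (of_real b)) = Some (of_real lam)"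
  using order unfolding Gext_def option.case G_critical_values
  by (simp_all add: complex_eq_iff)

lemma crit_in_Reg:
  "of_real \<beta> \<in> Reg 0" "of_real \<beta> \<in> Reg 1" "of_real \<alpha> \<in> Reg 0" "of_real \<alpha> \<in> Reg 1"
  "of_real a \<in> Reg 1" "of_real a \<in> Reg 2" "of_real b \<in> Reg 1" "of_real b \<in> Reg 2"
  using order mid by (simp_all add: Reg_def W_real)

lemma less_3_cases: "k < (3::nat) \<Longrightarrow> k = 0 \<or> k = 1 \<or> k = 2"
  by auto

text \<open>Each sheet holds a root of \<open>N w\<close> in its half-region of sign s
  (\<open>e0\<close>, \<open>e1\<close>, \<open>e2\<close>). A second root in one half-region gives
  either four distinct roots, or a critical root among three distinct ones, or critical values of
  opposite sign.\<close>

lemma inj_on_Gext: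
  assumes s: "s = 1 \<or> s = - 1" and k: "k < 3"
  shows "inj_on Gext (Half k s)"
proof
  fix x y assume x: "x \<in> Half k s" and y: "y \<in> Half k s" and eq: "Gext x = Gext y"
  show "x = y"
  proof (cases "Gext x")
    case None
    then have "x = None \<or> x = Some 1 \<or> x = Some (- 1)" "y = None \<or> y = Some 1 \<or> y = Some (- 1)"
      using eq by (simp_all add: Gext_None_iff[symmetric])
    then show ?thesis using x y by (auto split: if_splits)
  next
    case (Some w)
    then obtain z z' where z: "x = Some z" "N w z = 0" and z': "y = Some z'" "N w z' = 0"
      using eq Gext_Some_iff by metis
    have "Some w \<in> Hp s" using x Some Gext_Half_subset[OF s, of k] by force
    have ex: "\<exists>e. N w e = 0 \<and> Some e \<in> Half j s" if "j < 3" for j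
    proof -
      have "Some w \<in> Gext ` Half j s" using \<open>Some w \<in> Hp s\<close> Gext_Half[OF s that] by simp
      then show ?thesis using Gext_Some_iff by (metis imageE)
    qed
    obtain e0 where e0: "N w e0 = 0" "Some e0 \<in> Half 0 s" using ex[of 0] by force
    obtain e1 where e1: "N w e1 = 0" "Some e1 \<in> Half 1 s" using ex[of 1] by force
    obtain e2 where e2: "N w e2 = 0" "Some e2 \<in> Half 2 s" using ex[of 2] by force
    have crit: "u \<in> crit" "i = 0 \<Longrightarrow> u \<in> of_real ` {\<beta>, \<alpha>}" "i = 2 \<Longrightarrow> u \<in> of_real ` {a, b}"
      if "Some u \<in> Half i s" "Some u \<in> Half 1 s" "i = 0 \<or> i = 2" for u i
      using that s Reg_inter[of u] by (auto simp: sg_def)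
    have d02: "Some u \<notin> Half 2 s" if "Some u \<in> Half 0 s" for u
      using that Reg_disjoint[of u] by auto
    have no: "False" if "N w r1 = 0" "N w r2 = 0" "N w r3 = 0" "r1 \<noteq> r2" "r1 \<noteq> r3" "r2 \<noteq> r3" "r1 \<in> crit" for r1 r2 r3
      using crit_no_3_roots[OF that(1-3)] that(4-) by simp
    have no4: "False" if "N w r1 = 0" "N w r2 = 0" "N w r3 = 0" "N w r4 = 0" "distinct [r1, r2, r3, r4]" for r1 r2 r3 r4
      using N_roots_le_3[OF that(1-4)] that(5) by auto
    \<comment> \<open>Keeps the two outer roots from both being shared with the middle sheet: the
      critical values on the left are negative, those on the right positive.\<close>
    have vals: False if "u \<in> of_real ` {\<beta>, \<alpha>}" "v \<in> of_real ` {a, b}" "N w u = 0" "N w v = 0" for u v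
    proof -
      have "w = G u" "w = G v" using that(3,4) by (simp_all add: N_zero_iff)
      moreover have "Re (G u) < 0" "0 < Re (G v)"
        using that(1,2) G_critical_values lam mu by auto
      ultimately show False by simp
    qed
    \<comment> \<open>A fourth root being impossible, \<open>e1\<close> is one of the three roots on
      the outer sheets, and such a shared root is critical.\<close>
    have outer: False
      if i: "i = 0 \<or> i = 2" "j = 0 \<or> j = 2" "i \<noteq> j" and e: "N w e = 0" "Some e \<in> Half j s"
        and ne: "z \<noteq> z'" "Some z \<in> Half i s" "Some z' \<in> Half i s" for i j e
    proof -
      have "z \<noteq> e" "z' \<noteq> e" using d02 i e ne by blast+
      moreover from this have "e1 = z \<or> e1 = z' \<or> e1 = e" using no4[of z z' e e1] z z' e1 e ne by auto
      ultimately show False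
        using no[of e1 z z'] no[of e1 z e] no[of e1 z' e] crit(1)[of e1 i] crit(1)[of e1 j] i e1 e z z' ne by metis
    qed
    \<comment> \<open>The shared root u is critical, so the other outer root has to be u' itself,
      which \<open>vals\<close> forbids.\<close>
    have inner: False
      if "u \<noteq> u'" "N w u = 0" "N w u' = 0" "Some u' \<in> Half 1 s" "e0 = u \<or> e2 = u" "Some u \<in> Half 1 s" for u u'
    proof -
      have "e0 \<noteq> e2" using d02 e0 e2 by blast
      then show False
        using no[of u u' e2] no[of u u' e0] crit[of u 0] crit[of u 2] crit[of u' 0] crit[of u' 2]
          vals[of u u'] vals[of u' u] that e0 e2 by metis
    qed
    have "z = z'"
    proof (rule ccontr)
      assume ne: "z \<noteq> z'"
      consider "k = 0" | "k = 1" | "k = 2" using less_3_cases[OF k] by blast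
      then show False
      proof cases
        case 1
        then show False using outer[of 0 2 e2] ne x y z z' e2 by simp
      next
        case 2
        then have zz: "Some z \<in> Half 1 s" "Some z' \<in> Half 1 s" using x y z z' by simp_all
        have "e0 = z \<or> e0 = z' \<or> e2 = z \<or> e2 = z'" using no4[of z z' e0 e2] d02 z z' e0 e2 ne by auto
        then show False using inner[of z z'] inner[of z' z] ne z z' zz by metis
      next
        case 3
        then show False using outer[of 2 0 e0] ne x y z z' e0 by simp
      qed
    qed
    then show ?thesis using z z' by simp
  qed
qed

definition branch :: "nat \<Rightarrow> real \<Rightarrow> ecomplex \<Rightarrow> ecomplex" where
  "branch k s = inv_into (Half k s) Gext"

lemma branch:
  assumes "s = 1 \<or> s = - 1" "k < 3" "w \<in> Hp s"
  shows "branch k s w \<in> Half k s" "Gext (branch k s w) = w"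
  using assms(3) unfolding branch_def Gext_Half[OF assms(1,2), symmetric]
  by (auto intro: inv_into_into f_inv_into_f)

lemma branch_eqI:
  assumes "s = 1 \<or> s = - 1" "k < 3" "x \<in> Half k s" "Gext x = w"
  shows "branch k s w = x"
  using assms(3,4) inj_on_Gext[OF assms(1,2)] unfolding branch_def by (auto intro: inv_into_f_eq)

text \<open>\<open>Gext\<close> is a continuous bijection from a compact half-region onto a
  Hausdorff half plane, so its inverse is continuous.\<close>

lemma continuous_map_branch:
  assumes s: "s = 1 \<or> s = - 1" and k: "k < 3"
  shows "continuous_map (subtopology ext_top (Hp s)) ext_top (branch k s)"
proof -
  have "compact_space (subtopology ext_top (Half k s))"
    by (simp add: compact_space_subtopology closedin_Half closedin_compact_space compact_space_ext_top)
  moreover have "continuous_map (subtopology ext_top (Half k s)) (subtopology ext_top (Hp s)) Gext"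
    using Gext_Half_subset[OF s] continuous_map_Gext
    by (auto simp: continuous_map_in_subtopology intro: continuous_map_from_subtopology)
  moreover have "Hausdorff_space (subtopology ext_top (Hp s))"
    by (simp add: Hausdorff_space_ext_top Hausdorff_space_subtopology)
  ultimately have "homeomorphic_map (subtopology ext_top (Half k s)) (subtopology ext_top (Hp s)) Gext"
    using inj_on_Gext[OF s k] Gext_Half[OF s k]
    by (intro continuous_imp_homeomorphic_map) simp_all
  then obtain f where f: "homeomorphic_maps (subtopology ext_top (Half k s)) (subtopology ext_top (Hp s)) Gext f"
    using homeomorphic_map_maps by blast
  then have "continuous_map (subtopology ext_top (Hp s)) ext_top f"
    unfolding homeomorphic_maps_def by (auto simp: continuous_map_in_subtopology)
  moreover have "f w = branch k s w" if "w \<in> topspace (subtopology ext_top (Hp s))" for w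
  proof -
    have "f w \<in> Half k s" "Gext (f w) = w"
      using f that unfolding homeomorphic_maps_def continuous_map_def by auto
    then show ?thesis using branch_eqI[OF s k] by simp
  qed
  ultimately show ?thesis by (rule continuous_map_eq)
qed

section \<open>Fibres over the real axis and real values of G\<close>

lemma N_real: "N (of_real x) (of_real t) =
   of_real ((h + t - \<kappa> * x) * (1 - t\<^sup>2) + A * t * (1 + t) + B * t * (1 - t))"
  by (simp add: N_def)

lemma N_real_root:
  assumes "u < v" "Re (N (of_real x) (of_real u)) * Re (N (of_real x) (of_real v)) < 0"
  shows "\<exists>t. u < t \<and> t < v \<and> N (of_real x) (of_real t) = 0"
proof -
  define f where "f t = Re (N (of_real x) (of_real t))" for t
  have f: "N (of_real x) (of_real t) = of_real (f t)" for t by (simp add: f_def N_real)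
  have cont: "continuous_on {u..v} f"
    unfolding f_def N_real Re_complex_of_real by (intro continuous_intros)
  have uv: "f u < 0 \<and> 0 < f v \<or> 0 < f u \<and> f v < 0"
    using assms(2) by (auto simp: f_def mult_less_0_iff)
  then obtain t where "u \<le> t" "t \<le> v" "f t = 0"
    using IVT'[of f u 0 v] IVT2'[of f v 0 u] cont assms(1) by auto
  then show ?thesis using uv f[of t] by (intro exI[of _ t]) (auto simp: less_le)
qed

lemma Re_N:
  "t \<noteq> 1 \<Longrightarrow> t \<noteq> - 1 \<Longrightarrow> Re (N (of_real x) (of_real t)) = \<kappa> * (Re (G (of_real t)) - x) * (1 - t\<^sup>2)"
  by (subst N_eq; simp add: complex_eq_iff flip: of_real_power)

text \<open>The intermediate value theorem is applied to \<open>N\<close>, which passes through the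
  pole: \<open>N\<close> is positive at -1, and its sign at \<beta> or \<alpha> is known from the
  critical value.\<close>

lemma real_root_left:
  assumes "x < - mu \<or> - 1 < x"
  shows "\<exists>t. \<beta> < t \<and> t < \<alpha> \<and> N (of_real x) (of_real t) = 0"
proof -
  have sq: "1 - \<beta>\<^sup>2 < 0" "0 < 1 - \<alpha>\<^sup>2"
    using order abs_square_less_1[of \<alpha>] abs_square_le_1[of \<beta>] by auto
  have N1: "0 < Re (N (of_real x) (of_real (- 1)))" using AB_neg by (simp add: N_poles)
  from assms show ?thesis
  proof
    assume "x < - mu"
    then have "Re (N (of_real x) (of_real \<beta>)) < 0"
      using order sq \<kappa> by (simp add: Re_N G_critical_values mult_pos_neg)
    then show ?thesis using N_real_root[OF order(1) mult_neg_pos[OF _ N1]] order by force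
  next
    assume "- 1 < x"
    then have "Re (N (of_real x) (of_real \<alpha>)) < 0"
      using order sq \<kappa> by (simp add: Re_N G_critical_values mult_pos_neg mult_neg_pos)
    then show ?thesis using N_real_root[OF order(2) mult_pos_neg[OF N1]] order by (meson less_trans)
  qed
qed

lemma real_root_right:
  assumes "x < 1 \<or> lam < x"
  shows "\<exists>t. a < t \<and> t < b \<and> N (of_real x) (of_real t) = 0"
proof -
  have sq: "1 - b\<^sup>2 < 0" "0 < 1 - a\<^sup>2"
    using order abs_square_less_1[of a] abs_square_le_1[of b] by auto
  have N1: "Re (N (of_real x) (of_real 1)) < 0" using AB_neg by (simp add: N_poles)
  from assms show ?thesis
  proof
    assume "x < 1"
    then have "0 < Re (N (of_real x) (of_real a))"
      using order sq \<kappa> by (simp add: Re_N G_critical_values)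
    then show ?thesis using N_real_root[OF order(4) mult_pos_neg[OF _ N1]] order by force
  next
    assume "lam < x"
    then have "0 < Re (N (of_real x) (of_real b))"
      using order sq \<kappa> by (simp add: Re_N G_critical_values mult_neg_neg mult_pos_neg)
    then show ?thesis using N_real_root[OF order(5) mult_neg_pos[OF N1]] order by (meson less_trans)
  qed
qed

lemma Re_G_deriv:
  assumes "t \<noteq> 1" "t \<noteq> - 1"
  shows "((\<lambda>t. Re (G (of_real t))) has_real_derivative W (of_real t) / (\<kappa> * (1 - t\<^sup>2)\<^sup>2)) (at t)"
proof -
  have "complex_of_real t \<noteq> 1" "complex_of_real t \<noteq> - 1"
    using assms by (auto simp: complex_eq_iff)
  from has_vector_derivative_real_field[OF G_deriv[OF this]]
  have "((\<lambda>t. G (of_real t)) has_vector_derivative of_real (W (of_real t) / (\<kappa> * (1 - t\<^sup>2)\<^sup>2))) (at t)"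
    by (simp add: W_real)
  from bounded_linear.has_vector_derivative[OF bounded_linear_Re this]
  show ?thesis by (simp add: has_real_derivative_iff_has_vector_derivative del: of_real_divide of_real_mult)
qed

text \<open>The sign of \<open>W\<close> is imposed inside the interval only, because one endpoint
  will be a critical point.\<close>

lemma Re_G_mono:
  fixes u v :: real
  assumes "u < v" and np: "\<And>t. u \<le> t \<Longrightarrow> t \<le> v \<Longrightarrow> t \<noteq> 1 \<and> t \<noteq> - 1"
  shows "(\<And>t. u < t \<Longrightarrow> t < v \<Longrightarrow> 0 < W (of_real t)) \<Longrightarrow> Re (G (of_real u)) < Re (G (of_real v))"
    "(\<And>t. u < t \<Longrightarrow> t < v \<Longrightarrow> W (of_real t) < 0) \<Longrightarrow> Re (G (of_real v)) < Re (G (of_real u))"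
proof -
  have cont: "continuous_on {u..v} (\<lambda>t. Re (G (of_real t)))"
    using Re_G_deriv np by (intro DERIV_continuous_on) (auto intro: has_field_derivative_at_within)
  have pos: "0 < \<kappa> * (1 - t\<^sup>2)\<^sup>2" if "u \<le> t" "t \<le> v" for t
    using np[OF that] \<kappa> by (simp add: power2_eq_1_iff)
  show "Re (G (of_real u)) < Re (G (of_real v))" if W: "\<And>t. u < t \<Longrightarrow> t < v \<Longrightarrow> 0 < W (of_real t)"
  proof (rule DERIV_pos_imp_increasing_open[OF assms(1) _ cont])
    fix t assume t: "u < t" "t < v"
    show "\<exists>y. ((\<lambda>t. Re (G (of_real t))) has_real_derivative y) (at t) \<and> 0 < y"
      using Re_G_deriv[of t] np[of t] pos[of t] W[OF t] t
      by (intro exI[of _ "W (of_real t) / (\<kappa> * (1 - t\<^sup>2)\<^sup>2)"]) (auto intro: divide_pos_pos)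
  qed
  show "Re (G (of_real v)) < Re (G (of_real u))" if W: "\<And>t. u < t \<Longrightarrow> t < v \<Longrightarrow> W (of_real t) < 0"
  proof (rule DERIV_neg_imp_decreasing_open[OF assms(1) _ cont])
    fix t assume t: "u < t" "t < v"
    show "\<exists>y. ((\<lambda>t. Re (G (of_real t))) has_real_derivative y) (at t) \<and> y < 0"
      using Re_G_deriv[of t] np[of t] pos[of t] W[OF t] t
      by (intro exI[of _ "W (of_real t) / (\<kappa> * (1 - t\<^sup>2)\<^sup>2)"]) (auto intro: divide_neg_pos)
  qed
qed

lemma W_real_pos: "0 < W (of_real x) \<longleftrightarrow> x < \<beta> \<or> (\<alpha> < x \<and> x < a) \<or> b < x"
  unfolding not_le[symmetric] W_real_nonpos using order by auto

text \<open>The counterpart of \<open>real_root_left\<close>: G decreases from -mu on the left of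
  the pole -1 and decreases to -1 on its right, so it omits [-mu, -1].\<close>

lemma real_values_left:
  assumes "\<beta> < t" "t < \<alpha>" "t \<noteq> - 1"
  shows "Re (G (of_real t)) < - mu \<or> - 1 < Re (G (of_real t))"
proof (cases "t < - 1")
  case True
  then have "Re (G (of_real t)) < Re (G (of_real \<beta>))"
    using assms order by (intro Re_G_mono(2)) (auto simp: W_real_neg)
  then show ?thesis by (simp add: G_critical_values)
next
  case False
  then have "Re (G (of_real \<alpha>)) < Re (G (of_real t))"
    using assms order by (intro Re_G_mono(2)) (auto simp: W_real_neg)
  then show ?thesis by (simp add: G_critical_values)
qed

lemma real_values_right:
  assumes "a < t" "t < b" "t \<noteq> 1"
  shows "Re (G (of_real t)) < 1 \<or> lam < Re (G (of_real t))"
proof (cases "t < 1")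
  case True
  then have "Re (G (of_real t)) < Re (G (of_real a))"
    using assms order by (intro Re_G_mono(2)) (auto simp: W_real_neg)
  then show ?thesis by (simp add: G_critical_values)
next
  case False
  then have "Re (G (of_real b)) < Re (G (of_real t))"
    using assms order by (intro Re_G_mono(2)) (auto simp: W_real_neg)
  then show ?thesis by (simp add: G_critical_values)
qed

lemma real_values_middle:
  assumes "0 < W (of_real t)"
  shows "Re (G (of_real t)) < - mu \<or> (- 1 < Re (G (of_real t)) \<and> Re (G (of_real t)) < 1) \<or> lam < Re (G (of_real t))"
  using assms unfolding W_real_pos
proof (elim disjE)
  assume t: "t < \<beta>"
  then have "Re (G (of_real t)) < Re (G (of_real \<beta>))"
    using order by (intro Re_G_mono(1)) (auto simp: W_real_pos)
  then show ?thesis by (simp add: G_critical_values)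
next
  assume t: "\<alpha> < t \<and> t < a"
  then have "Re (G (of_real \<alpha>)) < Re (G (of_real t))" "Re (G (of_real t)) < Re (G (of_real a))"
    using order by (auto intro!: Re_G_mono(1) simp: W_real_pos)
  then show ?thesis by (simp add: G_critical_values)
next
  assume t: "b < t"
  then have "Re (G (of_real b)) < Re (G (of_real t))"
    using order by (intro Re_G_mono(1)) (auto simp: W_real_pos)
  then show ?thesis by (simp add: G_critical_values)
qed

section \<open>The homeomorphism onto the sphere\<close>

text \<open>Open cuts: the endpoints are branch points, whose fibres are given by
  \<open>branch_crit\<close>.\<close>

definition cut :: "nat \<Rightarrow> real \<Rightarrow> bool" where
  "cut k x \<longleftrightarrow> ((k = 0 \<or> k = 1) \<and> - mu < x \<and> x < - 1) \<or> ((k = 1 \<or> k = 2) \<and> 1 < x \<and> x < lam)"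

lemma branch_crit:
  assumes "s = 1 \<or> s = - 1"
  shows "branch 0 s (Some (of_real (- mu))) = Some (of_real \<beta>)" "branch 1 s (Some (of_real (- mu))) = Some (of_real \<beta>)"
    "branch 0 s (Some (- 1)) = Some (of_real \<alpha>)" "branch 1 s (Some (- 1)) = Some (of_real \<alpha>)"
    "branch 1 s (Some 1) = Some (of_real a)" "branch 2 s (Some 1) = Some (of_real a)"
    "branch 1 s (Some (of_real lam)) = Some (of_real b)" "branch 2 s (Some (of_real lam)) = Some (of_real b)"
  using assms by (auto intro!: branch_eqI simp: Gext_crit_values crit_in_Reg simp del: of_real_minus One_nat_def)

lemma branch_SomeE:
  assumes "s = 1 \<or> s = - 1" "k < 3" "0 \<le> s * Im w"
  obtains z where "branch k s (Some w) = Some z" "N w z = 0" "z \<in> Reg k" "0 \<le> s * sg k * Im z"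
proof -
  have "Some w \<in> Hp s" using assms(3) by simp
  from branch[OF assms(1,2) this] obtain z where "branch k s (Some w) = Some z" "N w z = 0"
    using Gext_Some_iff by metis
  then show thesis using branch(1)[OF assms(1,2) \<open>Some w \<in> Hp s\<close>] that by simp
qed

text \<open>Apart from the branch points: on an outer sheet a real root comes from the intermediate
  value theorem. On the middle sheet both outer roots are real, and a nonreal third root would bring
  its conjugate as a fourth.\<close>

lemma branch_real:
  assumes s: "s = 1 \<or> s = - 1" and "k < 3" "\<not> cut k x"
  shows "\<exists>t. branch k s (Some (of_real x)) = Some (of_real t)"
proof -
  have root: "branch j s (Some (of_real x)) = Some (of_real t)"
    if "j < 3" "of_real t \<in> Reg j" "N (of_real x) (of_real t) = 0" for j t
    using that s by (intro branch_eqI) (auto simp: Gext_Some_iff)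
  consider "x = - mu" "k = 0 \<or> k = 1" | "x = - 1" "k = 0 \<or> k = 1" | "x = 1" "k = 1 \<or> k = 2" | "x = lam" "k = 1 \<or> k = 2"
    | "k = 0" "x < - mu \<or> - 1 < x" | "k = 2" "x < 1 \<or> lam < x" | "k = 1" "x < - mu \<or> - 1 < x" "x < 1 \<or> lam < x"
  proof -
    note nc = assms(3)[unfolded cut_def]
    from less_3_cases[OF assms(2)] consider "k = 0" | "k = 1" | "k = 2" by blast
    then show thesis
    proof cases
      case 1
      then have "x = - mu \<or> x = - 1 \<or> x < - mu \<or> - 1 < x" using nc by auto
      then show thesis using that 1 by blast
    next
      case 2
      then have "x = - mu \<or> x = - 1 \<or> x < - mu \<or> - 1 < x" "x = 1 \<or> x = lam \<or> x < 1 \<or> lam < x" using nc by auto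
      then show thesis using that 2 by blast
    next
      case 3
      then have "x = 1 \<or> x = lam \<or> x < 1 \<or> lam < x" using nc by auto
      then show thesis using that 3 by blast
    qed
  qed
  then show ?thesis
  proof cases
    case 5
    then obtain t where t: "\<beta> < t" "t < \<alpha>" "N (of_real x) (of_real t) = 0" using real_root_left by blast
    then have "W (of_real t) < 0" by (simp add: W_real_neg)
    then have "of_real t \<in> Reg 0" using t mid by (simp add: Reg_def)
    then show ?thesis using root[of 0 t] t 5 by auto
  next
    case 6
    then obtain t where t: "a < t" "t < b" "N (of_real x) (of_real t) = 0" using real_root_right by blast
    then have "W (of_real t) < 0" by (simp add: W_real_neg)
    then have "of_real t \<in> Reg 2" using t mid by (simp add: Reg_def)
    then show ?thesis using root[of 2 t] t 6 by auto
  next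
    case 7
    obtain t where t: "\<beta> < t" "t < \<alpha>" "N (of_real x) (of_real t) = 0" using 7 real_root_left by blast
    obtain t' where t': "a < t'" "t' < b" "N (of_real x) (of_real t') = 0" using 7 real_root_right by blast
    obtain z where z: "branch 1 s (Some (of_real x)) = Some z" "N (of_real x) z = 0"
      by (rule branch_SomeE[OF s, of 1 "of_real x"]) auto
    have "Im z = 0"
    proof (rule ccontr)
      assume "Im z \<noteq> 0"
      moreover have "N (of_real x) (cnj z) = 0" using N_cnj[of "of_real x" z] z(2) by simp
      moreover have "t \<noteq> t'" using t t' order by auto
      ultimately show False
        using N_roots_le_3[OF t(3) t'(3) z(2), of "cnj z"] by (auto simp: complex_eq_iff)
    qed
    then have "z = of_real (Re z)" by (simp add: complex_eq_iff)
    then show ?thesis using z(1) 7 by metis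
  next
    case 1
    then show ?thesis using branch_crit(1,2)[OF s] by (metis of_real_minus)
  next
    case 2
    then show ?thesis using branch_crit(3,4)[OF s] by (metis of_real_1 of_real_minus)
  next
    case 3
    then show ?thesis using branch_crit(5,6)[OF s] by (metis of_real_1)
  next
    case 4
    then show ?thesis using branch_crit(7,8)[OF s] by metis
  qed
qed

text \<open>If \<open>W z\<close> were nonzero, \<open>sgn_Im_G\<close> would make z real, as its
  image x is; but G maps the real points of the open region of sheet k off the cuts of that
  sheet.\<close>

lemma branch_nonreal:
  assumes s: "s = 1 \<or> s = - 1" and k: "k < 3" "cut k x"
    and z: "branch k s (Some (of_real x)) = Some z"
  shows "W z = 0"
proof (rule ccontr)
  assume W: "W z \<noteq> 0"
  obtain z' where z': "branch k s (Some (of_real x)) = Some z'" "N (of_real x) z' = 0" "z' \<in> Reg k" "0 \<le> s * sg k * Im z'"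
    by (rule branch_SomeE[OF s k(1), of "of_real x"]) auto
  then have z'': "N (of_real x) z = 0" "z \<in> Reg k" "0 \<le> s * sg k * Im z" using z by auto
  then have "s * sg k * Im z = 0" using sgn_Im_G(2)[OF z''(1,2) s] W by auto
  then have "Im z = 0" using s by (auto simp: sg_def split: if_splits)
  then obtain t where t: "z = of_real t" by (metis complex_is_Real_iff Reals_cases)
  have x: "Re (G (of_real t)) = x" "z \<noteq> 1" "z \<noteq> - 1" using z''(1) t by (simp_all add: N_zero_iff)
  then have t1: "t \<noteq> 1" "t \<noteq> - 1" using t by auto
  consider "k = 0" | "k = 1" | "k = 2" using less_3_cases[OF k(1)] by blast
  then show False
  proof cases
    case 1
    then have "W (of_real t) < 0" "t \<le> \<alpha>" using z''(2) W Reg_Re(1)[of z] t by (auto simp: Reg_def)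
    then show False using real_values_left[of t] t1 x k(2) 1 order unfolding W_real_neg by (auto simp: cut_def)
  next
    case 2
    then have "0 < W (of_real t)" using z''(2) W t by (auto simp: Reg_def)
    then show False using real_values_middle[of t] x k(2) 2 lam mu by (auto simp: cut_def)
  next
    case 3
    then have "W (of_real t) < 0" "a \<le> t" using z''(2) W Reg_Re(2)[of z] t by (auto simp: Reg_def)
    then show False using real_values_right[of t] t1 x k(2) 3 order unfolding W_real_neg by (auto simp: cut_def)
  qed
qed

text \<open>Tells which oval z lies on. Were x off the cut of sheet j, the branch there would be
  real, so z would be a real zero of \<open>W\<close>, that is a critical point, and x a branch
  point.\<close>

lemma W_zero_branch:
  assumes s: "s = 1 \<or> s = - 1" and z: "branch 1 s (Some (of_real x)) = Some z" "W z = 0"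
    and x: "x \<noteq> - mu" "x \<noteq> - 1" "x \<noteq> 1" "x \<noteq> lam"
    and j: "z \<in> Reg j" "j = 0 \<or> j = 2"
  shows "cut j x"
proof (rule ccontr)
  assume "\<not> cut j x"
  obtain z' where z': "branch 1 s (Some (of_real x)) = Some z'" "N (of_real x) z' = 0" "z' \<in> Reg 1" "0 \<le> s * sg 1 * Im z'"
    by (rule branch_SomeE[OF s, of 1 "of_real x"]) auto
  then have z'': "N (of_real x) z = 0" "z \<in> Reg 1" "0 \<le> s * Im z" using z by (auto simp: sg_def)
  \<comment> \<open>The sign is reversed because \<open>sg j\<close> and \<open>sg 1\<close> are
    opposite.\<close>
  have "branch j (- s) (Some (of_real x)) = Some z"
    using s j z'' by (intro branch_eqI) (auto simp: Gext_Some_iff sg_def)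
  moreover have "\<exists>t. branch j (- s) (Some (of_real x)) = Some (of_real t)"
    using \<open>\<not> cut j x\<close> s j by (intro branch_real) auto
  ultimately obtain t where t: "z = of_real t" by auto
  then have "t \<in> {\<beta>, \<alpha>, a, b}" using z(2) by (auto simp: W_real)
  moreover have "G (of_real t) = of_real x" using z''(1) t by (simp add: N_zero_iff)
  ultimately show False using G_critical_values x
    by (metis insertE of_real_1 of_real_eq_iff of_real_minus singletonD)
qed

text \<open>Over a cut the lower boundary values on one sheet are the upper ones on the sheet
  glued to it: the corresponding points lie on the oval separating the two regions.\<close>

lemma branch_cross:
  assumes k: "k < 3" "cut k x" and j: "j < 3" "cut j x" "j \<noteq> k"
  shows "branch j 1 (Some (of_real x)) = branch k (- 1) (Some (of_real x))"
proof -
  obtain z where z: "branch k (- 1) (Some (of_real x)) = Some z" "N (of_real x) z = 0" "z \<in> Reg k" "0 \<le> - 1 * sg k * Im z"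
    by (rule branch_SomeE[of "- 1" k "of_real x"]) (use k in auto)
  have W: "W z = 0" using branch_nonreal[OF _ k z(1)] by simp
  have "sg j = - sg k" using assms by (auto simp: cut_def sg_def)
  moreover have "z \<in> Reg j"
  proof (cases "j = 1")
    case False
    then have k1: "k = 1" "j = 0 \<or> j = 2" using assms by (auto simp: cut_def)
    \<comment> \<open>The point z lies on one of the two ovals; the cut that contains x decides on
      which.\<close>
    have "z \<in> Reg 0 \<or> z \<in> Reg 2" using W by (auto simp: Reg_def)
    moreover have "i = j" if "z \<in> Reg i" "i = 0 \<or> i = 2" for i
    proof -
      have "cut i x" using that W_zero_branch[of "- 1" x z i] z(1) W k k1 lam mu by (auto simp: cut_def)
      then show ?thesis using that(2) k1(2) j(2) by (auto simp: cut_def)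
    qed
    ultimately show ?thesis by blast
  qed (use W in \<open>simp add: Reg_def\<close>)
  ultimately show ?thesis unfolding z(1)
    using j(1) z(2,4) by (intro branch_eqI) (auto simp: Gext_Some_iff)
qed

lemma branch_off_cut:
  assumes "k < 3" "\<not> cut k x"
  shows "branch k 1 (Some (of_real x)) = branch k (- 1) (Some (of_real x))"
proof -
  obtain t where t: "branch k (- 1) (Some (of_real x)) = Some (of_real t)"
    using branch_real[OF _ assms, of "- 1"] by auto
  have "Some (complex_of_real x) \<in> Hp (- 1)" by simp
  from branch[OF _ assms(1) this] show ?thesis
    unfolding t using assms(1) by (intro branch_eqI) auto
qed

text \<open>The inverse of the map g. A real projection is given to the branch of the closed upper
  half plane, in keeping with the convention that a point over a cut is reached from its upper
  bank.\<close>

definition Phi :: "rpt \<Rightarrow> ecomplex" where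
  "Phi p = branch (fst p) (if snd p \<in> UH then 1 else - 1) (snd p)"

lemma Phi_canon:
  assumes "k < 3"
  shows "Phi (canon lam mu (k, w)) = branch k (if w \<in> UH then 1 else - 1) w"
proof (cases "canon lam mu (k, w) = (k, w)")
  case False
  then consider "k = 1" "w = Some (of_real (- mu))" | "k = 1" "w = Some (- 1)" | "k = 2" "w = Some 1" | "k = 2" "w = Some (of_real lam)"
    by (auto simp: canon_def split: if_splits)
  then show ?thesis
    by cases (simp_all add: canon_def Phi_def branch_crit branch_crit[simplified])
qed (simp add: Phi_def)

lemma Phi_chart_up:
  assumes "k < 3" "w \<in> UH"
  shows "Phi (chart_up lam mu k w) = branch k 1 w"
  using Phi_canon[OF assms(1), of w] assms(2) by (simp add: chart_up_def)

text \<open>The gluing: on a cut \<open>branch_cross\<close> matches the lower bank with the upper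
  bank of the neighbouring sheet; elsewhere on the real axis \<open>branch_off_cut\<close> joins the
  two banks of one sheet.\<close>

lemma Phi_chart_low:
  assumes "k < 3" "w \<in> LH"
  shows "Phi (chart_low lam mu k w) = branch k (- 1) w"
proof (cases w)
  case None
  have "branch k 1 None = branch k (- 1) None"
    using branch[of "- 1" k None] assms(1)
    by (intro branch_eqI) (auto simp: Gext_None_iff)
  then show ?thesis using Phi_canon[OF assms(1), of None] None by (simp add: chart_low_def)
next
  case (Some z)
  show ?thesis
  proof (cases "Im z = 0")
    case False
    then have "Some z \<notin> UH" using assms(2) Some by simp
    then show ?thesis using Phi_canon[OF assms(1), of w] Some False by (simp add: chart_low_def)
  next
    case True
    then obtain x where x: "z = of_real x" by (metis complex_is_Real_iff Reals_cases)
    have UH: "Some (complex_of_real x) \<in> UH" by simp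
    consider "k = 0 \<or> k = 1" "- mu < x" "x < - 1" | "k = 1 \<or> k = 2" "1 < x" "x < lam" | "\<not> cut k x"
      unfolding cut_def by blast
    then show ?thesis
    proof cases
      case 1
      then have "chart_low lam mu k w = (1 - k, Some (of_real x))"
        by (auto simp: chart_low_def Some x lowerpt_def)
      then show ?thesis using branch_cross[OF assms(1), of x "1 - k"] 1 UH by (auto simp: Phi_def Some x cut_def)
    next
      case 2
      then have "chart_low lam mu k w = (3 - k, Some (of_real x))"
        by (auto simp: chart_low_def Some x lowerpt_def)
      then show ?thesis using branch_cross[OF assms(1), of x "3 - k"] 2 UH by (auto simp: Phi_def Some x cut_def)
    next
      case 3
      then have "chart_low lam mu k w = canon lam mu (k, Some (of_real x))"
        by (auto simp: chart_low_def Some x lowerpt_def cut_def)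
      then show ?thesis using Phi_canon[OF assms(1), of "Some (of_real x)"] branch_off_cut[OF assms(1) 3] UH
        by (simp add: Some x)
    qed
  qed
qed

lemma Gext_Phi: "p \<in> R_pts lam mu \<Longrightarrow> Gext (Phi p) = snd p"
proof -
  assume "p \<in> R_pts lam mu"
  then have "fst p < 3" using R_pts_iff[OF lam mu, of "fst p" "snd p"] by simp
  moreover have "snd p \<in> Hp (if snd p \<in> UH then 1 else - 1)"
    by (cases "snd p") auto
  ultimately show ?thesis unfolding Phi_def by (intro branch(2)) auto
qed

lemma Half_cover: "\<exists>k<3. x \<in> Half k 1 \<or> x \<in> Half k (- 1)"
proof (cases x)
  case None
  then show ?thesis by (intro exI[of _ 1]) auto
next
  case (Some z)
  have "\<exists>k<3. z \<in> Reg k"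
  proof (cases "0 \<le> W z")
    case True
    then show ?thesis by (intro exI[of _ 1]) (simp add: Reg_def)
  next
    case False
    then show ?thesis
      by (cases "Re z \<le> mid") (force intro: exI[of _ 0] exI[of _ 2] simp: Reg_def)+
  qed
  then obtain k where "k < 3" "z \<in> Reg k" by blast
  then show ?thesis unfolding Some using sg_cases[of k] by (intro exI[of _ k]) auto
qed

text \<open>A continuous bijection from a compact to a Hausdorff space. For injectivity,
  \<open>Phi p\<close> determines the projection of p, so that only the sheet is in
  question.\<close>

lemma homeomorphic_map_Phi: "homeomorphic_map (R_top lam mu) ext_top Phi"
proof (rule continuous_imp_homeomorphic_map)
  show "continuous_map (R_top lam mu) ext_top Phi"
  proof (rule continuous_map_R_top[OF lam mu])
    fix k :: nat assume k: "k < 3"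
    show "continuous_map (subtopology ext_top UH) ext_top (\<lambda>w. Phi (chart_up lam mu k w))"
      by (rule continuous_map_eq[OF continuous_map_branch[of 1 k, unfolded Hp_eq]])
         (use k in \<open>simp_all add: Phi_chart_up\<close>)
    show "continuous_map (subtopology ext_top LH) ext_top (\<lambda>w. Phi (chart_low lam mu k w))"
      by (rule continuous_map_eq[OF continuous_map_branch[of "- 1" k, unfolded Hp_eq]])
         (use k in \<open>simp_all add: Phi_chart_low\<close>)
  qed simp
  show "compact_space (R_top lam mu)" by (rule compact_space_R_top[OF lam mu])
  show "Hausdorff_space ext_top" by (rule Hausdorff_space_ext_top)
  have "x \<in> Phi ` R_pts lam mu" for x
  proof -
    obtain k where k: "k < 3" "x \<in> Half k 1 \<or> x \<in> Half k (- 1)" using Half_cover by blast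
    then consider "x \<in> Half k 1" | "x \<in> Half k (- 1)" by blast
    then show ?thesis
    proof cases
      case 1
      then have "Gext x \<in> UH" using Gext_Half_subset[of 1 k] by (force simp: Hp_eq)
      then have "Phi (chart_up lam mu k (Gext x)) = x"
        using k(1) 1 by (simp add: Phi_chart_up branch_eqI)
      then show ?thesis using chart_up_in_R_pts[OF k(1)] by (metis imageI)
    next
      case 2
      then have "Gext x \<in> LH" using Gext_Half_subset[of "- 1" k] by (force simp: Hp_eq)
      then have "Phi (chart_low lam mu k (Gext x)) = x"
        using k(1) 2 by (simp add: Phi_chart_low branch_eqI)
      then show ?thesis using chart_low_in_R_pts[OF lam mu k(1)] by (metis imageI)
    qed
  qed
  then show "Phi ` topspace (R_top lam mu) = topspace ext_top"
    using lam mu by (auto simp: topspace_R_top)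
  show "inj_on Phi (topspace (R_top lam mu))"
  proof (rule inj_onI)
    fix p q assume "p \<in> topspace (R_top lam mu)" "q \<in> topspace (R_top lam mu)" and eq: "Phi p = Phi q"
    then have p: "p \<in> R_pts lam mu" and q: "q \<in> R_pts lam mu" using lam mu by (simp_all add: topspace_R_top)
    then have w: "snd p = snd q" using Gext_Phi eq by metis
    obtain k j w where pq: "p = (k, w)" "q = (j, w)" using w by (metis prod.collapse)
    have kj: "k < 3" "j < 3" using p q unfolding pq by (simp_all add: R_pts_iff lam mu)
    define s :: real where "s = (if w \<in> UH then 1 else - 1)"
    have s: "s = 1 \<or> s = - 1" by (simp add: s_def)
    have wH: "w \<in> Hp s" by (cases w) (auto simp: s_def)
    have x: "branch k s w = branch j s w" using eq by (simp add: pq Phi_def s_def)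
    define x where "x = branch k s w"
    have xk: "x \<in> Half k s" "x \<in> Half j s" "Gext x = w"
      using branch[OF s kj(1) wH] branch[OF s kj(2) wH] x by (simp_all add: x_def)
    show "p = q"
    proof (rule ccontr)
      assume "p \<noteq> q"
      then have ne: "k \<noteq> j" by (simp add: pq)
      \<comment> \<open>A point in the half-regions of two adjacent sheets is critical, so w is a
        branch point, and only one of the two sheets carries its canonical representative.\<close>
      have main: False if "i \<noteq> 1" "i < 3" "x \<in> Half i s" "x \<in> Half 1 s" "(1, w) \<in> R_pts lam mu" "(i, w) \<in> R_pts lam mu" for i
      proof -
        have i: "i = 0 \<or> i = 2" using that(1,2) by auto
        have "x \<noteq> None" using that(1,3) by (metis None_in_Half)
        then obtain z where z: "x = Some z" by auto
        then have "z \<in> Reg i" "z \<in> Reg 1" "0 \<le> s * sg i * Im z" "0 \<le> s * sg 1 * Im z" using that by auto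
        moreover from this have "Im z = 0" using s i by (auto simp: sg_def)
        ultimately have "z \<in> of_real ` {\<beta>, \<alpha>} \<and> i = 0 \<or> z \<in> of_real ` {a, b} \<and> i = 2"
          using Reg_inter[of z] i by auto
        then have "w \<in> {Some (of_real (- mu)), Some (- 1)} \<and> i = 0 \<or> w \<in> {Some 1, Some (of_real lam)} \<and> i = 2"
          using xk(3) Gext_crit_values unfolding z by fastforce
        then show False using that(5,6) by (auto simp: R_pts_iff lam mu)
      qed
      show False
      proof (cases "k = 1 \<or> j = 1")
        case True
        then show False using main[of k] main[of j] xk kj p q ne unfolding pq by auto
      next
        case False
        then have "x \<in> Half 0 s" "x \<in> Half 2 s"
          using ne kj xk less_3_cases[of k] less_3_cases[of j] by auto
        then show False using Reg_disjoint by (cases x) auto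
      qed
    qed
  qed
qed

text \<open>Each open region corresponds to its own sheet. This makes g explicit off the ovals,
  poles included.\<close>

lemma Phi_sheet:
  assumes "k < 3" "z \<in> Int_Reg k"
  shows "(k, Gext (Some z)) \<in> R_pts lam mu" "Phi (k, Gext (Some z)) = Some z"
proof -
  define w where "w = Gext (Some z)"
  define s :: real where "s = (if w \<in> UH then 1 else - 1)"
  have s: "s = 1 \<or> s = - 1" by (simp add: s_def)
  have z: "z \<in> Reg k" "W z \<noteq> 0" using assms by (simp_all add: Int_Reg_eq)
  have "0 \<le> s * sg k * Im z"
  proof (cases w)
    case None
    then have "z = 1 \<or> z = - 1" using Gext_None_iff[of "Some z"] by (simp add: w_def)
    then show ?thesis by auto
  next
    case (Some v)
    then have N: "N v z = 0" using Gext_Some_iff[of "Some z" v] by (simp add: w_def)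
    show ?thesis
      using sgn_Im_G(2)[OF N z(1), of 1] sgn_Im_G(2)[OF N z(1), of "- 1"] z(2) s
      by (cases "0 < Im v"; cases "Im v < 0") (auto simp: s_def Some)
  qed
  then have b: "branch k s w = Some z" using s assms(1) z(1) by (intro branch_eqI) (auto simp: w_def)
  then show "Phi (k, Gext (Some z)) = Some z" by (simp add: Phi_def s_def w_def)
  show "(k, Gext (Some z)) \<in> R_pts lam mu"
    unfolding w_def[symmetric] R_pts_iff[OF lam mu]
    using assms(1) b z(2) branch_crit[OF s] by (auto simp: W_real simp del: of_real_minus)
qed

lemma Phi_None: "Phi (1, None) = None"
  unfolding Phi_def by (intro branch_eqI) (auto simp: Gext_def)

end

section \<open>The maps psi\<close>

lemma open_sheet: "open (sheet_open lam mu k)"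
proof -
  have "closed {z. Im z = 0 \<and> ((k = 0 \<or> k = 1) \<and> - mu \<le> Re z \<and> Re z \<le> - 1 \<or>
       (k = 1 \<or> k = 2) \<and> 1 \<le> Re z \<and> Re z \<le> lam)}"
    by (intro closed_Collect_conj closed_Collect_disj closed_Collect_const closed_Collect_eq
        closed_Collect_le continuous_intros)
  then show ?thesis by (simp add: sheet_open_def closed_def Compl_eq)
qed

context three_sheets begin

definition preim :: "nat \<Rightarrow> complex \<Rightarrow> complex" where
  "preim k w = the (Phi (k, Some w))"

lemma sheet_open_R_pts: "k < 3 \<Longrightarrow> w \<in> sheet_open lam mu k \<Longrightarrow> (k, Some w) \<in> R_pts lam mu"
  using lam mu by (auto simp: R_pts_iff sheet_open_def)

lemma preim:
  assumes "k < 3" "w \<in> sheet_open lam mu k"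
  shows "Phi (k, Some w) = Some (preim k w)" "N w (preim k w) = 0" "preim k w \<in> Reg k"
    "preim k w \<noteq> 1" "preim k w \<noteq> - 1" "preim k w \<notin> crit"
proof -
  define s :: real where "s = (if Some w \<in> UH then 1 else - 1)"
  have s: "s = 1 \<or> s = - 1" by (simp add: s_def)
  obtain z where z: "branch k s (Some w) = Some z" "N w z = 0" "z \<in> Reg k"
    by (rule branch_SomeE[OF s assms(1), of w]) (auto simp: s_def)
  have P: "Phi (k, Some w) = Some z" using z(1) by (simp add: Phi_def s_def)
  then have pz: "preim k w = z" by (simp add: preim_def)
  show "Phi (k, Some w) = Some (preim k w)" using P pz by simp
  show "N w (preim k w) = 0" "preim k w \<in> Reg k" using z pz by simp_all
  then show "preim k w \<noteq> 1" "preim k w \<noteq> - 1" by (simp_all add: N_zero_iff)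
  show "preim k w \<notin> crit"
  proof
    assume "preim k w \<in> crit"
    then have c: "z \<in> of_real ` {\<beta>, \<alpha>} \<or> z \<in> of_real ` {a, b}" using pz by (auto simp: crit_def)
    then have "z \<in> of_real ` {\<beta>, \<alpha>} \<and> k \<noteq> 2 \<or> z \<in> of_real ` {a, b} \<and> k \<noteq> 0"
      using z(3) Reg_Re[of z] order by auto
    moreover have "w = G z" using z(2) by (simp add: N_zero_iff)
    ultimately show False
      using assms less_3_cases[of k] G_critical_values lam mu by (auto simp: sheet_open_def)
  qed
qed

text \<open>On each closed half plane \<open>preim k\<close> is a branch, and on the real axis off
  the cuts both branches agree.\<close>

lemma continuous_on_preim:
  assumes k: "k < 3"
  shows "continuous_on (sheet_open lam mu k) (preim k)"
proof -
  define S where "S = sheet_open lam mu k"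
  have eq: "S = (S \<inter> {w. 0 \<le> Im w}) \<union> (S \<inter> {w. Im w \<le> 0})" by auto
  have "continuous_on (S \<inter> {w. 0 \<le> Im w}) (preim k)"
  proof (rule continuous_on_ext_the[OF continuous_map_branch[of 1 k]])
    show "branch k 1 (Some z) = Some (preim k z)" if "z \<in> S \<inter> {w. 0 \<le> Im w}" for z
      using that preim(1)[OF k, of z] by (simp add: S_def Phi_def)
  qed (use k in auto)
  moreover have "continuous_on (S \<inter> {w. Im w \<le> 0}) (preim k)"
  proof (rule continuous_on_ext_the[OF continuous_map_branch[of "- 1" k]])
    show "branch k (- 1) (Some z) = Some (preim k z)" if "z \<in> S \<inter> {w. Im w \<le> 0}" for z
    proof (cases "Im z = 0")
      case True
      then obtain x where x: "z = of_real x" by (metis complex_is_Real_iff Reals_cases)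
      then have "\<not> cut k x" using that by (auto simp: S_def sheet_open_def cut_def)
      then show ?thesis using that preim(1)[OF k, of z] branch_off_cut[OF k] x by (simp add: S_def Phi_def)
    next
      case False
      then show ?thesis using that preim(1)[OF k, of z] by (simp add: S_def Phi_def)
    qed
  qed (use k in auto)
  moreover have "closedin (top_of_set S) (S \<inter> {w. 0 \<le> Im w})" "closedin (top_of_set S) (S \<inter> {w. Im w \<le> 0})"
    by (auto intro!: closedin_closed_Int closed_Collect_le continuous_intros)
  \<comment> \<open>The pasting lemma is stated for two functions; here both are
    \<open>preim k\<close>.\<close>
  ultimately have "continuous_on ((S \<inter> {w. 0 \<le> Im w}) \<union> (S \<inter> {w. Im w \<le> 0})) (\<lambda>x. if True then preim k x else preim k x)"
    using eq by (intro continuous_on_cases_local) auto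
  then show ?thesis using eq unfolding S_def by simp
qed

lemma holomorphic_on_preim:
  assumes k: "k < 3"
  shows "preim k holomorphic_on sheet_open lam mu k"
  unfolding holomorphic_on_def
proof
  fix w assume w: "w \<in> sheet_open lam mu k"
  note p = preim[OF k w]
  have "(preim k has_field_derivative inverse ((preim k w - of_real \<beta>) * (preim k w - of_real \<alpha>) *
      (preim k w - of_real a) * (preim k w - of_real b) / (of_real \<kappa> * (1 - (preim k w)\<^sup>2)\<^sup>2))) (at w)"
  proof (rule has_field_derivative_inverse_basic[where f = G and t = "sheet_open lam mu k"])
    show "(G has_field_derivative (preim k w - of_real \<beta>) * (preim k w - of_real \<alpha>) *
      (preim k w - of_real a) * (preim k w - of_real b) / (of_real \<kappa> * (1 - (preim k w)\<^sup>2)\<^sup>2)) (at (preim k w))"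
      by (rule G_deriv[OF p(4,5)])
    show "open (sheet_open lam mu k)" by (rule open_sheet)
    show "w \<in> sheet_open lam mu k" by (rule w)
    show "(preim k w - of_real \<beta>) * (preim k w - of_real \<alpha>) *
      (preim k w - of_real a) * (preim k w - of_real b) / (of_real \<kappa> * (1 - (preim k w)\<^sup>2)\<^sup>2) \<noteq> 0"
      using p(4-6) \<kappa> by (auto simp: crit_def power2_eq_1_iff)
    show "isCont (preim k) w"
      using continuous_on_preim[OF k] w open_sheet by (simp add: continuous_on_eq_continuous_at)
    show "G (preim k z) = z" if "z \<in> sheet_open lam mu k" for z
      using preim(2)[OF k that] by (simp add: N_zero_iff)
  qed
  then show "preim k field_differentiable (at w within sheet_open lam mu k)"
    using field_differentiable_def field_differentiable_at_within by blast
qed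

text \<open>On the open sheets \<open>Phi\<close> avoids 1 and -1. A Moebius map without finite
  poles other than these keeps the values finite there, so the holomorphic case of
  \<open>mero_at\<close> always applies.\<close>

lemma conformal_R_emob:
  assumes f: "\<And>q. q \<in> R_pts lam mu \<Longrightarrow> f q = emob p r u v (Phi q)"
    and det: "p * v - r * u \<noteq> 0" and nz: "\<And>z. z \<noteq> 1 \<Longrightarrow> z \<noteq> - 1 \<Longrightarrow> u * z + v \<noteq> 0"
  shows "conformal_R lam mu f"
  unfolding conformal_R_def
proof (intro conjI allI impI ballI)
  show "homeomorphic_map (R_top lam mu) ext_top f"
    by (rule homeomorphic_map_eq[OF homeomorphic_map_compose[OF homeomorphic_map_Phi emob_homeomorphic[OF det]]])
       (use f in \<open>simp add: topspace_R_top lam mu\<close>)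
  fix k w assume k: "k < (3::nat)" and w: "w \<in> sheet_open lam mu k"
  obtain \<epsilon> where \<epsilon>: "0 < \<epsilon>" "ball w \<epsilon> \<subseteq> sheet_open lam mu k"
    using w open_sheet open_contains_ball by metis
  have nz': "u * preim k z + v \<noteq> 0" if "z \<in> ball w \<epsilon>" for z
    using that \<epsilon> preim(4,5)[OF k, of z] nz by blast
  have fz: "f (k, Some z) = Some ((p * preim k z + r) / (u * preim k z + v))" if "z \<in> ball w \<epsilon>" for z
    using that \<epsilon> preim(1)[OF k, of z] nz'[OF that] f[OF sheet_open_R_pts[OF k, of z]]
    by (auto simp: emob_def)
  have "(\<lambda>z. (p * preim k z + r) / (u * preim k z + v)) holomorphic_on ball w \<epsilon>"
    using nz' holomorphic_on_subset[OF holomorphic_on_preim[OF k] \<epsilon>(2)] by (intro holomorphic_intros) auto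
  then have "(\<lambda>z. the (f (k, Some z))) holomorphic_on ball w \<epsilon>"
    by (rule holomorphic_transform) (simp add: fz)
  then show "mero_at (\<lambda>z. f (k, Some z)) w"
    unfolding mero_at_def using \<epsilon>(1) fz by (intro disjI1 exI[of _ \<epsilon>]) auto
qed

section \<open>Asymptotics at the points at infinity\<close>

lemma eventually_sheet_open: "\<forall>\<^sub>F w in at_infinity. w \<in> sheet_open lam mu k \<and> w \<noteq> 0"
  unfolding eventually_at_infinity
proof (intro exI allI impI conjI)
  fix w :: complex assume w: "lam + mu \<le> cmod w"
  show "w \<noteq> 0" using w lam mu by auto
  show "w \<in> sheet_open lam mu k"
  proof (rule ccontr)
    assume "w \<notin> sheet_open lam mu k"
    then have "Im w = 0" "\<bar>Re w\<bar> < lam + mu" using lam mu by (auto simp: sheet_open_def)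
    then show False using w by (simp add: cmod_eq_Re)
  qed
qed

lemma norm_le_sum3: "cmod (x + y + z) \<le> cmod x + cmod y + cmod z"
  by (metis add_mono_thms_linordered_semiring(3) norm_triangle_ineq order_trans)

lemma norm_real_inverse_le:
  assumes "0 < d" "d \<le> cmod x"
  shows "cmod (of_real r * inverse x) \<le> \<bar>r\<bar> / d"
  using assms by (simp add: norm_mult norm_inverse divide_inverse mult_left_mono le_imp_inverse_le)

text \<open>On sheet 0 the point at infinity corresponds to the pole -1. With t = 1 +
  \<open>preim 0 w\<close>, multiplying G by t gives kappa w t = -B + t e with bounded e. Hence t =
  O(1/w), and feeding this back, t + B / (kappa w) = O(1/w^2).\<close>

lemma preim_near_infinity_0:
  obtains Q R where "0 \<le> Q" "0 \<le> R"
    "\<And>w. w \<in> sheet_open lam mu 0 \<Longrightarrow> w \<noteq> 0 \<Longrightarrow> cmod (1 + preim 0 w) \<le> Q / cmod w"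
    "\<And>w. w \<in> sheet_open lam mu 0 \<Longrightarrow> w \<noteq> 0 \<Longrightarrow> cmod (1 + preim 0 w + of_real B / (of_real \<kappa> * w)) \<le> R / (cmod w)\<^sup>2"
proof -
  \<comment> \<open>K, E and Q bound |u|, |e| and |w t| below; R results from inserting the bounds
    for t and e into t e / (kappa w).\<close>
  define K where "K = 1 + sqrt (- A - B)"
  define E where "E = K + \<bar>h - A + B\<bar> + \<bar>A\<bar> / (1 - \<alpha>)"
  define Q where "Q = (\<bar>B\<bar> + (1 + K) * E) / \<kappa>"
  define R where "R = Q * E / \<kappa>"
  have K: "0 \<le> K" using AB_neg by (simp add: K_def)
  then have E: "0 \<le> E" unfolding E_def using order by (intro add_nonneg_nonneg divide_nonneg_nonneg) auto
  then have Q: "0 \<le> Q" unfolding Q_def using K \<kappa>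
    by (intro add_nonneg_nonneg divide_nonneg_nonneg mult_nonneg_nonneg) auto
  then have "0 \<le> R" unfolding R_def using E \<kappa> by simp
  note pos = K E Q this
  show thesis
  proof (rule that[OF pos(3,4)])
    fix w assume w: "w \<in> sheet_open lam mu 0" and w0: "w \<noteq> 0"
    define u where "u = preim 0 w"
    define t where "t = 1 + u"
    note p = preim[OF _ w, folded u_def, simplified]
    have t0: "t \<noteq> 0" using p(5) by (simp add: t_def add_eq_0_iff)
    have "Re u \<le> \<alpha>" using Reg_Re(1)[OF p(3)] by simp
    then have "1 - \<alpha> \<le> Re (1 - u)" by simp
    then have d: "1 - \<alpha> \<le> cmod (1 - u)" using complex_Re_le_cmod order_trans by blast
    have "cmod u \<le> K" unfolding K_def using p(3) by (intro W_nonpos_bound) (simp add: Reg_def)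
    define e where "e = u + of_real (h - A + B) + of_real A * inverse (1 - u)"
    have "cmod e \<le> cmod u + cmod (of_real (h - A + B)) + cmod (of_real A * inverse (1 - u))"
      unfolding e_def by (rule norm_le_sum3)
    also have "\<dots> \<le> E"
      unfolding E_def using \<open>cmod u \<le> K\<close> norm_real_inverse_le[of "1 - \<alpha>" "1 - u" A] d order
      by (intro add_mono) (auto simp: u_def simp del: of_real_add of_real_diff)
    finally have e: "cmod e \<le> E" .
    have "w = G u" using p(2) by (simp add: N_zero_iff)
    then have "of_real \<kappa> * w = e - of_real B * inverse t"
      using G_alt[OF p(4,5)] \<kappa> by (simp add: e_def t_def)
    then have "of_real \<kappa> * w * t = (e - of_real B * inverse t) * t" by simp
    also have "\<dots> = - of_real B + t * e"
      using t0 by (simp add: field_simps)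
    finally have kt: "of_real \<kappa> * w * t = - of_real B + t * e" .
    have "cmod t \<le> 1 + K" unfolding t_def using norm_triangle_ineq[of 1 u] \<open>cmod u \<le> K\<close> by simp
    then have "cmod (t * e) \<le> (1 + K) * E" using e pos by (simp add: norm_mult mult_mono)
    then have "cmod (of_real \<kappa> * w * t) \<le> \<bar>B\<bar> + (1 + K) * E"
      unfolding kt using norm_triangle_ineq[of "- of_real B" "t * e"] by simp
    then have "\<kappa> * cmod w * cmod t \<le> \<kappa> * Q" using \<kappa> by (simp add: norm_mult Q_def)
    then have "cmod w * cmod t \<le> Q" using \<kappa> by simp
    then have tQ: "cmod t \<le> Q / cmod w" using w0 by (simp add: field_simps)
    then show "cmod (1 + preim 0 w) \<le> Q / cmod w" by (simp add: t_def u_def)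
    have "t + of_real B / (of_real \<kappa> * w) = t * e / (of_real \<kappa> * w)"
    proof -
      have "of_real \<kappa> * w \<noteq> 0" using \<kappa> w0 by simp
      then have "t + of_real B / (of_real \<kappa> * w) = (of_real \<kappa> * w * t + of_real B) / (of_real \<kappa> * w)"
        by (simp add: add_divide_distrib)
      then show ?thesis unfolding kt by simp
    qed
    then have "cmod (t + of_real B / (of_real \<kappa> * w)) = cmod t * cmod e / (\<kappa> * cmod w)"
      using \<kappa> by (simp add: norm_mult norm_divide)
    also have "\<dots> \<le> (Q / cmod w) * E / (\<kappa> * cmod w)"
      using tQ e pos \<kappa> by (intro divide_right_mono mult_mono) auto
    also have "\<dots> = R / (cmod w)\<^sup>2" by (simp add: R_def power2_eq_square)
    finally show "cmod (1 + preim 0 w + of_real B / (of_real \<kappa> * w)) \<le> R / (cmod w)\<^sup>2"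
      by (simp add: t_def u_def)
  qed
qed

text \<open>The numerator p (z + 1) vanishes at -1 and the denominator stays away from 0 on
  \<open>Reg 0\<close>. With t = z + 1 and \<delta> = v - u, the identity t / (u t + \<delta>) = t /
  \<delta> - u t^2 / (\<delta> (u t + \<delta>)) carries the asymptotics of t over.\<close>

lemma emob_at_infinity_0:
  assumes f: "\<And>q. q \<in> R_pts lam mu \<Longrightarrow> f q = emob p p u v (Phi q)" and "u \<noteq> v"
    and \<epsilon>: "0 < \<epsilon>" "\<And>z. z \<in> Reg 0 \<Longrightarrow> \<epsilon> \<le> cmod (u * z + v)"
  shows "\<exists>C M. \<forall>\<^sub>F w in at_infinity. \<exists>c. f (0, Some w) = Some c \<and> cmod (c - C / w) \<le> M / (cmod w)\<^sup>2"
proof -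
  obtain Q R where QR: "0 \<le> Q" "0 \<le> R"
    "\<And>w. w \<in> sheet_open lam mu 0 \<Longrightarrow> w \<noteq> 0 \<Longrightarrow> cmod (1 + preim 0 w) \<le> Q / cmod w"
    "\<And>w. w \<in> sheet_open lam mu 0 \<Longrightarrow> w \<noteq> 0 \<Longrightarrow> cmod (1 + preim 0 w + of_real B / (of_real \<kappa> * w)) \<le> R / (cmod w)\<^sup>2"
    by (rule preim_near_infinity_0) blast
  define \<delta> where "\<delta> = v - u"
  have \<delta>: "\<delta> \<noteq> 0" using assms(2) by (simp add: \<delta>_def)
  define C where "C = - (p / \<delta>) * of_real B / of_real \<kappa>"
  define M where "M = cmod (p / \<delta>) * (R + cmod u * Q\<^sup>2 / \<epsilon>)"
  have main: "\<exists>c. f (0, Some w) = Some c \<and> cmod (c - C / w) \<le> M / (cmod w)\<^sup>2"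
    if w: "w \<in> sheet_open lam mu 0" "w \<noteq> 0" for w
  proof -
    define t where "t = 1 + preim 0 w"
    have den: "u * preim 0 w + v = u * t + \<delta>" by (simp add: t_def \<delta>_def algebra_simps)
    have e: "\<epsilon> \<le> cmod (u * t + \<delta>)" using \<epsilon>(2)[OF preim(3)[OF _ w(1)]] unfolding den by simp
    then have ne: "u * t + \<delta> \<noteq> 0" using \<epsilon>(1) by auto
    have fw: "f (0, Some w) = Some (p * (t / (u * t + \<delta>)))"
      using f[OF sheet_open_R_pts[OF _ w(1)]] preim(1)[OF _ w(1)] den ne
      by (simp add: emob_def) (simp add: t_def distrib_left add.commute)
    have "t * (u * t + \<delta>) - u * t\<^sup>2 = t * \<delta>" by (simp add: power2_eq_square algebra_simps)
    then have "t - u * t\<^sup>2 / (u * t + \<delta>) = t * \<delta> / (u * t + \<delta>)"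
      using ne by (metis diff_divide_distrib nonzero_mult_div_cancel_right)
    then have "t / (u * t + \<delta>) = (t - u * t\<^sup>2 / (u * t + \<delta>)) / \<delta>" using \<delta> by simp
    moreover have "C / w = - (p / \<delta>) * (of_real B / (of_real \<kappa> * w))" by (simp add: C_def)
    ultimately have "p * (t / (u * t + \<delta>)) - C / w = (p / \<delta>) * ((t + of_real B / (of_real \<kappa> * w)) - u * t\<^sup>2 / (u * t + \<delta>))"
      by (simp only: right_diff_distrib distrib_left diff_divide_distrib) simp
    then have "cmod (p * (t / (u * t + \<delta>)) - C / w)
        = cmod (p / \<delta>) * cmod ((t + of_real B / (of_real \<kappa> * w)) - u * t\<^sup>2 / (u * t + \<delta>))"
      by (simp only: norm_mult)
    also have "\<dots> \<le> cmod (p / \<delta>) * (cmod (t + of_real B / (of_real \<kappa> * w)) + cmod (u * t\<^sup>2 / (u * t + \<delta>)))"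
      by (intro mult_left_mono norm_triangle_ineq4 norm_ge_zero)
    also have "\<dots> \<le> cmod (p / \<delta>) * (R / (cmod w)\<^sup>2 + cmod u * (Q / cmod w)\<^sup>2 / \<epsilon>)"
    proof (intro mult_left_mono add_mono)
      show "cmod (t + of_real B / (of_real \<kappa> * w)) \<le> R / (cmod w)\<^sup>2" using QR(4)[OF w] by (simp add: t_def)
      have "(cmod t)\<^sup>2 \<le> (Q / cmod w)\<^sup>2" using QR(3)[OF w] by (intro power_mono) (auto simp: t_def)
      then show "cmod (u * t\<^sup>2 / (u * t + \<delta>)) \<le> cmod u * (Q / cmod w)\<^sup>2 / \<epsilon>"
        using e \<epsilon>(1) unfolding norm_divide norm_mult norm_power by (intro frac_le mult_left_mono) auto
    qed auto
    also have "\<dots> = M / (cmod w)\<^sup>2"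
      by (simp add: M_def power_divide add_divide_distrib distrib_left mult.commute)
    finally show ?thesis using fw by simp
  qed
  have "\<forall>\<^sub>F w in at_infinity. \<exists>c. f (0, Some w) = Some c \<and> cmod (c - C / w) \<le> M / (cmod w)\<^sup>2"
    using eventually_sheet_open[of 0] by eventually_elim (simp add: main)
  then show ?thesis by blast
qed

text \<open>The linear part of G cancels, and on the middle region the polar terms are bounded. The
  hypothesis concerns \<open>R_pts\<close> because the theorem has \<open>inv_into UNIV g\<close> in
  place of \<open>Phi\<close>, and the two agree there.\<close>

lemma is_psi_1:
  assumes f: "\<And>q. q \<in> R_pts lam mu \<Longrightarrow> f q = emob (1 / of_real \<kappa>) (1 / of_real \<kappa>) 0 1 (Phi q)"
  shows "is_psi lam mu 1 f"
  unfolding is_psi_def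
proof (intro conjI)
  show "conformal_R lam mu f" using \<kappa> by (intro conformal_R_emob[OF f]) auto
  have fz: "f (k, Some w) = Some ((1 + preim k w) / of_real \<kappa>)" if "k < 3" "w \<in> sheet_open lam mu k" for k w
    using preim(1)[OF that] f[OF sheet_open_R_pts[OF that]] by (simp add: emob_def add_divide_distrib)
  define M where "M = (\<bar>1 - (h - A + B)\<bar> + \<bar>A\<bar> / sqrt (- A) + \<bar>B\<bar> / sqrt (- B)) / \<kappa>"
  have M: "cmod ((1 + preim 1 w) / of_real \<kappa> - w) \<le> M" if w: "w \<in> sheet_open lam mu 1" for w
  proof -
    define u where "u = preim 1 w"
    note p = preim[OF _ w, folded u_def, simplified]
    have "0 \<le> W u" using preim(3)[OF _ w] by (simp add: Reg_def u_def)
    from norm_lower_middle[OF this]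
    have low: "sqrt (- A) \<le> cmod (1 - u)" "sqrt (- B) \<le> cmod (1 + u)"
      by (auto intro: real_le_lsqrt)
    have "w = G u" using p(2) by (simp add: N_zero_iff)
    then have "(1 + u) / of_real \<kappa> - w = (of_real (1 - (h - A + B)) + - of_real A * inverse (1 - u) + of_real B * inverse (1 + u)) / of_real \<kappa>"
      using G_alt[OF p(4,5)] by (simp add: diff_divide_distrib[symmetric])
    then have "cmod ((1 + u) / of_real \<kappa> - w) = cmod (of_real (1 - (h - A + B)) + - of_real A * inverse (1 - u) + of_real B * inverse (1 + u)) / \<kappa>"
      using \<kappa> by (simp add: norm_divide)
    also have "\<dots> \<le> (cmod (of_real (1 - (h - A + B))) + cmod (- of_real A * inverse (1 - u)) + cmod (of_real B * inverse (1 + u))) / \<kappa>"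
      using \<kappa> by (intro divide_right_mono norm_le_sum3) auto
    also have "\<dots> \<le> M"
      unfolding M_def using low AB_neg \<kappa> norm_real_inverse_le[of "sqrt (- A)" "1 - u" A] norm_real_inverse_le[of "sqrt (- B)" "1 + u" B]
      by (intro divide_right_mono add_mono) (auto simp del: of_real_add of_real_diff)
    finally show ?thesis by (simp add: u_def)
  qed
  have "\<forall>\<^sub>F w in at_infinity. \<exists>c. f (1, Some w) = Some c \<and> cmod (c - w) \<le> M"
    using eventually_sheet_open[of 1]
  proof eventually_elim
    fix w assume "w \<in> sheet_open lam mu 1 \<and> w \<noteq> 0"
    then show "\<exists>c. f (1, Some w) = Some c \<and> cmod (c - w) \<le> M" using M fz[of 1 w] by auto
  qed
  then show "\<exists>M. \<forall>\<^sub>F w in at_infinity. \<exists>c. f (1, Some w) = Some c \<and> cmod (c - w) \<le> M" by blast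
  show "\<exists>C M. \<forall>\<^sub>F w in at_infinity. \<exists>c. f (0, Some w) = Some c \<and> cmod (c - C / w) \<le> M / (cmod w)\<^sup>2"
    by (rule emob_at_infinity_0[OF f, of 1]) auto
qed

text \<open>The constant A / (2 kappa) is chosen to cancel the pole of G at 1, through (1 + z) / (1
  - z) = 2 / (1 - z) - 1; the remainder is bounded on \<open>Reg 2\<close>.\<close>

lemma is_psi_2:
  assumes f: "\<And>q. q \<in> R_pts lam mu \<Longrightarrow>
    f q = emob (of_real A / (2 * of_real \<kappa>)) (of_real A / (2 * of_real \<kappa>)) (- 1) 1 (Phi q)"
  shows "is_psi lam mu 2 f"
  unfolding is_psi_def
proof (intro conjI)
  show "conformal_R lam mu f" using \<kappa> AB_neg by (intro conformal_R_emob[OF f]) auto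
  define D where "D = complex_of_real A / (2 * of_real \<kappa>)"
  have fz: "f (k, Some w) = Some (D * ((1 + preim k w) / (1 - preim k w)))" if "k < 3" "w \<in> sheet_open lam mu k" for k w
    using preim(1,4)[OF that] f[OF sheet_open_R_pts[OF that]]
    by (simp add: emob_def D_def[symmetric] distrib_left add.commute)
  define M where "M = (\<bar>A / 2 - h - B\<bar> + (1 + sqrt (- A - B)) + \<bar>B\<bar> / (1 + a)) / \<kappa>"
  have M: "cmod (D * ((1 + preim 2 w) / (1 - preim 2 w)) - w) \<le> M" if w: "w \<in> sheet_open lam mu 2" for w
  proof -
    define u where "u = preim 2 w"
    note p = preim[OF _ w, folded u_def, simplified]
    have "1 + a \<le> Re (1 + u)" using Reg_Re(2)[OF p(3)] by simp
    then have low: "1 + a \<le> cmod (1 + u)" using complex_Re_le_cmod order_trans by blast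
    have "cmod u \<le> 1 + sqrt (- A - B)" using p(3) by (intro W_nonpos_bound) (simp add: Reg_def)
    have "w = G u" using p(2) by (simp add: N_zero_iff)
    moreover have "D * ((1 + u) / (1 - u)) = (of_real A * inverse (1 - u) - of_real A / 2) / of_real \<kappa>"
    proof -
      have "(1 + u) / (1 - u) = 2 * inverse (1 - u) - 1" using p(4) by (simp add: field_simps)
      then show ?thesis by (simp add: D_def diff_divide_distrib right_diff_distrib)
    qed
    ultimately have "D * ((1 + u) / (1 - u)) - w = (of_real (A / 2 - h - B) + - u + of_real B * inverse (1 + u)) / of_real \<kappa>"
      using G_alt[OF p(4,5)] by (simp add: diff_divide_distrib[symmetric])
    then have "cmod (D * ((1 + u) / (1 - u)) - w) = cmod (of_real (A / 2 - h - B) + - u + of_real B * inverse (1 + u)) / \<kappa>"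
      using \<kappa> by (simp add: norm_divide)
    also have "\<dots> \<le> (cmod (of_real (A / 2 - h - B)) + cmod (- u) + cmod (of_real B * inverse (1 + u))) / \<kappa>"
      using \<kappa> by (intro divide_right_mono norm_le_sum3) auto
    also have "\<dots> \<le> M"
      unfolding M_def using low order \<kappa> \<open>cmod u \<le> 1 + sqrt (- A - B)\<close> norm_real_inverse_le[of "1 + a" "1 + u" B]
      by (intro divide_right_mono add_mono) (auto simp del: of_real_add of_real_diff)
    finally show ?thesis by (simp add: u_def)
  qed
  have "\<forall>\<^sub>F w in at_infinity. \<exists>c. f (2, Some w) = Some c \<and> cmod (c - w) \<le> M"
    using eventually_sheet_open[of 2]
  proof eventually_elim
    fix w assume "w \<in> sheet_open lam mu 2 \<and> w \<noteq> 0"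
    then show "\<exists>c. f (2, Some w) = Some c \<and> cmod (c - w) \<le> M" using M fz[of 2 w] by auto
  qed
  then show "\<exists>M. \<forall>\<^sub>F w in at_infinity. \<exists>c. f (2, Some w) = Some c \<and> cmod (c - w) \<le> M" by blast
  show "\<exists>C M. \<forall>\<^sub>F w in at_infinity. \<exists>c. f (0, Some w) = Some c \<and> cmod (c - C / w) \<le> M / (cmod w)\<^sup>2"
  proof (rule emob_at_infinity_0[OF f, of "1 - \<alpha>"])
    fix z assume "z \<in> Reg 0"
    then have "1 - \<alpha> \<le> Re (1 - z)" using Reg_Re(1)[of z] by simp
    then show "1 - \<alpha> \<le> cmod (- 1 * z + 1)" using complex_Re_le_cmod[of "1 - z"] by simp
  qed (use order in auto)
qed

end

section \<open>Uniqueness of the maps psi\<close>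

text \<open>In the reciprocal case the value at w is not None, so the reciprocal is nonzero near w
  and can be inverted back.\<close>

lemma mero_at_finite:
  assumes "mero_at F w" "F w \<noteq> None"
  shows "(\<lambda>z. the (F z)) field_differentiable at w"
  using assms(1) unfolding mero_at_def
proof (elim disjE exE conjE)
  fix r :: real assume "0 < r" "(\<lambda>z. the (F z)) holomorphic_on ball w r"
  then show ?thesis by (auto intro: holomorphic_on_imp_differentiable_at)
next
  fix r :: real
  define q where "q z = (case F z of None \<Rightarrow> 0 | Some c \<Rightarrow> inverse c)" for z
  assume r: "0 < r" "\<forall>z\<in>ball w r. F z \<noteq> Some 0" and "(\<lambda>z. case F z of None \<Rightarrow> 0 | Some c \<Rightarrow> inverse c) holomorphic_on ball w r"
  then have hol: "q holomorphic_on ball w r" by (simp add: q_def[abs_def])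
  have qw: "q w \<noteq> 0" using assms(2) r by (auto simp: q_def)
  have o: "open (ball w r \<inter> q -` (- {0}))"
    by (rule continuous_open_preimage[OF holomorphic_on_imp_continuous_on[OF hol]]) auto
  have m: "w \<in> ball w r \<inter> q -` (- {0})" using qw r by auto
  have e: "inverse (q z) = the (F z)" if "z \<in> ball w r \<inter> q -` (- {0})" for z
    using that by (auto simp: q_def split: option.splits)
  have "(\<lambda>z. inverse (q z)) field_differentiable at w"
    using qw holomorphic_on_imp_differentiable_at[OF hol] r by (intro field_differentiable_inverse) auto
  then obtain d where "((\<lambda>z. inverse (q z)) has_field_derivative d) (at w)"
    unfolding field_differentiable_def by blast
  from has_field_derivative_transform_within_open[OF this o m e]
  show ?thesis unfolding field_differentiable_def by blast
qed

lemma conformal_R_inj: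
  assumes "conformal_R lam mu f" "lam > 1" "mu > 1"
  shows "inj_on f (R_pts lam mu)" "f ` R_pts lam mu = UNIV"
  using assms homeomorphic_imp_injective_map[of "R_top lam mu" ext_top f]
    homeomorphic_imp_surjective_map[of "R_top lam mu" ext_top f]
  by (auto simp: conformal_R_def topspace_R_top)

text \<open>A sequence to infinity off the real axis, where neither the cuts nor the renaming by
  \<open>canon\<close> interfere.\<close>

lemma imaginary_axis_at_infinity: "filterlim (\<lambda>n. \<i> * of_nat (Suc n)) at_infinity sequentially"
  by (intro tendsto_mult_filterlim_at_infinity[OF tendsto_const] filterlim_compose[OF tendsto_of_nat filterlim_Suc]) simp

lemma limitin_chart_at_infinity:
  assumes f: "continuous_map (R_top lam mu) ext_top f" and lm: "lam > 1" "mu > 1" and k: "k < 3"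
  shows "limitin ext_top (\<lambda>n. f (k, Some (\<i> * of_nat (Suc n)))) (f (k, None)) sequentially"
proof -
  have "limitin (subtopology ext_top UH) (\<lambda>n. Some (\<i> * of_nat (Suc n))) None sequentially"
    unfolding limitin_subtopology by (auto intro: limitin_ext_NoneI[OF imaginary_axis_at_infinity])
  from continuous_map_limit[OF continuous_map_compose[OF continuous_map_chart_up[OF lm k] f] this]
  have "limitin ext_top (\<lambda>n. f (chart_up lam mu k (Some (\<i> * of_nat (Suc n))))) (f (chart_up lam mu k None)) sequentially"
    by (simp add: o_def)
  moreover have "chart_up lam mu k None = (k, None)" by (simp add: chart_up_def canon_def)
  moreover have "chart_up lam mu k (Some (\<i> * of_nat (Suc n))) = (k, Some (\<i> * of_nat (Suc n)))" for n
    by (auto simp: chart_up_def canon_def complex_eq_iff)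
  ultimately show ?thesis by simp
qed

text \<open>The asymptotic conditions determine the values at two points at infinity, as limits in
  the Hausdorff sphere are unique.\<close>

lemma is_psi_at_infinity:
  assumes psi: "is_psi lam mu l f" and lm: "lam > 1" "mu > 1" and l: "l < 3"
  shows "f (l, None) = None" "f (0, None) = Some 0"
proof -
  have f: "continuous_map (R_top lam mu) ext_top f"
    using psi by (auto simp: is_psi_def conformal_R_def homeomorphic_imp_continuous_map)
  define w where "w n = \<i> * of_nat (Suc n)" for n
  have lim: "filterlim w at_infinity sequentially"
    unfolding w_def by (rule imaginary_axis_at_infinity)
  note unique = limitin_Hausdorff_unique[OF limitin_chart_at_infinity[OF f lm, folded w_def] _ trivial_limit_sequentially Hausdorff_space_ext_top]
  obtain M where M: "\<forall>\<^sub>F w in at_infinity. \<exists>c. f (l, Some w) = Some c \<and> cmod (c - w) \<le> M"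
    using psi by (auto simp: is_psi_def)
  have ev: "\<forall>\<^sub>F n in sequentially. \<exists>c. f (l, Some (w n)) = Some c \<and> cmod (c - w n) \<le> M"
    using lim M unfolding filterlim_iff by blast
  have "filterlim (\<lambda>n. the (f (l, Some (w n)))) at_infinity sequentially"
    unfolding filterlim_at_infinity_conv_norm_at_top filterlim_at_top
  proof
    fix Z
    have "\<forall>\<^sub>F n in sequentially. Z + M \<le> cmod (w n)"
      using lim unfolding filterlim_at_infinity_conv_norm_at_top filterlim_at_top by blast
    then show "\<forall>\<^sub>F n in sequentially. Z \<le> cmod (the (f (l, Some (w n))))"
      using ev
    proof eventually_elim
      fix n assume "Z + M \<le> cmod (w n)" "\<exists>c. f (l, Some (w n)) = Some c \<and> cmod (c - w n) \<le> M"
      then obtain c where "f (l, Some (w n)) = Some c" "cmod (c - w n) \<le> M" by blast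
      then show "Z \<le> cmod (the (f (l, Some (w n))))"
        using norm_triangle_ineq2[of "w n" c] \<open>Z + M \<le> cmod (w n)\<close> by (simp add: norm_minus_commute)
    qed
  qed
  moreover have "\<forall>\<^sub>F n in sequentially. f (l, Some (w n)) = None \<or> f (l, Some (w n)) = Some (the (f (l, Some (w n))))"
    by (intro always_eventually allI) (metis option.collapse)
  ultimately have "limitin ext_top (\<lambda>n. f (l, Some (w n))) None sequentially"
    by (rule limitin_ext_NoneI)
  then show "f (l, None) = None" using unique[OF l] by blast
  obtain C M where M: "\<forall>\<^sub>F w in at_infinity. \<exists>c. f (0, Some w) = Some c \<and> cmod (c - C / w) \<le> M / (cmod w)\<^sup>2"
    using psi by (auto simp: is_psi_def)
  have ev: "\<forall>\<^sub>F n in sequentially. \<exists>c. f (0, Some (w n)) = Some c \<and> cmod (c - C / w n) \<le> M / (cmod (w n))\<^sup>2"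
    using lim M unfolding filterlim_iff by blast
  have inv: "(\<lambda>n. inverse (w n)) \<longlonglongrightarrow> 0"
    by (rule filterlim_compose[OF tendsto_inverse_0 lim])
  have "(\<lambda>n. the (f (0, Some (w n))) - C / w n) \<longlonglongrightarrow> 0"
  proof (rule Lim_null_comparison)
    show "\<forall>\<^sub>F n in sequentially. norm (the (f (0, Some (w n))) - C / w n) \<le> M * (cmod (inverse (w n)))\<^sup>2"
      using ev by eventually_elim (auto simp: norm_inverse power_inverse divide_inverse)
    have "(\<lambda>n. M * (cmod (inverse (w n)))\<^sup>2) \<longlonglongrightarrow> M * (cmod 0)\<^sup>2" by (intro tendsto_intros inv)
    then show "(\<lambda>n. M * (cmod (inverse (w n)))\<^sup>2) \<longlonglongrightarrow> 0" by simp
  qed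
  moreover have "(\<lambda>n. C * inverse (w n)) \<longlonglongrightarrow> C * 0" by (intro tendsto_intros inv)
  ultimately have "(\<lambda>n. (the (f (0, Some (w n))) - C / w n) + C * inverse (w n)) \<longlonglongrightarrow> 0 + C * 0"
    by (rule tendsto_add)
  then have "(\<lambda>n. the (f (0, Some (w n)))) \<longlonglongrightarrow> 0" by (simp add: divide_inverse)
  moreover have "\<forall>\<^sub>F n in sequentially. f (0, Some (w n)) = Some (the (f (0, Some (w n))))"
    using ev by eventually_elim auto
  ultimately have "limitin ext_top (\<lambda>n. f (0, Some (w n))) (Some 0) sequentially"
    by (rule limitin_ext_SomeI)
  from unique[OF _ this] show "f (0, None) = Some 0" by simp
qed

section \<open>Composition of psi with the uniformization\<close>

context three_sheets begin

definition Phi_inv :: "ecomplex \<Rightarrow> rpt" where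
  "Phi_inv = inv_into (R_pts lam mu) Phi"

lemma Phi_bij: "inj_on Phi (R_pts lam mu)" "Phi ` R_pts lam mu = UNIV"
  using homeomorphic_imp_injective_map[OF homeomorphic_map_Phi]
    homeomorphic_imp_surjective_map[OF homeomorphic_map_Phi] lam mu
  by (simp_all add: topspace_R_top)

lemma Phi_inv: "Phi_inv x \<in> R_pts lam mu" "Phi (Phi_inv x) = x" "p \<in> R_pts lam mu \<Longrightarrow> Phi_inv (Phi p) = p"
  using Phi_bij unfolding Phi_inv_def by (auto intro: inv_into_into f_inv_into_f)

lemma homeomorphic_map_Phi_inv: "homeomorphic_map ext_top (R_top lam mu) Phi_inv"
proof -
  obtain f where f: "homeomorphic_maps (R_top lam mu) ext_top Phi f"
    using homeomorphic_map_Phi unfolding homeomorphic_map_maps by (rule exE)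
  then have "homeomorphic_maps ext_top (R_top lam mu) f Phi" by (subst homeomorphic_maps_sym)
  then have "homeomorphic_map ext_top (R_top lam mu) f"
    unfolding homeomorphic_map_maps by (rule exI[of _ Phi])
  moreover have "f x = Phi_inv x" for x
  proof -
    have "Phi (f x) = x" "f x \<in> R_pts lam mu"
      using f lam mu by (auto simp: homeomorphic_maps_def continuous_map_def topspace_R_top)
    then show ?thesis using Phi_inv(3) by metis
  qed
  ultimately show ?thesis by (rule homeomorphic_map_eq)
qed

lemma Phi_inv_sheet:
  assumes "k < 3" "z \<in> Int_Reg k"
  shows "Phi_inv (Some z) = (k, Gext (Some z))"
  using Phi_sheet[OF assms] Phi_inv(3) by metis

lemma Phi_inv_infinity:
  "Phi_inv None = (1, None)" "Phi_inv (Some 1) = (2, None)" "Phi_inv (Some (- 1)) = (0, None)"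
proof -
  have "(1, None) \<in> R_pts lam mu" by (simp add: R_pts_iff lam mu)
  then show "Phi_inv None = (1, None)" using Phi_inv(3) Phi_None by metis
  have i: "1 \<in> Int_Reg 2" "- 1 \<in> Int_Reg 0" using W_poles mid order by (auto simp: Int_Reg_def)
  show "Phi_inv (Some 1) = (2, None)" "Phi_inv (Some (- 1)) = (0, None)"
    using Phi_inv_sheet[OF _ i(1)] Phi_inv_sheet[OF _ i(2)] by (simp_all add: Gext_def)
qed

text \<open>The composition of f with g in the plane coordinate. The lemmas on its regularity assume
  finite values, so that \<open>the\<close> is harmless.\<close>

definition lift :: "(rpt \<Rightarrow> ecomplex) \<Rightarrow> complex \<Rightarrow> complex" where
  "lift f z = the (f (Phi_inv (Some z)))"

lemma continuous_map_lift:
  assumes "conformal_R lam mu f"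
  shows "continuous_map ext_top ext_top (\<lambda>x. f (Phi_inv x))"
proof -
  have "continuous_map (R_top lam mu) ext_top f"
    using assms by (auto simp: conformal_R_def intro: homeomorphic_imp_continuous_map)
  from continuous_map_compose[OF homeomorphic_imp_continuous_map[OF homeomorphic_map_Phi_inv] this]
  show ?thesis by (simp add: o_def)
qed

lemma continuous_on_lift:
  assumes f: "conformal_R lam mu f" and fin: "\<And>z. z \<in> S \<Longrightarrow> f (Phi_inv (Some z)) \<noteq> None"
  shows "continuous_on S (lift f)"
proof (rule continuous_on_ext_the)
  show "continuous_map (subtopology ext_top UNIV) ext_top (\<lambda>x. f (Phi_inv x))"
    using continuous_map_lift[OF f] by simp
qed (use fin in \<open>auto simp: lift_def\<close>)

text \<open>G is locally biholomorphic away from its critical points and poles. In the local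
  coordinate G the lift is continuous and holomorphic off the real line, hence holomorphic.\<close>

lemma lift_holomorphic_regular:
  assumes f: "conformal_R lam mu f" and S: "open S" and fin: "\<And>z. z \<in> S \<Longrightarrow> f (Phi_inv (Some z)) \<noteq> None"
    and reg: "S \<inter> (crit \<union> {1, - 1}) = {}"
  shows "lift f holomorphic_on S"
  unfolding holomorphic_on_def
proof
  fix z0 assume z0: "z0 \<in> S"
  obtain r where r: "0 < r" "ball z0 r \<subseteq> S - {1, -1}" "open (G ` ball z0 r)" "inj_on G (ball z0 r)"
    "G holomorphic_on ball z0 r"
    using G_locally_invertible[OF _ _ _ S z0] reg z0 by blast
  \<comment> \<open>In the coordinate w = G z the boundaries between the regions lie on the real
    line; off it the lift is locally one of the functions f (k, w).\<close>
  define D where "D = G ` ball z0 r"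
  obtain \<gamma> where \<gamma>: "\<gamma> holomorphic_on D" "\<And>z. z \<in> ball z0 r \<Longrightarrow> \<gamma> (G z) = z"
    using holomorphic_has_inverse[OF r(5) open_ball r(4)] unfolding D_def by metis
  have \<gamma>D: "\<gamma> w \<in> ball z0 r" "G (\<gamma> w) = w" if "w \<in> D" for w using that \<gamma>(2) by (auto simp: D_def)
  have cont\<gamma>: "continuous_on D \<gamma>" by (rule holomorphic_on_imp_continuous_on[OF \<gamma>(1)])
  have "continuous_on S (lift f)" by (rule continuous_on_lift[OF f fin])
  then have cont: "continuous_on D (\<lambda>w. lift f (\<gamma> w))"
    using \<gamma>D(1) r(2) by (intro continuous_on_compose2[OF _ cont\<gamma>]) blast+
  have diff: "(\<lambda>w. lift f (\<gamma> w)) field_differentiable at w" if w: "w \<in> D" "Im w \<noteq> 0" for w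
  proof -
    have g: "\<gamma> w \<in> S" "\<gamma> w \<noteq> 1" "\<gamma> w \<noteq> - 1" using \<gamma>D(1)[OF w(1)] r(2) by auto
    have "W (\<gamma> w) \<noteq> 0" using Im_G[OF g(2,3)] w \<gamma>D(2)[OF w(1)] by auto
    then obtain k where k: "k < 3" "\<gamma> w \<in> Int_Reg k"
    proof (cases "0 < W (\<gamma> w)")
      case True
      then show thesis using that[of 1] by (simp add: Int_Reg_def)
    next
      case False
      then show thesis using that[of 0] that[of 2] \<open>W (\<gamma> w) \<noteq> 0\<close> W_nonpos_Re[of "\<gamma> w"] mid
        by (cases "Re (\<gamma> w) < mid") (auto simp: Int_Reg_def)
    qed
    \<comment> \<open>Near w the local inverse stays in one region, so the lift involves a single
      sheet there.\<close>
    define V where "V = D \<inter> \<gamma> -` Int_Reg k"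
    have "open V" unfolding V_def using r(3) by (intro continuous_open_preimage[OF cont\<gamma>] open_Int_Reg) (simp add: D_def)
    have eq: "lift f (\<gamma> v) = the (f (k, Some v))" "f (Phi_inv (Some (\<gamma> v))) = f (k, Some v)" if "v \<in> V" for v
    proof -
      have v: "v \<in> D" "\<gamma> v \<in> Int_Reg k" using that by (auto simp: V_def)
      then have "Gext (Some (\<gamma> v)) = Some v" using \<gamma>D[OF v(1)] r(2) by (auto simp: Gext_def)
      then show "lift f (\<gamma> v) = the (f (k, Some v))" "f (Phi_inv (Some (\<gamma> v))) = f (k, Some v)"
        using Phi_inv_sheet[OF k(1) v(2)] by (simp_all add: lift_def)
    qed
    have wV: "w \<in> V" using w k by (simp add: V_def)
    have "w \<in> sheet_open lam mu k" using w(2) by (simp add: sheet_open_def)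
    then have "mero_at (\<lambda>z. f (k, Some z)) w" using f k(1) by (simp add: conformal_R_def)
    moreover have "f (k, Some w) \<noteq> None" using fin[OF g(1)] eq(2)[OF wV] by simp
    ultimately have "(\<lambda>z. the (f (k, Some z))) field_differentiable at w" by (rule mero_at_finite)
    then obtain d where "((\<lambda>z. the (f (k, Some z))) has_field_derivative d) (at w)"
      unfolding field_differentiable_def by blast
    from has_field_derivative_transform_within_open[OF this \<open>open V\<close> wV eq(1)[symmetric]]
    show ?thesis unfolding field_differentiable_def by blast
  qed
  have im: "\<i> \<bullet> w = Im w" for w by (simp add: inner_complex_def)
  have "(\<lambda>w. lift f (\<gamma> w)) holomorphic_on D"
  proof (rule holomorphic_on_paste_across_line[of D "\<i>" _ 0])
    show "open D" using r(3) by (simp add: D_def)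
    show "(\<lambda>w. lift f (\<gamma> w)) holomorphic_on D \<inter> {z. \<i> \<bullet> z < 0}"
      "(\<lambda>w. lift f (\<gamma> w)) holomorphic_on D \<inter> {z. 0 < \<i> \<bullet> z}"
      unfolding im holomorphic_on_def using diff by (auto intro: field_differentiable_at_within)
  qed (use cont in auto)
  then have "(\<lambda>w. lift f (\<gamma> w)) \<circ> G holomorphic_on ball z0 r"
    by (intro holomorphic_on_compose r(5)) (simp add: D_def)
  then have "lift f holomorphic_on ball z0 r"
    by (rule holomorphic_transform) (simp add: \<gamma>(2))
  then have "lift f field_differentiable at z0"
    using r(1) by (auto intro: holomorphic_on_imp_differentiable_at)
  then show "lift f field_differentiable at z0 within S" by (rule field_differentiable_at_within)
qed

text \<open>Critical points and poles of G are finitely many, and continuity of the lift makes them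
  removable.\<close>

lemma lift_holomorphic:
  assumes f: "conformal_R lam mu f" and S: "open S" and fin: "\<And>z. z \<in> S \<Longrightarrow> f (Phi_inv (Some z)) \<noteq> None"
  shows "lift f holomorphic_on S"
proof (rule no_isolated_singularity)
  show fin': "finite (crit \<union> {1, - 1})" by (simp add: crit_def)
  show "lift f holomorphic_on S - (crit \<union> {1, - 1})"
    using fin by (intro lift_holomorphic_regular[OF f] open_Diff S finite_imp_closed fin') auto
qed (use S continuous_on_lift[OF f fin] in auto)


text \<open>Transports the normalization w + O(1) to the uniformizing coordinate; X will be
  \<open>at_infinity\<close> for the first map and \<open>at 1\<close> for the second.\<close>

lemma lift_near_infinity:
  assumes psi: "is_psi lam mu l f" and l: "l < 3" and G: "filterlim G at_infinity X"
    and X: "\<forall>\<^sub>F z in X. z \<in> Int_Reg l" "\<forall>\<^sub>F z in X. z \<noteq> 1 \<and> z \<noteq> - 1"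
  obtains M where "\<forall>\<^sub>F z in X. cmod (lift f z - G z) \<le> M"
proof -
  obtain M where "\<forall>\<^sub>F w in at_infinity. \<exists>c. f (l, Some w) = Some c \<and> cmod (c - w) \<le> M"
    using psi by (auto simp: is_psi_def)
  then have "\<forall>\<^sub>F z in X. \<exists>c. f (l, Some (G z)) = Some c \<and> cmod (c - G z) \<le> M"
    using G unfolding filterlim_iff by blast
  with X have "\<forall>\<^sub>F z in X. cmod (lift f z - G z) \<le> M"
  proof eventually_elim
    fix z assume z: "z \<in> Int_Reg l" "z \<noteq> 1 \<and> z \<noteq> - 1" "\<exists>c. f (l, Some (G z)) = Some c \<and> cmod (c - G z) \<le> M"
    have "Phi_inv (Some z) = (l, Some (G z))" using Phi_inv_sheet[OF l z(1)] z(2) by (simp add: Gext_def)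
    then show "cmod (lift f z - G z) \<le> M" using z(3) by (auto simp: lift_def)
  qed
  then show thesis by (rule that)
qed

lemma Phi_inv_eq_iff: "Phi_inv x = Phi_inv y \<longleftrightarrow> x = y"
  by (metis Phi_inv(2))

lemma lift_not_None:
  assumes "conformal_R lam mu f" "f (Phi_inv y) = None" "x \<noteq> y"
  shows "f (Phi_inv x) \<noteq> None"
  using assms conformal_R_inj(1)[OF assms(1) lam mu] Phi_inv(1) Phi_inv_eq_iff by (metis inj_onD)

text \<open>\<open>lift f\<close> is entire, because f is infinite only at g(infinity). Subtracting
  the growth z / kappa leaves a bounded entire function, constant by Liouville's theorem, and the
  zero of \<open>lift f\<close> at -1 fixes the constant.\<close>

lemma psi_1_unique:
  assumes psi: "is_psi lam mu 1 f" and p: "p \<in> R_pts lam mu"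
  shows "f p = emob (1 / of_real \<kappa>) (1 / of_real \<kappa>) 0 1 (Phi p)"
proof -
  have conf: "conformal_R lam mu f" using psi by (simp add: is_psi_def)
  have inf: "f (Phi_inv None) = None" "f (Phi_inv (Some (- 1))) = Some 0"
    using is_psi_at_infinity[OF psi lam mu] Phi_inv_infinity by simp_all
  have fin: "f (Phi_inv (Some z)) \<noteq> None" for z
    using lift_not_None[OF conf inf(1)] by simp
  have hol: "lift f holomorphic_on UNIV" by (rule lift_holomorphic[OF conf]) (use fin in auto)
  define D where "D z = lift f z - z / of_real \<kappa>" for z
  have holD: "D holomorphic_on UNIV" unfolding D_def using \<kappa> by (intro holomorphic_intros hol) auto
  have "\<forall>\<^sub>F z in at_infinity. z \<in> Int_Reg 1"
    unfolding eventually_at_infinity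
  proof (intro exI allI impI)
    fix z assume "2 + sqrt (- A - B) \<le> cmod z"
    then show "z \<in> Int_Reg 1" using W_nonpos_bound[of z] by (force simp: Int_Reg_def not_le[symmetric])
  qed
  then obtain M where M: "\<forall>\<^sub>F z in at_infinity. cmod (lift f z - G z) \<le> M"
    using lift_near_infinity[OF psi _ G_at_infinity _ eventually_not_pole] by auto
  have "\<forall>\<^sub>F z in at_infinity. cmod (G z - z / of_real \<kappa>) < cmod (of_real ((h - A + B) / \<kappa>)) + 1"
    by (rule order_tendstoD(2)[OF tendsto_norm[OF G_linear_at_infinity]]) simp
  with M have "\<forall>\<^sub>F z in at_infinity. cmod (D z) \<le> M + (cmod (of_real ((h - A + B) / \<kappa>)) + 1)"
  proof eventually_elim
    fix z assume "cmod (lift f z - G z) \<le> M" "cmod (G z - z / of_real \<kappa>) < cmod (of_real ((h - A + B) / \<kappa>)) + 1"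
    then show "cmod (D z) \<le> M + (cmod (of_real ((h - A + B) / \<kappa>)) + 1)"
      using norm_triangle_ineq[of "lift f z - G z" "G z - z / of_real \<kappa>"] by (simp add: D_def)
  qed
  \<comment> \<open>The factor \<open>cmod z ^ 0\<close> gives the bound the form of the polynomial
    Liouville theorem, in degree 0.\<close>
  then obtain r where r: "\<And>z. r \<le> cmod z \<Longrightarrow> cmod (D z) \<le> (M + (cmod (of_real ((h - A + B) / \<kappa>)) + 1)) * cmod z ^ 0"
    unfolding eventually_at_infinity by auto
  have const: "D z = D 0" for z using Liouville_polynomial[OF holD r, where \<xi> = z] by simp
  have "D (- 1) = 1 / of_real \<kappa>" using inf(2) by (simp add: D_def lift_def)
  then have "D z = 1 / of_real \<kappa>" for z using const by metis
  then have lift: "lift f z = (1 + z) / of_real \<kappa>" for z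
    by (simp add: D_def add_divide_distrib diff_eq_eq)
  show ?thesis
  proof (cases "Phi p")
    case None
    then have "p = Phi_inv None" using Phi_inv(3)[OF p] by simp
    then show ?thesis using inf(1) None by (simp add: emob_def)
  next
    case (Some z)
    then have pz: "p = Phi_inv (Some z)" using Phi_inv(3)[OF p] by simp
    then have "f p = Some (lift f z)" using fin[of z] by (auto simp: lift_def)
    then show ?thesis using Some lift by (simp add: emob_def add_divide_distrib)
  qed
qed

text \<open>\<open>lift f\<close> is infinite only at 1, where its leading part is that of G, and it
  is bounded near infinity. So (1 - z) times it is a polynomial of degree at most 1, fixed by its
  values at 1 and -1.\<close>

lemma psi_2_unique:
  assumes psi: "is_psi lam mu 2 f" and p: "p \<in> R_pts lam mu"
  shows "f p = emob (of_real A / (2 * of_real \<kappa>)) (of_real A / (2 * of_real \<kappa>)) (- 1) 1 (Phi p)"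
proof -
  define E where "E = complex_of_real A / (2 * of_real \<kappa>)"
  have E0: "E \<noteq> 0" using AB_neg \<kappa> by (simp add: E_def)
  have conf: "conformal_R lam mu f" using psi by (simp add: is_psi_def)
  have inf: "f (Phi_inv (Some 1)) = None" "f (Phi_inv (Some (- 1))) = Some 0"
    using is_psi_at_infinity[OF psi lam mu] Phi_inv_infinity by simp_all
  have fin: "f (Phi_inv x) \<noteq> None" if "x \<noteq> Some 1" for x
    using lift_not_None[OF conf inf(1)] that by simp
  have hol: "lift f holomorphic_on (- {1})" by (rule lift_holomorphic[OF conf]) (use fin in auto)
  \<comment> \<open>The value at 1 is the limit of (1 - z) G z there, which equals that of (1 - z)
    times the lift.\<close>
  define q where "q z = (if z = 1 then of_real A / of_real \<kappa> else (1 - z) * lift f z)" for z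
  have "1 \<in> Int_Reg 2" using W_poles mid order by (auto simp: Int_Reg_def)
  then have "\<forall>\<^sub>F z in nhds 1. z \<in> Int_Reg 2" using open_Int_Reg eventually_nhds by blast
  then have X: "\<forall>\<^sub>F z in at 1. z \<in> Int_Reg 2" by (auto simp: eventually_at_filter elim: eventually_mono)
  have np: "\<forall>\<^sub>F z in at 1. z \<noteq> (1::complex) \<and> z \<noteq> - 1"
    by (auto intro!: eventually_conj tendsto_imp_eventually_ne[OF tendsto_ident_at] eventually_neq_at_within)
  obtain M where M: "\<forall>\<^sub>F z in at 1. cmod (lift f z - G z) \<le> M"
    using lift_near_infinity[OF psi _ G_at_pole X np] by auto
  have "((\<lambda>z. (1 - z) * (lift f z - G z)) \<longlongrightarrow> 0) (at 1)"
  proof (rule Lim_null_comparison)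
    show "\<forall>\<^sub>F z in at 1. cmod ((1 - z) * (lift f z - G z)) \<le> cmod (1 - z) * M"
      using M by eventually_elim (simp add: norm_mult mult_left_mono)
    have "((\<lambda>z. cmod (1 - z) * M) \<longlongrightarrow> cmod (1 - 1) * M) (at (1::complex))" by (intro tendsto_intros)
    then show "((\<lambda>z. cmod (1 - z) * M) \<longlongrightarrow> 0) (at (1::complex))" by simp
  qed
  moreover have "((\<lambda>z. ((of_real h + z) * (1 - z) + of_real A * z + of_real B * z / (1 + z) * (1 - z)) / of_real \<kappa>) \<longlongrightarrow>
     ((of_real h + 1) * (1 - 1) + of_real A * 1 + of_real B * 1 / (1 + 1) * (1 - 1)) / of_real \<kappa>) (at (1::complex))"
    using \<kappa> by (intro tendsto_intros) auto
  ultimately have "((\<lambda>z. (1 - z) * (lift f z - G z) +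
      ((of_real h + z) * (1 - z) + of_real A * z + of_real B * z / (1 + z) * (1 - z)) / of_real \<kappa>) \<longlongrightarrow>
      0 + ((of_real h + 1) * (1 - 1) + of_real A * 1 + of_real B * 1 / (1 + 1) * (1 - 1)) / of_real \<kappa>) (at (1::complex))"
    by (rule tendsto_add)
  moreover have "\<forall>\<^sub>F z in at 1. (1 - z) * (lift f z - G z) +
      ((of_real h + z) * (1 - z) + of_real A * z + of_real B * z / (1 + z) * (1 - z)) / of_real \<kappa> = q z"
    using np
  proof eventually_elim
    fix z :: complex assume z: "z \<noteq> 1 \<and> z \<noteq> - 1"
    have "(x + a' / (1 - z) + y) * (1 - z) = x * (1 - z) + a' + y * (1 - z)" for x a' y
      using z by (simp add: field_simps)
    from this[of "of_real h + z" "of_real A * z" "of_real B * z / (1 + z)"]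
    have "(1 - z) * G z = ((of_real h + z) * (1 - z) + of_real A * z + of_real B * z / (1 + z) * (1 - z)) / of_real \<kappa>"
      by (simp add: G_def mult.commute)
    then show "(1 - z) * (lift f z - G z) +
      ((of_real h + z) * (1 - z) + of_real A * z + of_real B * z / (1 + z) * (1 - z)) / of_real \<kappa> = q z"
      using z by (simp add: q_def right_diff_distrib)
  qed
  ultimately have "(q \<longlongrightarrow> 0 + ((of_real h + 1) * (1 - 1) + of_real A * 1 + of_real B * 1 / (1 + 1) * (1 - 1)) / of_real \<kappa>) (at 1)"
    by (rule Lim_transform_eventually)
  then have qlim: "(q \<longlongrightarrow> q 1) (at 1)" by (simp add: q_def[of 1])
  have "(\<lambda>z. (1 - z) * lift f z) holomorphic_on (- {1})" by (intro holomorphic_intros hol)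
  then have "q holomorphic_on (- {1})" by (rule holomorphic_transform) (simp add: q_def)
  then have hol1: "q holomorphic_on (UNIV - {1})" by (simp only: Compl_eq_Diff_UNIV)
  have holq: "q holomorphic_on UNIV"
  proof (rule no_isolated_singularity'[of "{1}"])
    show "(q \<longlongrightarrow> q z) (at z within UNIV)" if "z \<in> {1}" for z using that qlim by simp
  qed (use hol1 in auto)
  obtain c where c: "f (Phi_inv None) = Some c" using fin[of None] by auto
  have "limitin ext_top (\<lambda>u. f (Phi_inv (Some u))) (Some c) at_infinity"
  proof -
    have "limitin ext_top Some None (at_infinity :: complex filter)"
      by (rule limitin_ext_NoneI[OF filterlim_ident]) auto
    from continuous_map_limit[OF continuous_map_lift[OF conf] this] c show ?thesis by (simp add: o_def)
  qed
  then have "(lift f \<longlongrightarrow> c) at_infinity"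
  proof (rule limitin_ext_SomeD)
    show "\<forall>\<^sub>F x in at_infinity. f (Phi_inv (Some x)) = Some (lift f x)"
      using eventually_not_pole by eventually_elim (use fin in \<open>auto simp: lift_def\<close>)
  qed
  then have "\<forall>\<^sub>F z in at_infinity. cmod (lift f z) < cmod c + 1"
    by (intro order_tendstoD(2)[OF tendsto_norm]) auto
  then obtain r where r: "\<And>z. r \<le> cmod z \<Longrightarrow> cmod (lift f z) < cmod c + 1"
    unfolding eventually_at_infinity by auto
  define r' where "r' = max r 2"
  have bound: "cmod (q z) \<le> (2 * (cmod c + 1)) * cmod z ^ 1" if z: "r' \<le> cmod z" for z
  proof -
    have that: "r \<le> cmod z" "2 \<le> cmod z" using z by (auto simp: r'_def)
    have "z \<noteq> 1" using that by auto
    then have "cmod (q z) = cmod (1 - z) * cmod (lift f z)" by (simp add: q_def norm_mult)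
    also have "\<dots> \<le> (2 * cmod z) * (cmod c + 1)"
      using r[of z] that norm_triangle_ineq4[of 1 z] by (intro mult_mono) auto
    finally show ?thesis by (simp add: algebra_simps)
  qed
  define c0 c1 where "c0 = q 0" and "c1 = deriv q 0"
  have lin: "q z = c0 + c1 * z" for z
    using Liouville_polynomial[OF holq bound, where \<xi> = z] by (simp add: c0_def c1_def)
  have "q 1 = 2 * E" "q (- 1) = 0" using inf(2) by (simp_all add: q_def E_def lift_def)
  then have "c0 + c1 = 2 * E" "c0 = c1" using lin[of 1] lin[of "- 1"] by simp_all
  then have "c0 = E" "c1 = E" by simp_all
  then have lift: "lift f z = (E * z + E) / (- 1 * z + 1)" if "z \<noteq> 1" for z
    using lin[of z] that by (simp add: q_def field_simps)
  have Some: "f p = emob E E (- 1) 1 (Some z)" if "p \<in> R_pts lam mu" "Phi p = Some z" for p z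
  proof -
    have pz: "p = Phi_inv (Some z)" using Phi_inv(3)[OF that(1)] that(2) by simp
    show ?thesis
    proof (cases "z = 1")
      case True
      then show ?thesis using inf(1) pz by (simp add: emob_def)
    next
      case False
      then have "f p = Some (lift f z)" using fin[of "Some z"] pz by (auto simp: lift_def)
      then show ?thesis using lift[OF False] False by (simp add: emob_def)
    qed
  qed
  \<comment> \<open>The value at the point over infinity follows from surjectivity of f:
    \<open>emob E E (- 1) 1 None\<close> is attained somewhere, and injectivity of the Moebius map
    excludes every finite \<open>Phi p'\<close>.\<close>
  have "f p = emob E E (- 1) 1 (Phi p)"
  proof (cases "Phi p")
    case None
    obtain p' where p': "p' \<in> R_pts lam mu" "f p' = emob E E (- 1) 1 None"
      using conformal_R_inj(2)[OF conf lam mu] by (metis UNIV_I imageE)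
    have "inj (emob E E (- 1) 1)"
      using homeomorphic_imp_injective_map[OF emob_homeomorphic[of E 1 E "- 1"]] E0 by simp
    then have "Phi p' = None" using Some[OF p'(1)] p'(2) by (cases "Phi p'") (auto dest: injD)
    then have "p' = p" using Phi_inv(3)[OF p] Phi_inv(3)[OF p'(1)] None by simp
    then show ?thesis using p'(2) None by simp
  qed (use Some[OF p] in simp)
  then show ?thesis by (simp add: E_def)
qed

text \<open>The numerator is a multiple of \<open>N 0\<close>, which does not vanish at the zeros 1
  and -1 of the denominator; this gives coprimality.\<close>

lemma rational_G: "rational_of_degree 3 G"
proof -
  define k where "k = complex_of_real (1 / \<kappa>)"
  define P where "P = [: - k * of_real h, - k * of_real (1 + A + B), - k * of_real (A - B - h), k :]"
  define Q where "Q = [: - 1, 1 :] * [: 1, 1 :: complex :]"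
  have k: "k \<noteq> 0" using \<kappa> by (simp add: k_def)
  have Q: "poly Q z = z\<^sup>2 - 1" for z by (simp add: Q_def power2_eq_square algebra_simps)
  have P: "poly P z = - k * N 0 z" for z
    by (simp add: P_def N_expand power2_eq_square power3_eq_cube algebra_simps)
  have "coprime P Q"
  proof (rule coprimeI)
    fix d assume d: "d dvd P" "d dvd Q"
    have "degree d = 0"
    proof (rule ccontr)
      assume "degree d \<noteq> 0"
      then obtain z where "poly d z = 0"
        using fundamental_theorem_of_algebra[of d] by (auto simp: constant_degree)
      then have "poly P z = 0" "poly Q z = 0" using d by (auto elim!: dvdE)
      then have "N 0 z = 0" "z = 1 \<or> z = - 1" using k by (auto simp: P Q power2_eq_1_iff)
      then show False using AB_neg by (auto simp: N_poles)
    qed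
    moreover have "d \<noteq> 0" using d(2) by (auto simp: Q_def)
    ultimately show "is_unit d" by (simp add: is_unit_iff_degree)
  qed
  moreover have "Q \<noteq> 0" "degree P = 3" "degree Q = 2"
    using k by (simp_all add: Q_def P_def degree_mult_eq)
  moreover have "G z = poly P z / poly Q z" if "poly Q z \<noteq> 0" for z
  proof -
    have "z \<noteq> 1" "z \<noteq> - 1" "z\<^sup>2 - 1 \<noteq> 0" using that by (auto simp: Q)
    then have "poly P z = G z * (z\<^sup>2 - 1)"
      using \<kappa> by (simp add: P N_eq k_def algebra_simps)
    then show ?thesis using \<open>z\<^sup>2 - 1 \<noteq> 0\<close> by (simp add: Q)
  qed
  ultimately show ?thesis unfolding rational_of_degree_def
    by (intro exI[of _ P] exI[of _ Q]) auto
qed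

end

section \<open>From solutions of the system to uniformizations\<close>

text \<open>In terms of s, p, d and c, the coefficient conditions and the critical values at
  \<alpha> and a follow by algebra. The critical values at \<beta> and b are obtained from their sum
  and difference: the first equation gives H(b) + H(\<beta>), and the second gives the square of
  H(b) - H(\<beta>).\<close>

lemma three_sheets_of_solution:
  fixes lam mu \<alpha> a :: real
  assumes lm: "1 < lam" "1 < mu" and ord: "-1 < \<alpha>" "\<alpha> < a" "a < 1"
    and eq1: "2 * (a + \<alpha>) * (3 - a * \<alpha> - a - \<alpha>) * (3 - a * \<alpha> + a + \<alpha>) + (lam - mu) * (a - \<alpha>) ^ 3 = 0"
    and eq2: "(lam + mu)\<^sup>2 * (a - \<alpha>) ^ 6 = 4 * (3 + a * \<alpha>) ^ 3 * (1 - a * \<alpha>) * (2 + a + \<alpha>) * (2 - a - \<alpha>)"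
  obtains \<beta> b where "\<beta> < - 1" "1 < b"
    "\<beta>\<^sup>2 + (a + \<alpha>) * \<beta> + (a - \<alpha>)\<^sup>2 / (1 - a * \<alpha>) - 3 = 0"
    "b\<^sup>2 + (a + \<alpha>) * b + (a - \<alpha>)\<^sup>2 / (1 - a * \<alpha>) - 3 = 0"
    "three_sheets lam mu \<alpha> a \<beta> b ((1/4) * (1 - \<beta>) * (1 - \<alpha>) * (1 - a) * (1 - b))
       ((1/4) * (1 + \<beta>) * (1 + \<alpha>) * (1 + a) * (1 + b))
       ((1/4) * (a + \<alpha>) * (2 * a * \<alpha> - (a - \<alpha>)\<^sup>2 / (1 - a * \<alpha>)))
       ((a - \<alpha>)\<^sup>2 / (1 - a * \<alpha>) * (a - \<alpha>) / 4)"
proof -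
  define s p d c where "s = a + \<alpha>" and "p = a * \<alpha>" and "d = a - \<alpha>" and "c = d\<^sup>2 / (1 - p)"
  have d: "0 < d" using ord by (simp add: d_def)
  have "(1 - a) * (1 - \<alpha>) > 0" "(1 + a) * (1 + \<alpha>) > 0" using ord by simp_all
  then have q1: "0 < 1 - s + p" "0 < 1 + s + p" by (simp_all add: s_def p_def algebra_simps)
  then have p1: "0 < 1 + p" by simp
  have s2: "-2 < s" "s < 2" using ord by (simp_all add: s_def)
  have d2: "d\<^sup>2 = s\<^sup>2 - 4 * p" by (simp add: d_def s_def p_def power2_eq_square algebra_simps)
  have "4 * (1 - p) = d\<^sup>2 + (2 - s) * (2 + s)" unfolding d2 by (simp add: power2_eq_square algebra_simps)
  also have "\<dots> > 0" using d mult_pos_pos[of "2 - s" "2 + s"] s2 zero_less_power[OF d, of 2] by linarith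
  finally have p: "0 < 1 - p" by simp
  have cp: "c * (1 - p) = s\<^sup>2 - 4 * p" using p d2 by (simp add: c_def)
  have c0: "0 < c" using p d by (simp add: c_def)
  \<comment> \<open>The bounds c < 2 - s and c < 2 + s say that x^2 + s x + c - 3 is negative at 1
    and at -1, so that its roots lie on both sides of [-1, 1].\<close>
  have "(2 - s - c) * (1 - p) = (1 - s + p) * (2 + s)"
    using cp by (simp add: left_diff_distrib power2_eq_square algebra_simps)
  also have "\<dots> > 0" using q1 s2 by simp
  finally have c1: "c < 2 - s" using p by (simp add: zero_less_mult_iff)
  have "(2 + s - c) * (1 - p) = (1 + s + p) * (2 - s)"
    using cp by (simp add: left_diff_distrib power2_eq_square algebra_simps)
  also have "\<dots> > 0" using q1 s2 by simp
  finally have c2: "c < 2 + s" using p by (simp add: zero_less_mult_iff)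
  define \<Delta> where "\<Delta> = s\<^sup>2 - 4 * c + 12"
  have "0 \<le> (2 + s)\<^sup>2" by simp
  then have \<Delta>: "0 < \<Delta>" using c1 by (simp add: \<Delta>_def power2_eq_square algebra_simps)
  define \<beta> b where "\<beta> = (- s - sqrt \<Delta>) / 2" and "b = (- s + sqrt \<Delta>) / 2"
  have sb: "b = - s - \<beta>" by (simp add: \<beta>_def b_def field_simps)
  have diff: "b - \<beta> = sqrt \<Delta>" by (simp add: \<beta>_def b_def field_simps)
  have lt: "\<beta> < b" using diff \<Delta> by (metis diff_gt_0_iff_gt real_sqrt_gt_zero)
  have "4 * (u / 2 * (v / 2)) = u * v" for u v :: real by simp
  then have "4 * (\<beta> * b) = (- s - sqrt \<Delta>) * (- s + sqrt \<Delta>)" unfolding \<beta>_def b_def .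
  also have "\<dots> = s\<^sup>2 - (sqrt \<Delta>)\<^sup>2" unfolding power2_eq_square by algebra
  also have "\<dots> = 4 * (c - 3)" using \<Delta> by (simp add: \<Delta>_def)
  finally have pb: "\<beta> * b = c - 3" by simp
  have roots: "x\<^sup>2 + s * x + c - 3 = (x - \<beta>) * (x - b)" for x
    using pb by (simp add: sb power2_eq_square algebra_simps)
  have Qm: "(1 - \<beta>) * (1 - b) = s + c - 2" using roots[of 1] by simp
  have Qp: "(1 + \<beta>) * (1 + b) = c - 2 - s" using roots[of "- 1"] by (simp add: algebra_simps)
  have "(1 - \<beta>) * (1 - b) < 0" "(1 + \<beta>) * (1 + b) < 0" unfolding Qm Qp using c1 c2 by auto
  then have bb: "\<beta> < - 1" "1 < b" using lt by (auto simp: mult_less_0_iff)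
  define A B h \<kappa> where "A = (1/4) * (1 - \<beta>) * (1 - \<alpha>) * (1 - a) * (1 - b)"
    and "B = (1/4) * (1 + \<beta>) * (1 + \<alpha>) * (1 + a) * (1 + b)"
    and "h = (1/4) * (a + \<alpha>) * (2 * a * \<alpha> - (a - \<alpha>)\<^sup>2 / (1 - a * \<alpha>))"
    and "\<kappa> = (a - \<alpha>)\<^sup>2 / (1 - a * \<alpha>) * (a - \<alpha>) / 4"
  have h: "h = s * (2 * p - c) / 4" by (simp add: h_def s_def p_def c_def d_def)
  have \<kappa>: "\<kappa> = c * d / 4" by (simp add: \<kappa>_def p_def c_def d_def)
  have A: "A = ((1 - \<beta>) * (1 - b)) * ((1 - a) * (1 - \<alpha>)) / 4" "B = ((1 + \<beta>) * (1 + b)) * ((1 + a) * (1 + \<alpha>)) / 4"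
    by (simp_all add: A_def B_def)
  have q: "(1 - a) * (1 - \<alpha>) = 1 - s + p" "(1 + a) * (1 + \<alpha>) = 1 + s + p"
    by (simp_all add: s_def p_def algebra_simps)
  have A': "A = (s + c - 2) * (1 - s + p) / 4" "B = (c - 2 - s) * (1 + s + p) / 4"
    using A unfolding Qm Qp q by simp_all
  have AB: "A + B = ((c - 2) * (1 + p) - s\<^sup>2) / 2" "B - A = s * (c - 3 - p) / 2"
    unfolding A' by (simp_all add: power2_eq_square field_simps)
  \<comment> \<open>A and B contain the linear factors that occur as denominators at the critical
    points, so the polar terms become polynomials there.\<close>
  have cancel: "C * x / y = x * R" if "y \<noteq> 0" "C = y * R" for C x y R :: real
    using that by simp
  have pole_a: "A * a / (1 - a) + B * a / (1 + a) = a * (c - 2 - s * \<alpha>) / 2"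
  proof -
    have "A = (1 - a) * (((s + c - 2) * (1 - \<alpha>)) / 4)" "B = (1 + a) * (((c - 2 - s) * (1 + \<alpha>)) / 4)"
      unfolding A Qm Qp by simp_all
    from cancel[OF _ this(1), of a] cancel[OF _ this(2), of a]
    have e: "A * a / (1 - a) = a * (((s + c - 2) * (1 - \<alpha>)) / 4)" "B * a / (1 + a) = a * (((c - 2 - s) * (1 + \<alpha>)) / 4)"
      using ord bb by auto
    show ?thesis unfolding e by (simp add: field_simps)
  qed
  have pole_\<alpha>: "A * \<alpha> / (1 - \<alpha>) + B * \<alpha> / (1 + \<alpha>) = \<alpha> * (c - 2 - s * a) / 2"
  proof -
    have "A = (1 - \<alpha>) * (((s + c - 2) * (1 - a)) / 4)" "B = (1 + \<alpha>) * (((c - 2 - s) * (1 + a)) / 4)"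
      unfolding A Qm Qp by simp_all
    from cancel[OF _ this(1), of \<alpha>] cancel[OF _ this(2), of \<alpha>]
    have e: "A * \<alpha> / (1 - \<alpha>) = \<alpha> * (((s + c - 2) * (1 - a)) / 4)" "B * \<alpha> / (1 + \<alpha>) = \<alpha> * (((c - 2 - s) * (1 + a)) / 4)"
      using ord bb by auto
    show ?thesis unfolding e by (simp add: field_simps)
  qed
  have pole_b: "A * b / (1 - b) + B * b / (1 + b) = b * (1 + p) / 2 + s * (c - 3) / 2"
  proof -
    have "A = (1 - b) * (((1 - \<beta>) * (1 - s + p)) / 4)" "B = (1 + b) * (((1 + \<beta>) * (1 + s + p)) / 4)"
      unfolding A q by simp_all
    from cancel[OF _ this(1), of b] cancel[OF _ this(2), of b]
    have e: "A * b / (1 - b) = b * (((1 - \<beta>) * (1 - s + p)) / 4)" "B * b / (1 + b) = b * (((1 + \<beta>) * (1 + s + p)) / 4)"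
      using ord bb by auto
    show ?thesis unfolding e pb[symmetric] by (simp add: field_simps)
  qed
  have pole_\<beta>: "A * \<beta> / (1 - \<beta>) + B * \<beta> / (1 + \<beta>) = \<beta> * (1 + p) / 2 + s * (c - 3) / 2"
  proof -
    have "A = (1 - \<beta>) * (((1 - b) * (1 - s + p)) / 4)" "B = (1 + \<beta>) * (((1 + b) * (1 + s + p)) / 4)"
      unfolding A q by simp_all
    from cancel[OF _ this(1), of \<beta>] cancel[OF _ this(2), of \<beta>]
    have e: "A * \<beta> / (1 - \<beta>) = \<beta> * (((1 - b) * (1 - s + p)) / 4)" "B * \<beta> / (1 + \<beta>) = \<beta> * (((1 + b) * (1 + s + p)) / 4)"
      using ord bb by auto
    show ?thesis unfolding e pb[symmetric] by (simp add: field_simps)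
  qed
  have eq1': "2 * s * ((3 - p)\<^sup>2 - s\<^sup>2) + (lam - mu) * (d\<^sup>2 * d) = 0"
    using eq1 unfolding s_def p_def d_def by (simp add: power2_eq_square power3_eq_cube algebra_simps)
  have "\<kappa> * (1 - p) = c * (1 - p) * d / 4" by (simp add: \<kappa>)
  then have \<kappa>p: "\<kappa> * (1 - p) = d\<^sup>2 * d / 4" unfolding cp d2 .
  have sum: "s * (p + c - 9) / 2 = (lam - mu) * \<kappa>"
  proof -
    have "(s * (p + c - 9) / 2) * (1 - p) = s * (p * (1 - p) + c * (1 - p) - 9 * (1 - p)) / 2"
      by (simp add: algebra_simps)
    also have "\<dots> = - (s * ((3 - p)\<^sup>2 - s\<^sup>2)) / 2" unfolding cp by (simp add: power2_eq_square algebra_simps)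
    also have "\<dots> = (lam - mu) * (d\<^sup>2 * d) / 4" using eq1' by simp
    also have "\<dots> = ((lam - mu) * \<kappa>) * (1 - p)" by (simp add: mult.assoc \<kappa>p)
    finally show ?thesis using p by simp
  qed
  have "b - \<beta> = (lam + mu) * \<kappa> * 2 / (3 + p)"
  \<comment> \<open>The second equation determines only the square, and both sides are nonnegative.
    Its right-hand side turns into the discriminant through \<Delta> (1 - p) = (3 + p) (4 -
    s^2).\<close>
  proof (rule power2_eq_imp_eq)
    define m where "m = 3 + p"
    have m: "0 < m" using p1 by (simp add: m_def)
    have e: "(lam + mu)\<^sup>2 * d ^ 6 = 4 * m ^ 3 * (1 - p) * (4 - s\<^sup>2)"
      using eq2 unfolding d_def[symmetric] p_def[symmetric] m_def
      by (simp add: s_def power2_eq_square algebra_simps)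
    have "((lam + mu) * \<kappa> * 2)\<^sup>2 * (1 - p)\<^sup>2 = (lam + mu)\<^sup>2 * 4 * (\<kappa> * (1 - p))\<^sup>2"
      by (simp add: power_mult_distrib)
    also have "(\<kappa> * (1 - p))\<^sup>2 = d ^ 6 / 16" unfolding \<kappa>p by (simp add: power2_eq_square eval_nat_numeral)
    also have "(lam + mu)\<^sup>2 * 4 * (d ^ 6 / 16) = ((lam + mu)\<^sup>2 * d ^ 6) / 4" by simp
    also have "\<dots> = m ^ 3 * (1 - p) * (4 - s\<^sup>2)" unfolding e by simp
    also have "\<dots> = m\<^sup>2 * (1 - p) * (\<Delta> * (1 - p))"
    proof -
      have "\<Delta> * (1 - p) = s\<^sup>2 * (1 - p) - 4 * (c * (1 - p)) + 12 * (1 - p)" by (simp add: \<Delta>_def algebra_simps)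
      also have "\<dots> = m * (4 - s\<^sup>2)" unfolding cp m_def by (simp add: algebra_simps)
      finally show ?thesis by (simp add: power2_eq_square power3_eq_cube)
    qed
    finally have "((lam + mu) * \<kappa> * 2)\<^sup>2 = m\<^sup>2 * \<Delta>" using p by (simp add: power2_eq_square)
    then show "(b - \<beta>)\<^sup>2 = ((lam + mu) * \<kappa> * 2 / (3 + p))\<^sup>2"
      using m \<Delta> unfolding diff m_def[symmetric] by (simp add: power_divide)
    show "0 \<le> b - \<beta>" using lt by simp
    show "0 \<le> (lam + mu) * \<kappa> * 2 / (3 + p)" using lm c0 d p1 by (simp add: \<kappa>)
  qed
  then have dif: "(b - \<beta>) * (3 + p) / 2 = (lam + mu) * \<kappa>" using p1 by (simp add: field_simps)
  have "three_sheets lam mu \<alpha> a \<beta> b A B h \<kappa>"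
  proof
    show "1 < lam" "1 < mu" "0 < \<kappa>" "\<beta> < -1" "-1 < \<alpha>" "\<alpha> < a" "a < 1" "1 < b"
      using lm ord bb c0 d by (simp_all add: \<kappa>)
    show "\<beta> + \<alpha> + a + b = 0" by (simp add: sb s_def)
    have e: "\<beta> * \<alpha> + a * b + (\<beta> + \<alpha>) * (a + b) = p + \<beta> * b + (\<beta> + b) * s"
      "\<beta> * \<alpha> * (a + b) + (\<beta> + \<alpha>) * (a * b) = p * (\<beta> + b) + (\<beta> * b) * s"
      "\<beta> * \<alpha> * (a * b) = p * (\<beta> * b)" by (simp_all add: s_def p_def algebra_simps)
    have sb': "\<beta> + b = - s" by (simp add: sb)
    show "A + B - 2 = \<beta> * \<alpha> + a * b + (\<beta> + \<alpha>) * (a + b)"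
      unfolding e sb' pb AB using cp by (simp add: power2_eq_square field_simps)
    show "2 * (B - A) = \<beta> * \<alpha> * (a + b) + (\<beta> + \<alpha>) * (a * b)"
      unfolding e sb' pb AB by (simp add: field_simps)
    have "1 + (A + B) = p * (c - 3)"
      unfolding AB using cp by (simp add: power2_eq_square field_simps)
    then show "1 + A + B = \<beta> * \<alpha> * (a * b)" unfolding e pb by simp
    have "h + a + a * (c - 2 - s * \<alpha>) / 2 = \<kappa>" "h + \<alpha> + \<alpha> * (c - 2 - s * a) / 2 = - \<kappa>"
      unfolding h \<kappa> by (simp_all add: s_def p_def d_def field_simps)
    then show "h + \<alpha> + A * \<alpha> / (1 - \<alpha>) + B * \<alpha> / (1 + \<alpha>) = - \<kappa>"
      "h + a + A * a / (1 - a) + B * a / (1 + a) = \<kappa>"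
      using pole_a pole_\<alpha> by linarith+
    have "2 * (h + b + b * (1 + p) / 2 + s * (c - 3) / 2) = s * (p + c - 9) / 2 + (b - \<beta>) * (3 + p) / 2"
      "2 * (h + \<beta> + \<beta> * (1 + p) / 2 + s * (c - 3) / 2) = s * (p + c - 9) / 2 - (b - \<beta>) * (3 + p) / 2"
      unfolding h sb by (simp_all add: field_simps)
    then have "h + b + (b * (1 + p) / 2 + s * (c - 3) / 2) = lam * \<kappa>"
      "h + \<beta> + (\<beta> * (1 + p) / 2 + s * (c - 3) / 2) = - mu * \<kappa>"
    proof -
      assume e: "2 * (h + b + b * (1 + p) / 2 + s * (c - 3) / 2) = s * (p + c - 9) / 2 + (b - \<beta>) * (3 + p) / 2"
        "2 * (h + \<beta> + \<beta> * (1 + p) / 2 + s * (c - 3) / 2) = s * (p + c - 9) / 2 - (b - \<beta>) * (3 + p) / 2"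
      have dl: "(lam - mu) * \<kappa> = lam * \<kappa> - mu * \<kappa>" "(lam + mu) * \<kappa> = lam * \<kappa> + mu * \<kappa>"
        by (rule left_diff_distrib, rule distrib_right)
      have half: "x + y + (u + v) = l" if "2 * (x + y + u + v) = l - m + (l + m)" for x y u v l m :: real
        using that by simp
      have half': "x + y + (u + v) = - m" if "2 * (x + y + u + v) = l - m - (l + m)" for x y u v l m :: real
        using that by simp
      show "h + b + (b * (1 + p) / 2 + s * (c - 3) / 2) = lam * \<kappa>"
        by (rule half[OF e(1)[unfolded sum dif dl]])
      show "h + \<beta> + (\<beta> * (1 + p) / 2 + s * (c - 3) / 2) = - mu * \<kappa>"
        unfolding mult_minus_left by (rule half'[OF e(2)[unfolded sum dif dl]])
    qed
    then show "h + \<beta> + A * \<beta> / (1 - \<beta>) + B * \<beta> / (1 + \<beta>) = - mu * \<kappa>"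
      "h + b + A * b / (1 - b) + B * b / (1 + b) = lam * \<kappa>"
      using pole_b pole_\<beta> by linarith+
  qed
  moreover have "x\<^sup>2 + (a + \<alpha>) * x + (a - \<alpha>)\<^sup>2 / (1 - a * \<alpha>) - 3 = (x - \<beta>) * (x - b)" for x
    using roots[of x] by (simp add: s_def p_def d_def c_def)
  ultimately show thesis
    using that[of \<beta> b] bb unfolding A_def B_def h_def \<kappa>_def by simp
qed

lemma three_sheets_unique:
  assumes "three_sheets lam mu \<alpha> a \<beta> b A B h \<kappa>" "three_sheets lam mu \<alpha>' a' \<beta>' b' A' B' h' \<kappa>'"
  shows "\<alpha> = \<alpha>' \<and> a = a'"
proof -
  interpret S: three_sheets lam mu \<alpha> a \<beta> b A B h \<kappa> by fact
  interpret T: three_sheets lam mu \<alpha>' a' \<beta>' b' A' B' h' \<kappa>' by fact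
  have eq: "emob (1 / of_real \<kappa>) (1 / of_real \<kappa>) 0 1 (S.Phi p) = emob (1 / of_real \<kappa>') (1 / of_real \<kappa>') 0 1 (T.Phi p)"
    if "p \<in> R_pts lam mu" for p
    using T.psi_1_unique[OF S.is_psi_1[of "\<lambda>p. emob (1 / of_real \<kappa>) (1 / of_real \<kappa>) 0 1 (S.Phi p)"] that] by simp
  \<comment> \<open>Three test points: at infinity on sheet 2 both maps \<open>Phi\<close> are 1,
    which gives kappa; the branch points over 1 and -1 then give a and \<alpha>.\<close>
  have pt: "(2, None) \<in> R_pts lam mu" "(1, Some 1) \<in> R_pts lam mu" "(0, Some (- 1)) \<in> R_pts lam mu"
    using S.lam S.mu by (auto simp: R_pts_iff complex_eq_iff)
  have "S.Phi (2, None) = Some 1" "T.Phi (2, None) = Some 1"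
    using S.Phi_inv(2)[of "Some 1"] T.Phi_inv(2)[of "Some 1"] S.Phi_inv_infinity T.Phi_inv_infinity by simp_all
  then have "2 / complex_of_real \<kappa> = 2 / complex_of_real \<kappa>'" using eq[OF pt(1)] by (simp add: emob_def)
  then have \<kappa>: "\<kappa> = \<kappa>'" using S.\<kappa> T.\<kappa> by (simp add: frac_eq_eq flip: of_real_mult)
  have "S.Phi (1, Some 1) = Some (of_real a)" "T.Phi (1, Some 1) = Some (of_real a')"
    using S.branch_crit(5)[of 1] T.branch_crit(5)[of 1] by (simp_all add: S.Phi_def T.Phi_def)
  moreover have "S.Phi (0, Some (- 1)) = Some (of_real \<alpha>)" "T.Phi (0, Some (- 1)) = Some (of_real \<alpha>')"
    using S.branch_crit(3)[of 1] T.branch_crit(3)[of 1] by (simp_all add: S.Phi_def T.Phi_def)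
  ultimately show ?thesis
    using eq[OF pt(2)] eq[OF pt(3)] S.\<kappa> unfolding \<kappa> by (auto simp: emob_def add_divide_distrib[symmetric])
qed

context three_sheets begin

text \<open>Lets kappa replace the number H(a) that occurs in the theorem.\<close>

lemma H_a:
  "complex_of_real h + of_real a + of_real A * of_real a / (1 - of_real a) + of_real B * of_real a / (1 + of_real a)
     = of_real \<kappa>"
proof -
  have "complex_of_real h + of_real a + of_real A * of_real a / (1 - of_real a) + of_real B * of_real a / (1 + of_real a)
     = of_real (h + a + A * a / (1 - a) + B * a / (1 + a))" by simp
  then show ?thesis unfolding critical_values .
qed

lemma uniformization:
  "rational_of_degree 3 G \<and>
    (\<exists>g :: ecomplex \<Rightarrow> rpt. homeomorphic_map ext_top (R_top lam mu) g \<and> (\<forall>w. proj (g w) = Gext w) \<and>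
      (let F1 = (\<lambda>p. emob (1 / of_real \<kappa>) (1 / of_real \<kappa>) 0 1 (inv_into UNIV g p));
           F2 = (\<lambda>p. emob (of_real A / (2 * of_real \<kappa>)) (of_real A / (2 * of_real \<kappa>)) (- 1) 1 (inv_into UNIV g p))
       in is_psi lam mu 1 F1 \<and> (\<forall>f. is_psi lam mu 1 f \<longrightarrow> (\<forall>p\<in>R_pts lam mu. f p = F1 p)) \<and>
          is_psi lam mu 2 F2 \<and> (\<forall>f. is_psi lam mu 2 f \<longrightarrow> (\<forall>p\<in>R_pts lam mu. f p = F2 p))))"
proof -
  \<comment> \<open>The range of \<open>Phi_inv\<close> is \<open>R_pts\<close>, so the inverse
    chosen by \<open>inv_into\<close> is determined exactly there.\<close>
  have Ginv: "inv_into UNIV Phi_inv p = Phi p" if "p \<in> R_pts lam mu" for p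
  proof -
    have "inj Phi_inv" using Phi_inv_eq_iff by (auto intro: injI)
    then show ?thesis using Phi_inv(3)[OF that] by (metis inv_into_f_f UNIV_I)
  qed
  have proj: "proj (Phi_inv w) = Gext w" for w
    using Gext_Phi[OF Phi_inv(1)] Phi_inv(2) by (simp add: proj_def)
  show ?thesis
    unfolding Let_def
    by (intro conjI exI[of _ Phi_inv] rational_G homeomorphic_map_Phi_inv allI impI ballI proj is_psi_1 is_psi_2)
       (simp_all add: Ginv psi_1_unique psi_2_unique)
qed

end

theorem theorem3p1:
  fixes lam mu :: real
  assumes "lam > 1" and "mu > 1"
  shows
   "(\<exists>!p :: real \<times> real.
       (let \<alpha> = fst p; a = snd p in
         2 * (a + \<alpha>) * (3 - a * \<alpha> - a - \<alpha>) * (3 - a * \<alpha> + a + \<alpha>) + (lam - mu) * (a - \<alpha>) ^ 3 = 0 \<and>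
         (lam + mu)\<^sup>2 * (a - \<alpha>) ^ 6 = 4 * (3 + a * \<alpha>) ^ 3 * (1 - a * \<alpha>) * (2 + a + \<alpha>) * (2 - a - \<alpha>) \<and>
         -1 < \<alpha> \<and> \<alpha> < a \<and> a < 1)) \<and>
    (\<forall>\<alpha> a :: real.
       2 * (a + \<alpha>) * (3 - a * \<alpha> - a - \<alpha>) * (3 - a * \<alpha> + a + \<alpha>) + (lam - mu) * (a - \<alpha>) ^ 3 = 0 \<and>
       (lam + mu)\<^sup>2 * (a - \<alpha>) ^ 6 = 4 * (3 + a * \<alpha>) ^ 3 * (1 - a * \<alpha>) * (2 + a + \<alpha>) * (2 - a - \<alpha>) \<and>
       -1 < \<alpha> \<and> \<alpha> < a \<and> a < 1 \<longrightarrow>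
       (\<exists>\<beta> b :: real. \<beta> < -1 \<and> 1 < b \<and>
          \<beta>\<^sup>2 + (a + \<alpha>) * \<beta> + (a - \<alpha>)\<^sup>2 / (1 - a * \<alpha>) - 3 = 0 \<and>
          b\<^sup>2 + (a + \<alpha>) * b + (a - \<alpha>)\<^sup>2 / (1 - a * \<alpha>) - 3 = 0 \<and>
          (let h = (1/4) * (a + \<alpha>) * (2 * a * \<alpha> - (a - \<alpha>)\<^sup>2 / (1 - a * \<alpha>));
               A = (1/4) * (1 - \<beta>) * (1 - \<alpha>) * (1 - a) * (1 - b);
               B = (1/4) * (1 + \<beta>) * (1 + \<alpha>) * (1 + a) * (1 + b);
               H = (\<lambda>z::complex. complex_of_real h + z + complex_of_real A * z / (1 - z)
                                  + complex_of_real B * z / (1 + z));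
               Ha = H (complex_of_real a);
               G = (\<lambda>z. H z / Ha);
               Gext = (\<lambda>w::ecomplex. case w of None \<Rightarrow> None
                          | Some z \<Rightarrow> (if z = 1 \<or> z = -1 then None else Some (G z)))
           in rational_of_degree 3 G \<and>
              (\<exists>g :: ecomplex \<Rightarrow> rpt.
                 homeomorphic_map ext_top (R_top lam mu) g \<and>
                 (\<forall>w. proj (g w) = Gext w) \<and>
                 (let Ginv = inv_into UNIV g;
                      F1 = (\<lambda>p. emob (1 / Ha) (1 / Ha) 0 1 (Ginv p));
                      F2 = (\<lambda>p. emob (complex_of_real A / (2 * Ha)) (complex_of_real A / (2 * Ha))
                                      (-1) 1 (Ginv p))
                  in is_psi lam mu 1 F1 \<and> (\<forall>f. is_psi lam mu 1 f \<longrightarrow> (\<forall>p\<in>R_pts lam mu. f p = F1 p)) \<and>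
                     is_psi lam mu 2 F2 \<and> (\<forall>f. is_psi lam mu 2 f \<longrightarrow> (\<forall>p\<in>R_pts lam mu. f p = F2 p)))))))"
proof -
  define sol where "sol \<alpha> a \<longleftrightarrow>
      2 * (a + \<alpha>) * (3 - a * \<alpha> - a - \<alpha>) * (3 - a * \<alpha> + a + \<alpha>) + (lam - mu) * (a - \<alpha>) ^ 3 = 0 \<and>
      (lam + mu)\<^sup>2 * (a - \<alpha>) ^ 6 = 4 * (3 + a * \<alpha>) ^ 3 * (1 - a * \<alpha>) * (2 + a + \<alpha>) * (2 - a - \<alpha>) \<and>
      -1 < \<alpha> \<and> \<alpha> < a \<and> a < 1" for \<alpha> a
  have ex: "\<exists>\<alpha> a. sol \<alpha> a" unfolding sol_def by (rule system_solvable[OF assms])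
  have unique: "\<alpha> = \<alpha>' \<and> a = a'" if "sol \<alpha> a" "sol \<alpha>' a'" for \<alpha> a \<alpha>' a'
    using that unfolding sol_def
    by (elim conjE) (rule three_sheets_of_solution[OF assms, of \<alpha> a], assumption+,
        rule three_sheets_of_solution[OF assms, of \<alpha>' a'], assumption+, rule three_sheets_unique)
  show ?thesis
    unfolding sol_def[symmetric]
  proof (intro conjI allI impI, goal_cases)
    case 1
    show ?case
      unfolding Let_def using ex unique by (metis prod.collapse fst_conv snd_conv)
  next
    case (2 \<alpha> a)
    then have s: "-1 < \<alpha>" "\<alpha> < a" "a < 1"
      "2 * (a + \<alpha>) * (3 - a * \<alpha> - a - \<alpha>) * (3 - a * \<alpha> + a + \<alpha>) + (lam - mu) * (a - \<alpha>) ^ 3 = 0"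
      "(lam + mu)\<^sup>2 * (a - \<alpha>) ^ 6 = 4 * (3 + a * \<alpha>) ^ 3 * (1 - a * \<alpha>) * (2 + a + \<alpha>) * (2 - a - \<alpha>)"
      by (simp_all only: sol_def)
    obtain \<beta> b where \<beta>b: "\<beta> < - 1" "1 < b"
      "\<beta>\<^sup>2 + (a + \<alpha>) * \<beta> + (a - \<alpha>)\<^sup>2 / (1 - a * \<alpha>) - 3 = 0"
      "b\<^sup>2 + (a + \<alpha>) * b + (a - \<alpha>)\<^sup>2 / (1 - a * \<alpha>) - 3 = 0"
      and S: "three_sheets lam mu \<alpha> a \<beta> b ((1/4) * (1 - \<beta>) * (1 - \<alpha>) * (1 - a) * (1 - b))
       ((1/4) * (1 + \<beta>) * (1 + \<alpha>) * (1 + a) * (1 + b))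
       ((1/4) * (a + \<alpha>) * (2 * a * \<alpha> - (a - \<alpha>)\<^sup>2 / (1 - a * \<alpha>)))
       ((a - \<alpha>)\<^sup>2 / (1 - a * \<alpha>) * (a - \<alpha>) / 4)"
      by (rule three_sheets_of_solution[OF assms s])
    interpret S: three_sheets lam mu \<alpha> a \<beta> b "(1/4) * (1 - \<beta>) * (1 - \<alpha>) * (1 - a) * (1 - b)"
      "(1/4) * (1 + \<beta>) * (1 + \<alpha>) * (1 + a) * (1 + b)"
      "(1/4) * (a + \<alpha>) * (2 * a * \<alpha> - (a - \<alpha>)\<^sup>2 / (1 - a * \<alpha>))"
      "(a - \<alpha>)\<^sup>2 / (1 - a * \<alpha>) * (a - \<alpha>) / 4"
      by (fact S)
    show ?case
      by (rule exI[of _ \<beta>], rule exI[of _ b],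
          rule conjI[OF \<beta>b(1) conjI[OF \<beta>b(2) conjI[OF \<beta>b(3) conjI[OF \<beta>b(4)]]]],
          unfold Let_def S.H_a S.G_def[symmetric] S.Gext_def[symmetric],
          rule S.uniformization[unfolded Let_def])
  qed
qed

end
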